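(* Let $u\in[\frac12,1)$ and $\mathcal{L}\in\mathcal{N}(u)$. Suppose that the Dirichlet series expansion of $\mathcal{L}$ satisfies the Ramanujan hypothesis. Let $\alpha\in(u,1]$ and $l>0$. Then there exists an $l$-set $A\subset[1,\infty)$ of density zero such that, for every $k\in\mathbb{N}$ and uniformly for $\sigma\in[\alpha,2]$, $$\lim_{T\to\infty}\frac1T\int_1^T|\mathcal{L}(\sigma+it)|^{2k}\,\mathbf{1}_{A^c}(t)\,dt=\sum_{n=1}^\infty\frac{|a_k(n)|^2}{n^{2\sigma}}$$ and $$\lim_{T\to\infty}\frac1T\int_1^T\mathcal{L}^k(\sigma+it)\,\mathbf{1}_{A^c}(t)\,dt=a_k(1),$$ where the $a_k(n)$ denote the coefficients of the Dirichlet series expansion of $\mathcal{L}^k$. If $\mathcal{L}$ can be written additionally as a polynomial Euler product in $\sigma>1$, then there is an $l$-set $A\subset[1,\infty)$ of density zero such that, for every $k\in\mathbb{N}$, uniformly for $\sigma\in[\alpha,2]$, $$\lim_{T\to\infty}\frac1T\int_1^T|\mathcal{L}(\sigma+it)|^{-2k}\,\mathbf{1}_{A^c}(t)\,dt=\sum_{n=1}^\infty\frac{|a_{-k}(n)|^2}{n^{2\sigma}},$$ $$\lim_{T\to\infty}\frac1T\int_1^T|\log\mathcal{L}(\sigma+it)|^2\,\mathbf{1}_{A^c}(t)\,dt=\sum_{n=1}^\infty\frac{|a_{\log\mathcal{L}}(n)|^2}{n^{2\sigma}}$$ and $$\lim_{T\to\infty}\frac1T\int_1^T\left|\frac{\mathcal{L}'(\sigma+it)}{\mathcal{L}(\sigma+it)}\right|^2\mathbf{1}_{A^c}(t)\,dt=\sum_{n=1}^\infty\frac{|\Lambda_{\mathcal{L}}(n)|^2}{n^{2\sigma}},$$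 where $a_{-k}(n)$, $a_{\log\mathcal{L}}(n)$ and $\Lambda_{\mathcal{L}}(n)$ denote the coefficients of the Dirichlet series expansion of $\mathcal{L}^{-k}$, $\log\mathcal{L}$ and $\mathcal{L}'/\mathcal{L}$, respectively.
   Context: $\mathbf{1}_X$ is the indicator function of $X\subset\mathbb{R}$, $X^c=\mathbb{R}\setminus X$, $\mathbb{N}=\{1,2,\dots\}$. For $J\subset\mathbb{N}$, $\mathrm{dens}_*J$ is the lower limit of $\#(J\cap[1,N])/N$ as $N\to\infty$; $\mathrm{dens}\,J$ is the limit if it exists. A set $A\subset[1,\infty)$ is an $l$-set of density zero if $A=\bigcup_{n\in J}[nl,(n+1)l)$ for some $J\subset\mathbb{N}$ with $\mathrm{dens}\,J=0$. The class $\mathcal{N}(u)$, $u\in[\frac12,1)$: functions $\mathcal{L}$ on the half-plane $\sigma>1$ such that (N.1) $\mathcal{L}(s)=\sum_{n\ge1}a(n)n^{-s}$ for $\sigma>1$ with $\sum_n|a(n)|^2n^{-\sigma}<\infty$ for every $\sigma>1$; (N.2) for all $\alpha\in(u,1]$ and $l,\varepsilon>0$ there is $J_\varepsilon\subset\mathbb{N}$ with $\mathrm{dens}_*J_\varepsilon>1-\varepsilon$ such that for every $n\in J_\varepsilon$ the function $s\mapsto\mathcal{L}(s+inl)$ extends to an analytic function on $Q(\alpha,l):=\{\sigma+it:\sigma>\alpha,\,-l<t<2l\}$, and the family of these functions, $n\in J_\varepsilon$, is normal in $Q(\alpha,l)$ (every sequence has a subsequence converging locally uniformly in the chordal metric).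 $\mathcal{L}(\sigma+it)$ denotes the value of the analytic continuation of $\mathcal{L}$. Ramanujan hypothesis: $a(n)\ll_\varepsilon n^\varepsilon$ for every $\varepsilon>0$. Polynomial Euler product: there are $m\in\mathbb{N}$ and complex numbers $\alpha_1(p),\dots,\alpha_m(p)$ with $\mathcal{L}(s)=\prod_p\prod_{j=1}^m(1-\alpha_j(p)p^{-s})^{-1}$ (over primes $p$) for $\sigma>1$. In this case $\log\mathcal{L}$ is the analytic logarithm of $\mathcal{L}$ in $\sigma>1$ normalized by $\lim_{\sigma\to+\infty}\log\mathcal{L}(\sigma)=0$, extended analytically to simply connected zero-free domains meeting a right half-plane. All Dirichlet series expansions mentioned are those valid in $\sigma>1$.
   Formalization: The l-set A is a union of blocks [nl,(n+1)l) intersected with [1,∞), with n = 0 allowed, so it may contain the part of [1,∞) before the first multiple of l; with whole blocks and n ≥ 1 the claim fails, e.g. for ζ(s−3i/2), l = 2, whose pole 1+3i/2 no block covers. *)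

theory Defs
  imports "HOL-Complex_Analysis.Complex_Analysis" "HOL-Library.Landau_Symbols"
begin

section \<open>Densities and \<open>l\<close>-sets\<close>

text \<open>Densities are relative to the positive integers; whether \<open>0 \<in> J\<close> is irrelevant.\<close>

definition lower_dens :: "nat set \<Rightarrow> ereal" where
  "lower_dens J = liminf (\<lambda>N. ereal (real (card (J \<inter> {1..N})) / real N))"

definition has_dens :: "nat set \<Rightarrow> real \<Rightarrow> bool" where
  "has_dens J d \<longleftrightarrow> (\<lambda>N. real (card (J \<inter> {1..N})) / real N) \<longlonglongrightarrow> d"

text \<open>
  The union is cut off at \<open>1\<close> and the block \<open>n = 0\<close> is admitted.  If \<open>1\<close> is not a
  multiple of \<open>l\<close>, then no union of full blocks with \<open>n \<ge> 1\<close> that lies in \<open>[1,\<infinity>)\<close> covers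
  the part of \<open>[1,\<infinity>)\<close> before the first multiple of \<open>l\<close>, where a function of the class
  \<open>class_N u\<close> below may have singularities: consider \<open>\<zeta>(s - 3i/2)\<close> and \<open>l = 2\<close>.
\<close>

definition l_set_density_zero :: "real \<Rightarrow> real set \<Rightarrow> bool" where
  "l_set_density_zero l A \<longleftrightarrow>
     (\<exists>J. has_dens J 0 \<and> A = {1..} \<inter> (\<Union>n\<in>J. {real n * l ..< (real n + 1) * l}))"

section \<open>Dirichlet series and Euler products\<close>

text \<open>Coefficients are indexed by \<open>n \<ge> 1\<close>; the value \<open>b 0\<close> is never used.\<close>

definition has_dirichlet_expansion :: "(complex \<Rightarrow> complex) \<Rightarrow> (nat \<Rightarrow> complex) \<Rightarrow> bool" where
  "has_dirichlet_expansion f b \<longleftrightarrow>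
     (\<forall>s. Re s > 1 \<longrightarrow> (\<lambda>n. b (Suc n) / of_nat (Suc n) powr s) sums f s)"

definition ramanujan_hypothesis :: "(nat \<Rightarrow> complex) \<Rightarrow> bool" where
  "ramanujan_hypothesis a \<longleftrightarrow> (\<forall>\<epsilon>>0. (\<lambda>n. cmod (a n)) \<in> O(\<lambda>n. real n powr \<epsilon>))"

definition polynomial_euler_product :: "(complex \<Rightarrow> complex) \<Rightarrow> bool" where
  "polynomial_euler_product L \<longleftrightarrow>
     (\<exists>m\<ge>1. \<exists>\<beta> :: nat \<Rightarrow> nat \<Rightarrow> complex. \<forall>s. Re s > 1 \<longrightarrow>
        (\<forall>p. prime p \<longrightarrow> (\<forall>j\<in>{1..m}. 1 - \<beta> j p / of_nat p powr s \<noteq> 0)) \<and>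
        (\<lambda>p. if prime p then \<Prod>j=1..m. inverse (1 - \<beta> j p / of_nat p powr s) else 1)
          has_prod L s)"

text \<open>Only the values on \<open>Re s > 1\<close> are constrained; there \<open>lg\<close> is uniquely determined.\<close>

definition is_normalized_log :: "(complex \<Rightarrow> complex) \<Rightarrow> (complex \<Rightarrow> complex) \<Rightarrow> bool" where
  "is_normalized_log L lg \<longleftrightarrow>
     lg holomorphic_on {s. Re s > 1} \<and>
     (\<forall>s. Re s > 1 \<longrightarrow> exp (lg s) = L s) \<and>
     ((\<lambda>\<sigma>. lg (complex_of_real \<sigma>)) \<longlongrightarrow> 0) at_top"

section \<open>Normal families in the chordal metric\<close>

text \<open>The Riemann sphere is \<open>complex option\<close>, with \<open>None\<close> the point at infinity.\<close>

fun chordal :: "complex option \<Rightarrow> complex option \<Rightarrow> real" where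
  "chordal (Some z) (Some w) = 2 * cmod (z - w) / (sqrt (1 + cmod z ^ 2) * sqrt (1 + cmod w ^ 2))"
| "chordal (Some z) None = 2 / sqrt (1 + cmod z ^ 2)"
| "chordal None (Some w) = 2 / sqrt (1 + cmod w ^ 2)"
| "chordal None None = 0"

definition chordal_normal_family :: "complex set \<Rightarrow> (complex \<Rightarrow> complex) set \<Rightarrow> bool" where
  "chordal_normal_family \<Omega> \<F> \<longleftrightarrow>
     (\<forall>f :: nat \<Rightarrow> complex \<Rightarrow> complex. range f \<subseteq> \<F> \<longrightarrow>
        (\<exists>r g. strict_mono r \<and>
           (\<forall>K. compact K \<and> K \<subseteq> \<Omega> \<longrightarrow>
              (\<forall>e>0. \<forall>\<^sub>F j in sequentially. \<forall>z\<in>K. chordal (Some (f (r j) z)) (g z) < e))))"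

section \<open>The class \<open>\<N>(u)\<close>\<close>

definition Q_rect :: "real \<Rightarrow> real \<Rightarrow> complex set" where
  "Q_rect \<alpha> l = {s. Re s > \<alpha> \<and> - l < Im s \<and> Im s < 2 * l}"

text \<open>Only the values of \<open>L\<close> on \<open>Re s > 1\<close> matter.\<close>

definition class_N :: "real \<Rightarrow> (complex \<Rightarrow> complex) \<Rightarrow> bool" where
  "class_N u L \<longleftrightarrow>
     (\<exists>a. has_dirichlet_expansion L a \<and>
        (\<forall>\<sigma>>1. summable (\<lambda>n. cmod (a (Suc n)) ^ 2 / real (Suc n) powr \<sigma>))) \<and>
     (\<forall>\<alpha> l \<epsilon>. u < \<alpha> \<and> \<alpha> \<le> 1 \<and> l > 0 \<and> \<epsilon> > 0 \<longrightarrow>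
        (\<exists>J \<subseteq> {1..}. lower_dens J > ereal (1 - \<epsilon>) \<and>
           (\<exists>G :: nat \<Rightarrow> complex \<Rightarrow> complex.
              (\<forall>n\<in>J. G n holomorphic_on Q_rect \<alpha> l \<and>
                 (\<forall>s\<in>Q_rect \<alpha> l. Re s > 1 \<longrightarrow> G n s = L (s + \<i> * of_real (real n * l)))) \<and>
              chordal_normal_family (Q_rect \<alpha> l) (G ` J))))"

section \<open>Analytic continuation\<close>

text \<open>
  Functions given on \<open>Re s > 1\<close> are continued to the left along horizontal strips.  This is the
  continuation provided by the definition of \<open>class_N\<close>, and the one that gives the
  logarithm its values on simply connected zero-free strips.
\<close>

definition right_strip :: "complex \<Rightarrow> real \<Rightarrow> complex set" where
  "right_strip s \<delta> = {z. Re z > Re s - \<delta> \<and> \<bar>Im z - Im s\<bar> < \<delta>}"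

definition continuation_value :: "(complex \<Rightarrow> complex) \<Rightarrow> complex \<Rightarrow> complex \<Rightarrow> bool" where
  "continuation_value f s w \<longleftrightarrow>
     (\<exists>\<delta>>0. \<exists>F. F holomorphic_on right_strip s \<delta> \<and>
        (\<forall>z\<in>right_strip s \<delta>. Re z > 1 \<longrightarrow> F z = f z) \<and> F s = w)"

definition continues_to :: "(complex \<Rightarrow> complex) \<Rightarrow> complex \<Rightarrow> bool" where
  "continues_to f s \<longleftrightarrow> (\<exists>w. continuation_value f s w)"

definition cont :: "(complex \<Rightarrow> complex) \<Rightarrow> complex \<Rightarrow> complex" where
  "cont f s = (THE w. continuation_value f s w)"

lemma continuation_value_unique:
  assumes "continuation_value f s w" "continuation_value f s w'"
  shows "w = w'"
proof -
  obtain d F where F: "d > 0" "F holomorphic_on right_strip s d"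
      "\<And>z. z \<in> right_strip s d \<Longrightarrow> Re z > 1 \<Longrightarrow> F z = f z" "F s = w"
    using assms(1) unfolding continuation_value_def by blast
  obtain d' F' where F': "d' > 0" "F' holomorphic_on right_strip s d'"
      "\<And>z. z \<in> right_strip s d' \<Longrightarrow> Re z > 1 \<Longrightarrow> F' z = f z" "F' s = w'"
    using assms(2) unfolding continuation_value_def by blast
  define e where "e = min d d'"
  define S where "S = right_strip s e"
  have e: "e > 0" "S \<subseteq> right_strip s d" "S \<subseteq> right_strip s d'"
    using F(1) F'(1) by (auto simp: e_def S_def right_strip_def)
  have S_eq: "S = {z. Re z > Re s - e} \<inter> {z. Im z < Im s + e} \<inter> {z. Im z > Im s - e}"
    by (auto simp: S_def right_strip_def)
  have S: "open S" "connected S"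
    unfolding S_eq
    by (intro open_Int open_halfspace_Re_gt open_halfspace_Im_lt open_halfspace_Im_gt
        convex_connected convex_Int convex_halfspace_Re_gt convex_halfspace_Im_lt
        convex_halfspace_Im_gt)+
  define U where "U = S \<inter> {z. Re z > 1}"
  define x where "x = Complex (max 1 (Re s) + 1) (Im s)"
  have U: "open U" "U \<subseteq> S" "x \<in> U"
    using S e by (auto simp: U_def x_def S_eq open_halfspace_Re_gt intro!: open_Int)
  have "x islimpt U"
    using U by (simp add: interior_limit_point interior_open)
  moreover have "(\<lambda>z. F z - F' z) holomorphic_on S"
    by (rule holomorphic_on_diff[OF holomorphic_on_subset[OF F(2) e(2)]
          holomorphic_on_subset[OF F'(2) e(3)]])
  moreover have "F z - F' z = 0" if "z \<in> U" for z
  proof -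
    have "z \<in> right_strip s d" "z \<in> right_strip s d'" "Re z > 1"
      using that e by (auto simp: U_def)
    then show ?thesis
      using F(3) F'(3) by simp
  qed
  moreover have "s \<in> S"
    using e by (simp add: S_eq)
  ultimately have "F s - F' s = 0"
    using S U analytic_continuation[of "\<lambda>z. F z - F' z" S U x s] by blast
  then show ?thesis
    using F F' by simp
qed

lemma cont_eqI: "continuation_value f s w \<Longrightarrow> cont f s = w"
  unfolding cont_def by (rule the_equality) (auto intro: continuation_value_unique)

lemma cont_eq:
  assumes "f holomorphic_on {s. Re s > 1}" "Re s > 1"
  shows "cont f s = f s"
proof (rule cont_eqI)
  have "right_strip s (Re s - 1) \<subseteq> {s. Re s > 1}"
    by (auto simp: right_strip_def)
  then show "continuation_value f s (f s)"
    unfolding continuation_value_def using assms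
    by (intro exI[of _ "Re s - 1"] conjI exI[of _ f]) (auto intro: holomorphic_on_subset)
qed

section \<open>Mean values off an exceptional set\<close>

definition mean_off ::
    "real set \<Rightarrow> (complex \<Rightarrow> 'a :: {banach, second_countable_topology}) \<Rightarrow> real \<Rightarrow> real \<Rightarrow> 'a" where
  "mean_off A f T \<sigma> =
     (1 / T) *\<^sub>R (LINT t:{1..T}|lborel. indicat_real (- A) t *\<^sub>R f (Complex \<sigma> t))"

definition uniform_mean_value ::
    "real \<Rightarrow> real set \<Rightarrow> (complex \<Rightarrow> 'a :: {banach, second_countable_topology})
      \<Rightarrow> (real \<Rightarrow> 'a) \<Rightarrow> bool" where
  "uniform_mean_value \<alpha> A f M \<longleftrightarrow>
     (\<forall>\<sigma>\<in>{\<alpha>..2}. \<forall>T\<ge>1. set_integrable lborel {1..T}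
        (\<lambda>t. indicat_real (- A) t *\<^sub>R f (Complex \<sigma> t))) \<and>
     uniform_limit {\<alpha>..2} (mean_off A f) M at_top"

definition uniform_mean_value_series ::
    "real \<Rightarrow> real set \<Rightarrow> (complex \<Rightarrow> real) \<Rightarrow> (nat \<Rightarrow> complex) \<Rightarrow> bool" where
  "uniform_mean_value_series \<alpha> A f b \<longleftrightarrow>
     (\<forall>\<sigma>\<in>{\<alpha>..2}. summable (\<lambda>n. cmod (b (Suc n)) ^ 2 / real (Suc n) powr (2 * \<sigma>))) \<and>
     uniform_mean_value \<alpha> A f
       (\<lambda>\<sigma>. \<Sum>n. cmod (b (Suc n)) ^ 2 / real (Suc n) powr (2 * \<sigma>))"

end

theory Submission
  imports
    Defs
    "HOL-Real_Asymp.Real_Asymp"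
    "HOL-Computational_Algebra.Squarefree"
begin

text \<open>
  The proof rests on approximating a function by the partial sums \<open>P\<^sub>N\<close> of its Dirichlet series, in
  mean square and uniformly on rectangles: outside a set of blocks \<open>[nl,(n+1)l)\<close> of density zero,
  the means of \<open>|f|\<^sup>2\<close> and \<open>f\<close> are those of \<open>|P\<^sub>N|\<^sup>2\<close> and \<open>P\<^sub>N\<close> up to an error that vanishes as
  \<open>N \<rightarrow> \<infinity>\<close>, and the means of \<open>P\<^sub>N\<close> are elementary.  The exceptional blocks do no harm because
  \<open>P\<^sub>N\<close> is bounded.

  Normality in the chordal metric alone allows poles and the constant \<open>\<infinity>\<close> as limits.  Since \<open>L\<close> is bounded for \<open>Re s \<ge> 2\<close>, a limit is finite somewhere, and
  Hurwitz's theorem applied to the reciprocals shows that the set where it is finite is open and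
  closed (\<open>chordal_normal_family_bounded\<close>).  So the continuation of \<open>L\<close> is bounded on half strips
  along a set of blocks of lower density \<open>> 1 - \<epsilon>\<close>, uniformly in the block
  (\<open>class_N_bounded_blocks\<close>).

  On such blocks consider \<open>h\<^sub>N = f - P\<^sub>N\<close>.  It is uniformly small for \<open>Re s \<ge> 2\<close>.
  Farther to the left the blockwise supremum of \<open>|h\<^sub>N|\<^sup>2\<close> has a mean over the blocks that is bounded
  independently of \<open>N\<close>: Cauchy's formula reduces this to the mean square of \<open>P\<^sub>N\<close> on vertical
  lines, which is controlled by \<open>\<Sum>|b(n)|\<^sup>2 n\<^sup>-\<^sup>2\<^sup>\<sigma>\<close> (\<open>dirichlet_poly_mean_sup\<close>).  A soft form of the
  two-constants theorem interpolates between the two facts, and the mean of the blockwise suprema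
  of \<open>|h\<^sub>N|\<^sup>2\<close> tends to \<open>0\<close> (\<open>mean_sup_vanishes\<close>, \<open>dirichlet_poly_approximation\<close>).

  For a polynomial Euler product the same interpolation, applied to \<open>L B\<^sub>N - 1\<close> with the
  partial sums \<open>B\<^sub>N\<close> of the series of \<open>1/L\<close>, is the argument of Bohr and Landau: on most blocks
  \<open>|L B\<^sub>N - 1| \<le> 1/2\<close>, hence \<open>L\<close> has no zeros and \<open>1/L\<close> is bounded (\<open>zero_free_blocks\<close>).  Cauchy's
  estimate and integration from the right then bound \<open>L'/L\<close> and \<open>log L\<close>.

  All of this needs the Ramanujan bound for the coefficients of the functions in
  question.  It is preserved by Dirichlet convolution, because the number of divisors of \<open>n\<close> is
  \<open>O(n\<^sup>\<epsilon>)\<close>; this gives the powers \<open>L\<^sup>k\<close>.  In the case of an Euler product it forces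
  \<open>|\<alpha>\<^sub>j(p)| \<le> 1\<close>, so that \<open>L\<close> is a product of series with completely multiplicative coefficients,
  which Moebius inversion inverts (\<open>polynomial_euler_product_inverse\<close>); \<open>L'/L\<close> and \<open>log L\<close> follow.

  The bounded blocks depend on \<open>\<epsilon>\<close>, and infinitely many approximations, one
  for every function and every \<open>N\<close>, have to hold off a single set.  A diagonal choice with rapidly
  growing switching times provides it (\<open>diagonal_choice\<close>, \<open>uniform_mean_values_family\<close>).
\<close>

section \<open>Dirichlet series\<close>

lemma ramanujan_hypothesis_iff:
  "ramanujan_hypothesis b \<longleftrightarrow> (\<forall>\<epsilon>>0. \<exists>C. \<forall>n\<ge>1. cmod (b n) \<le> C * real n powr \<epsilon>)"
proof
  assume R: "ramanujan_hypothesis b"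
  show "\<forall>\<epsilon>>0. \<exists>C. \<forall>n\<ge>1. cmod (b n) \<le> C * real n powr \<epsilon>"
  proof (intro allI impI)
    fix \<epsilon> :: real assume "\<epsilon> > 0"
    with R have "(\<lambda>n. cmod (b n)) \<in> O(\<lambda>n. real n powr \<epsilon>)"
      by (simp add: ramanujan_hypothesis_def)
    then obtain C N where C: "C > 0" "\<forall>n\<ge>N. cmod (b n) \<le> C * real n powr \<epsilon>"
      by (elim landau_o.bigE) (auto simp: eventually_sequentially)
    have "cmod (b n) \<le> (C + (\<Sum>m<N. cmod (b m))) * real n powr \<epsilon>" if n: "n \<ge> 1" for n
    proof (cases "n \<ge> N")
      case True
      then have "cmod (b n) \<le> C * real n powr \<epsilon>" using C by auto
      also have "\<dots> \<le> (C + (\<Sum>m<N. cmod (b m))) * real n powr \<epsilon>"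
        by (intro mult_right_mono) (auto intro: sum_nonneg)
      finally show ?thesis .
    next
      case False
      then have "cmod (b n) \<le> (\<Sum>m<N. cmod (b m))"
        by (intro member_le_sum) auto
      also have "\<dots> \<le> (C + (\<Sum>m<N. cmod (b m))) * 1" using C by auto
      also have "\<dots> \<le> (C + (\<Sum>m<N. cmod (b m))) * real n powr \<epsilon>"
        using C n \<open>\<epsilon> > 0\<close> sum_nonneg[of "{..<N}" "\<lambda>m. cmod (b m)"]
        by (intro mult_left_mono ge_one_powr_ge_zero) auto
      finally show ?thesis .
    qed
    then show "\<exists>C. \<forall>n\<ge>1. cmod (b n) \<le> C * real n powr \<epsilon>" by blast
  qed
next
  assume *: "\<forall>\<epsilon>>0. \<exists>C. \<forall>n\<ge>1. cmod (b n) \<le> C * real n powr \<epsilon>"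
  show "ramanujan_hypothesis b"
    unfolding ramanujan_hypothesis_def
  proof (intro allI impI)
    fix \<epsilon> :: real assume "\<epsilon> > 0"
    then obtain C where C: "\<forall>n\<ge>1. cmod (b n) \<le> C * real n powr \<epsilon>" using * by blast
    have *: "cmod (b n) \<le> max C 1 * real n powr \<epsilon>" if "n \<ge> 1" for n
      using C[rule_format, OF that] mult_right_mono[of C "max C 1" "real n powr \<epsilon>"] by simp
    then show "(\<lambda>n. cmod (b n)) \<in> O(\<lambda>n. real n powr \<epsilon>)"
      by (intro landau_o.bigI[where c = "max C 1"] eventually_sequentiallyI[of 1]) simp_all
  qed
qed

lemma ramanujan_bound:
  assumes "ramanujan_hypothesis b" "\<epsilon> > 0"
  obtains C where "C > 0" "\<And>n. n \<ge> 1 \<Longrightarrow> cmod (b n) \<le> C * real n powr \<epsilon>"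
proof -
  obtain C where C: "\<forall>n\<ge>1. cmod (b n) \<le> C * real n powr \<epsilon>"
    using assms ramanujan_hypothesis_iff by blast
  have "cmod (b n) \<le> max C 1 * real n powr \<epsilon>" if "n \<ge> 1" for n
    using C[rule_format, OF that] mult_right_mono[of C "max C 1" "real n powr \<epsilon>"] by simp
  then show ?thesis by (intro that[of "max C 1"]) auto
qed

lemma abs_summable_powr:
  "\<sigma> > 1 \<Longrightarrow> (\<lambda>n. real n powr -\<sigma>) summable_on {1..}"
proof -
  assume "\<sigma> > 1"
  then have "summable (\<lambda>n. real n powr -\<sigma>)" by (simp add: summable_real_powr_iff)
  then have "summable (\<lambda>n. norm (real n powr -\<sigma>))" by simp
  then have "(\<lambda>n. real n powr -\<sigma>) summable_on UNIV" by (rule norm_summable_imp_summable_on)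
  then show ?thesis by (rule summable_on_subset_banach) auto
qed

subsection \<open>Dirichlet convolution\<close>

definition dirichlet_conv :: "(nat \<Rightarrow> 'a::comm_semiring_1) \<Rightarrow> (nat \<Rightarrow> 'a) \<Rightarrow> nat \<Rightarrow> 'a" where
  "dirichlet_conv b c n = (\<Sum>d | d dvd n. b d * c (n div d))"

lemma bij_betw_divisor_pairs:
  "bij_betw (\<lambda>(n, d). (d, n div d)) (SIGMA n:{1::nat..}. {d. d dvd n}) ({1..} \<times> {1..})"
proof (rule bij_betw_byWitness[where f' = "\<lambda>(d, e). (d * e, d)"])
  have *: "d \<ge> 1 \<and> n div d \<ge> 1" if "n \<ge> 1" "d dvd n" for n d :: nat
  proof -
    obtain e where "n = d * e" using \<open>d dvd n\<close> by (auto elim: dvdE)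
    with \<open>n \<ge> 1\<close> have "d \<ge> 1" "e \<ge> 1" "n div d = e" by (auto simp: Suc_le_eq)
    then show ?thesis by simp
  qed
  show "(\<lambda>(n, d). (d, n div d)) ` (SIGMA n:{1::nat..}. {d. d dvd n}) \<subseteq> {1..} \<times> {1..}"
    using * by force
  show "(\<lambda>(d, e). (d * e, d)) ` ({1::nat..} \<times> {1..}) \<subseteq> (SIGMA n:{1..}. {d. d dvd n})"
    by (auto simp: Suc_le_eq)
qed auto

lemma dirichlet_conv_has_sum_aux:
  fixes F G :: "nat \<Rightarrow> 'a :: {real_normed_field, banach}"
  assumes F: "(\<lambda>n. norm (F n)) summable_on {1..}" and G: "(\<lambda>n. norm (G n)) summable_on {1..}"
  shows "(dirichlet_conv F G has_sum (infsum F {1..} * infsum G {1..})) {1..}"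
proof -
  have Fs: "F summable_on {1..}" and Gs: "G summable_on {1..}"
    using F G by (auto intro: abs_summable_summable)
  have abs: "(\<lambda>z. norm ((\<lambda>(x, y). F x * G y) z)) summable_on {1..} \<times> {1..}"
    by (rule Infinite_Sum.abs_summable_on_Sigma_iff[THEN iffD2])
       (use F G in \<open>auto simp: norm_mult infsum_cmult_right' summable_on_cmult_right infsum_nonneg
          intro!: summable_on_cmult_left\<close>)
  have "((\<lambda>(x, y). F x * G y) has_sum (infsum F {1..} * infsum G {1..})) ({1..} \<times> {1..})"
  proof (rule has_sum_SigmaI)
    show "((\<lambda>y. case (x, y) of (x, y) \<Rightarrow> F x * G y) has_sum F x * infsum G {1..}) {1..}" for x
      using Gs by (auto intro!: has_sum_cmult_right)
    show "((\<lambda>x. F x * infsum G {1..}) has_sum infsum F {1..} * infsum G {1..}) {1..}"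
      using Fs by (auto intro!: has_sum_cmult_left)
    show "(\<lambda>(x, y). F x * G y) summable_on {1..} \<times> {1..}"
      using abs by (rule abs_summable_summable)
  qed
  then have "((\<lambda>z. (\<lambda>(x, y). F x * G y) ((\<lambda>(n, d). (d, n div d)) z)) has_sum
      (infsum F {1..} * infsum G {1..})) (SIGMA n:{1..}. {d. d dvd n})"
    by (subst has_sum_reindex_bij_betw[OF bij_betw_divisor_pairs])
  then show ?thesis
    by (rule has_sum_SigmaD) (auto simp: dirichlet_conv_def intro!: has_sum_finiteI)
qed

lemma dirichlet_conv_has_sum:
  fixes F G :: "nat \<Rightarrow> 'a :: {real_normed_field, banach}"
  assumes "(\<lambda>n. norm (F n)) summable_on {1..}" "(\<lambda>n. norm (G n)) summable_on {1..}"
    and "(F has_sum s) {1..}" "(G has_sum t) {1..}"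
  shows "(dirichlet_conv F G has_sum (s * t)) {1..}" and "(\<lambda>n. norm (dirichlet_conv F G n)) summable_on {1..}"
proof -
  show "(dirichlet_conv F G has_sum (s * t)) {1..}"
    using dirichlet_conv_has_sum_aux[OF assms(1,2)] assms(3,4) by (simp add: infsumI)
  have "dirichlet_conv (\<lambda>n. norm (F n)) (\<lambda>n. norm (G n)) summable_on {1..}"
    using dirichlet_conv_has_sum_aux[of "\<lambda>n. norm (F n)" "\<lambda>n. norm (G n)"] assms(1,2)
    by (auto intro: has_sum_imp_summable)
  then show "(\<lambda>n. norm (dirichlet_conv F G n)) summable_on {1..}"
    by (rule Infinite_Sum.abs_summable_on_comparison_test')
       (auto simp: dirichlet_conv_def norm_mult intro!: sum_norm_le)
qed

definition divisor_count :: "nat \<Rightarrow> nat" where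
  "divisor_count n = card {d. d dvd n}"

lemma divisor_count_mult_le:
  assumes "m \<ge> 1" "n \<ge> 1"
  shows "divisor_count (m * n) \<le> divisor_count m * divisor_count n"
proof -
  have "{d. d dvd m * n} \<subseteq> (\<lambda>(x, y). x * y) ` ({d. d dvd m} \<times> {d. d dvd n})"
  proof
    fix k assume "k \<in> {d. d dvd m * n}"
    then obtain x y where "k = x * y" "x dvd m" "y dvd n" using division_decomp[of k m n] by auto
    then show "k \<in> (\<lambda>(x, y). x * y) ` ({d. d dvd m} \<times> {d. d dvd n})"
      by (intro image_eqI[of _ _ "(x, y)"]) auto
  qed
  then have "divisor_count (m * n) \<le> card ({d. d dvd m} \<times> {d. d dvd n})"
    unfolding divisor_count_def using assms by (intro surj_card_le) auto
  then show ?thesis by (simp add: divisor_count_def card_cartesian_product)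
qed

text \<open>
  Let \<open>\<tau>\<close> be the divisor count and \<open>F(n) = \<tau>(n)\<^sup>j n\<^sup>-\<^sup>\<sigma>\<close>.  Submultiplicativity of \<open>\<tau>\<close> gives
  \<open>F(n) \<le> F(d) F(n/d)\<close> for every divisor \<open>d\<close> of \<open>n\<close>.  Summing over \<open>d\<close> bounds \<open>\<tau>(n) F(n)\<close> by a term
  of the square of the convergent series of \<open>F\<close>, which is the step from \<open>j\<close> to \<open>j + 1\<close>.
\<close>

lemma divisor_count_power_summable:
  assumes "\<sigma> > 1"
  shows "(\<lambda>n. real (divisor_count n) ^ j * real n powr -\<sigma>) summable_on {1..}"
proof (induction j)
  case 0
  then show ?case using abs_summable_powr[OF assms] by simp
next
  case (Suc j)
  define F where "F = (\<lambda>n. real (divisor_count n) ^ j * real n powr -\<sigma>)"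
  have F0: "F n \<ge> 0" for n by (simp add: F_def)
  have "F summable_on {1..}" using Suc by (simp add: F_def)
  then have "dirichlet_conv F F summable_on {1..}"
    using F0 dirichlet_conv_has_sum(1)[OF _ _ has_sum_infsum has_sum_infsum, of F F]
    by (auto intro: has_sum_imp_summable)
  then show ?case
  proof (rule summable_on_comparison_test)
    fix n :: nat assume n: "n \<in> {1..}"
    have "real (divisor_count n) ^ Suc j * real n powr -\<sigma> = (\<Sum>d | d dvd n. F n)"
      by (simp add: F_def divisor_count_def)
    also have "\<dots> \<le> (\<Sum>d | d dvd n. F d * F (n div d))"
    proof (rule sum_mono)
      fix d assume "d \<in> {d. d dvd n}"
      then obtain e where e: "n = d * e" by auto
      with n have de: "d \<ge> 1" "e \<ge> 1" by (auto simp: Suc_le_eq)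
      have "real (divisor_count n) \<le> real (divisor_count d) * real (divisor_count e)"
        using divisor_count_mult_le[OF de] e by (simp flip: of_nat_mult)
      then have "real (divisor_count n) ^ j \<le> (real (divisor_count d) * real (divisor_count e)) ^ j"
        by (rule power_mono) auto
      then have "F n \<le> (real (divisor_count d) * real (divisor_count e)) ^ j * real n powr -\<sigma>"
        unfolding F_def by (rule mult_right_mono) auto
      also have "\<dots> = F d * F (n div d)"
        using de by (simp add: F_def e power_mult_distrib powr_mult)
      finally show "F n \<le> F d * F (n div d)" .
    qed
    finally show "real (divisor_count n) ^ Suc j * real n powr -\<sigma> \<le> dirichlet_conv F F n"
      by (simp add: dirichlet_conv_def)
  qed auto
qed

text \<open>
  The terms of the convergent series of \<open>\<tau>(n)\<^sup>j n\<^sup>-\<^sup>2\<close> are bounded, hence \<open>\<tau>(n) = O(n\<^sup>2\<^sup>/\<^sup>j)\<close> for every \<open>j\<close>.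
\<close>

lemma divisor_bound:
  assumes "\<epsilon> > 0"
  obtains C where "C > 0" "\<And>n. n \<ge> 1 \<Longrightarrow> real (divisor_count n) \<le> C * real n powr \<epsilon>"
proof -
  define j where "j = nat \<lceil>2 / \<epsilon>\<rceil>"
  have j: "2 / \<epsilon> \<le> real j" "j > 0" using assms by (auto simp: j_def intro: real_nat_ceiling_ge)
  define S where "S = (\<Sum>\<^sub>\<infinity>n\<in>{1..}. real (divisor_count n) ^ j * real n powr -2)"
  have summ: "(\<lambda>n. real (divisor_count n) ^ j * real n powr -2) summable_on {1..}"
    by (rule divisor_count_power_summable) auto
  have S0: "S \<ge> 0" unfolding S_def by (rule infsum_nonneg) auto
  have "real (divisor_count n) \<le> (S + 1) * real n powr \<epsilon>" if n: "n \<ge> 1" for n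
  proof -
    have "(\<Sum>n\<in>{n}. real (divisor_count n) ^ j * real n powr -2) \<le> S"
      unfolding S_def by (rule finite_sum_le_infsum[OF summ]) (use n in auto)
    then have "real (divisor_count n) ^ j \<le> S * real n powr 2"
      using n by (simp add: powr_minus field_simps)
    also have "\<dots> \<le> (S + 1) ^ j * (real n powr \<epsilon>) ^ j"
    proof (intro mult_mono)
      show "S \<le> (S + 1) ^ j" using S0 j(2) power_increasing[of 1 j "S+1"] by simp
      have "2 \<le> \<epsilon> * real j" using j assms by (simp add: field_simps)
      then have "real n powr 2 \<le> real n powr (\<epsilon> * real j)" using n by (intro powr_mono) auto
      also have "\<dots> = (real n powr \<epsilon>) ^ j" using n by (simp add: powr_powr[symmetric] powr_realpow)
      finally show "real n powr 2 \<le> (real n powr \<epsilon>) ^ j" .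
    qed (use S0 in auto)
    finally have "real (divisor_count n) ^ j \<le> ((S + 1) * real n powr \<epsilon>) ^ j"
      by (simp add: power_mult_distrib)
    then show ?thesis using S0 j(2) power_mono_iff[of "real (divisor_count n)" "(S + 1) * real n powr \<epsilon>" j] by auto
  qed
  then show ?thesis using S0 that[of "S + 1"] by simp
qed

lemma ramanujan_dirichlet_conv:
  assumes "ramanujan_hypothesis b" "ramanujan_hypothesis c"
  shows "ramanujan_hypothesis (dirichlet_conv b c)"
  unfolding ramanujan_hypothesis_iff
proof (intro allI impI)
  fix \<epsilon> :: real assume "\<epsilon> > 0"
  then have e: "\<epsilon> / 2 > 0" by simp
  obtain B where B: "B > 0" "\<And>n. n \<ge> 1 \<Longrightarrow> cmod (b n) \<le> B * real n powr (\<epsilon>/2)"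
    by (rule ramanujan_bound[OF assms(1) e]) blast
  obtain C where C: "C > 0" "\<And>n. n \<ge> 1 \<Longrightarrow> cmod (c n) \<le> C * real n powr (\<epsilon>/2)"
    by (rule ramanujan_bound[OF assms(2) e]) blast
  obtain D where D: "D > 0" "\<And>n. n \<ge> 1 \<Longrightarrow> real (divisor_count n) \<le> D * real n powr (\<epsilon>/2)"
    by (rule divisor_bound[OF e]) blast
  have "cmod (dirichlet_conv b c n) \<le> B * C * D * real n powr \<epsilon>" if n: "n \<ge> 1" for n
  proof -
    have "cmod (dirichlet_conv b c n) \<le> (\<Sum>d | d dvd n. B * C * real n powr (\<epsilon>/2))"
      unfolding dirichlet_conv_def
    proof (rule sum_norm_le)
      fix d assume "d \<in> {d. d dvd n}"
      then obtain e where e: "n = d * e" by auto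
      with n have de: "d \<ge> 1" "e \<ge> 1" by (auto simp: Suc_le_eq)
      have "cmod (b d) * cmod (c e) \<le> (B * real d powr (\<epsilon>/2)) * (C * real e powr (\<epsilon>/2))"
        using B C de by (intro mult_mono) auto
      also have "\<dots> = B * C * real n powr (\<epsilon>/2)" by (simp add: e powr_mult)
      finally show "cmod (b d * c (n div d)) \<le> B * C * real n powr (\<epsilon>/2)"
        using de by (simp add: e norm_mult)
    qed
    also have "\<dots> = real (divisor_count n) * (B * C * real n powr (\<epsilon>/2))"
      by (simp add: divisor_count_def)
    also have "\<dots> \<le> (D * real n powr (\<epsilon>/2)) * (B * C * real n powr (\<epsilon>/2))"
      using B C D n by (intro mult_right_mono) auto
    also have "\<dots> = B * C * D * real n powr \<epsilon>"
      by (simp flip: powr_add)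
    finally show ?thesis .
  qed
  then show "\<exists>C. \<forall>n\<ge>1. cmod (dirichlet_conv b c n) \<le> C * real n powr \<epsilon>" by blast
qed

subsection \<open>Dirichlet series with coefficients satisfying the Ramanujan hypothesis\<close>

lemma norm_dirichlet_term:
  "n \<ge> 1 \<Longrightarrow> cmod (b n / of_nat n powr s) = cmod (b n) * real n powr - Re s"
  by (simp add: norm_divide norm_mult norm_inverse norm_powr_real_powr powr_minus divide_inverse)

lemma ramanujan_abs_summable:
  assumes "ramanujan_hypothesis b" "\<sigma> > 1"
  shows "(\<lambda>n. cmod (b n) * real n powr -\<sigma>) summable_on {1..}"
proof -
  define \<epsilon> where "\<epsilon> = (\<sigma> - 1) / 2"
  have e: "\<epsilon> > 0" "\<sigma> - \<epsilon> > 1" using assms by (auto simp: \<epsilon>_def field_simps)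
  obtain B where B: "B > 0" "\<And>n. n \<ge> 1 \<Longrightarrow> cmod (b n) \<le> B * real n powr \<epsilon>"
    by (rule ramanujan_bound[OF assms(1) e(1)]) blast
  have "(\<lambda>n. B * real n powr -(\<sigma>-\<epsilon>)) summable_on {1..}"
    by (intro summable_on_cmult_right abs_summable_powr e)
  then show ?thesis
  proof (rule summable_on_comparison_test)
    fix n :: nat assume n: "n \<in> {1..}"
    have "cmod (b n) * real n powr -\<sigma> \<le> B * real n powr \<epsilon> * real n powr -\<sigma>"
      using B n by (intro mult_right_mono) auto
    also have "\<dots> = B * real n powr -(\<sigma>-\<epsilon>)" by (simp flip: powr_add add: mult.assoc)
    finally show "cmod (b n) * real n powr -\<sigma> \<le> B * real n powr -(\<sigma>-\<epsilon>)" .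
  qed auto
qed

lemma ramanujan_square_summable:
  assumes "ramanujan_hypothesis b" "\<sigma> > 1/2"
  shows "(\<lambda>n. cmod (b n) ^ 2 * real n powr (-2*\<sigma>)) summable_on {1..}"
proof -
  define \<epsilon> where "\<epsilon> = (2*\<sigma> - 1) / 4"
  have e: "\<epsilon> > 0" "2*\<sigma> - 2*\<epsilon> > 1" using assms by (auto simp: \<epsilon>_def field_simps)
  obtain B where B: "B > 0" "\<And>n. n \<ge> 1 \<Longrightarrow> cmod (b n) \<le> B * real n powr \<epsilon>"
    by (rule ramanujan_bound[OF assms(1) e(1)]) blast
  have "(\<lambda>n. B^2 * real n powr -(2*\<sigma>-2*\<epsilon>)) summable_on {1..}"
    by (intro summable_on_cmult_right abs_summable_powr e)
  then show ?thesis
  proof (rule summable_on_comparison_test)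
    fix n :: nat assume n: "n \<in> {1..}"
    have "cmod (b n) ^ 2 * real n powr (-2*\<sigma>) \<le> (B * real n powr \<epsilon>) ^ 2 * real n powr (-2*\<sigma>)"
      using B n by (intro mult_right_mono power_mono) auto
    also have "\<dots> = B^2 * real n powr -(2*\<sigma>-2*\<epsilon>)" 
      by (simp add: power_mult_distrib power2_eq_square[of "_ powr _"] flip: powr_add add: mult.assoc)
    finally show "cmod (b n) ^ 2 * real n powr (-2*\<sigma>) \<le> B^2 * real n powr -(2*\<sigma>-2*\<epsilon>)" .
  qed auto
qed

lemma summable_on_from_1_iff:
  fixes f :: "nat \<Rightarrow> real"
  assumes "\<And>n. n \<ge> 1 \<Longrightarrow> f n \<ge> 0"
  shows "f summable_on {1..} \<longleftrightarrow> summable (\<lambda>n. f (Suc n))"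
proof -
  have bij: "bij_betw Suc UNIV {1..}"
    by (rule bij_betw_byWitness[where f' = "\<lambda>n. n - 1"]) auto
  have "f summable_on {1..} \<longleftrightarrow> (\<lambda>n. f (Suc n)) summable_on UNIV"
    by (rule summable_on_reindex_bij_betw[OF bij, symmetric])
  also have "\<dots> \<longleftrightarrow> summable (\<lambda>n. f (Suc n))"
    by (rule summable_on_UNIV_nonneg_real_iff) (use assms in auto)
  finally show ?thesis .
qed

lemma has_sum_imp_sums_Suc:
  fixes f :: "nat \<Rightarrow> 'a :: {topological_comm_monoid_add, t2_space}"
  assumes "(f has_sum s) {1..}"
  shows "(\<lambda>n. f (Suc n)) sums s"
proof -
  have bij: "bij_betw Suc UNIV {1..}"
    by (rule bij_betw_byWitness[where f' = "\<lambda>n. n - 1"]) auto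
  show ?thesis using assms has_sum_reindex_bij_betw[OF bij, of f s] by (auto intro: has_sum_imp_sums)
qed

lemma has_sum_imp_partial_sums:
  fixes f :: "nat \<Rightarrow> 'a :: {topological_comm_monoid_add, t2_space}"
  assumes "(f has_sum s) {1..}"
  shows "(\<lambda>N. \<Sum>n=1..N. f n) \<longlonglongrightarrow> s"
proof -
  have "(\<Sum>n<N. f (Suc n)) = (\<Sum>n=1..N. f n)" for N
    by (rule sum.reindex_bij_witness[of _ "\<lambda>n. n - 1" Suc]) auto
  with has_sum_imp_sums_Suc[OF assms] show ?thesis by (simp add: sums_def)
qed

lemma sums_Suc_imp_has_sum:
  fixes f :: "nat \<Rightarrow> 'a :: banach"
  assumes "(\<lambda>n. norm (f n)) summable_on {1..}" "(\<lambda>n. f (Suc n)) sums s"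
  shows "(f has_sum s) {1..}"
proof -
  have "f summable_on {1..}" using assms(1) by (rule abs_summable_summable)
  then have *: "(f has_sum infsum f {1..}) {1..}" by simp
  from has_sum_imp_sums_Suc[OF *] assms(2) have "infsum f {1..} = s" by (simp add: sums_unique2)
  with * show ?thesis by simp
qed

text \<open>
  The class of Dirichlet series in which the proof works.  It is closed under products and
  derivatives, its series converge absolutely for \<open>Re s > 1\<close>, and \<open>\<Sum>|b(n)|\<^sup>2 n\<^sup>-\<^sup>2\<^sup>\<sigma>\<close> converges for
  \<open>\<sigma> > 1/2\<close>, to the left of the half-plane where the function is given.
\<close>

definition ramanujan_series :: "(complex \<Rightarrow> complex) \<Rightarrow> (nat \<Rightarrow> complex) \<Rightarrow> bool" where
  "ramanujan_series f b \<longleftrightarrow> has_dirichlet_expansion f b \<and> ramanujan_hypothesis b"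

lemma ramanujan_abs_summable_term:
  assumes "ramanujan_hypothesis b" "Re s > 1"
  shows "(\<lambda>n. norm (b n / of_nat n powr s)) summable_on {1..}"
  using ramanujan_abs_summable[OF assms]
  by (rule summable_on_cong[THEN iffD1, rotated]) (auto simp: norm_dirichlet_term)

lemma ramanujan_series_has_sum:
  assumes "ramanujan_series f b" "Re s > 1"
  shows "((\<lambda>n. b n / of_nat n powr s) has_sum f s) {1..}"
  using assms ramanujan_abs_summable_term
  by (intro sums_Suc_imp_has_sum) (auto simp: ramanujan_series_def has_dirichlet_expansion_def)

lemma ramanujan_seriesI:
  assumes "ramanujan_hypothesis b"
    and "\<And>s. Re s > 1 \<Longrightarrow> ((\<lambda>n. b n / of_nat n powr s) has_sum f s) {1..}"
  shows "ramanujan_series f b"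
  using assms has_sum_imp_sums_Suc unfolding ramanujan_series_def has_dirichlet_expansion_def
  by fastforce

lemma ramanujan_series_infsum:
  assumes "ramanujan_hypothesis b"
  shows "ramanujan_series (\<lambda>s. \<Sum>\<^sub>\<infinity>n\<in>{1..}. b n / of_nat n powr s) b"
  using assms abs_summable_summable[OF ramanujan_abs_summable_term[OF assms]]
  by (intro ramanujan_seriesI has_sum_infsum)

lemma ramanujan_series_mult:
  assumes "ramanujan_series f b" "ramanujan_series g c"
  shows "ramanujan_series (\<lambda>s. f s * g s) (dirichlet_conv b c)"
proof (rule ramanujan_seriesI)
  have r: "ramanujan_hypothesis b" "ramanujan_hypothesis c"
    using assms by (auto simp: ramanujan_series_def)
  then show "ramanujan_hypothesis (dirichlet_conv b c)" by (rule ramanujan_dirichlet_conv)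
  fix s :: complex assume s: "Re s > 1"
  have "(dirichlet_conv (\<lambda>n. b n / of_nat n powr s) (\<lambda>n. c n / of_nat n powr s) has_sum f s * g s) {1..}"
    using r s assms by (intro dirichlet_conv_has_sum ramanujan_abs_summable_term ramanujan_series_has_sum)
  then show "((\<lambda>n. dirichlet_conv b c n / of_nat n powr s) has_sum f s * g s) {1..}"
  proof (rule has_sum_cong[THEN iffD1, rotated])
    fix n :: nat assume n: "n \<in> {1..}"
    show "dirichlet_conv (\<lambda>n. b n / of_nat n powr s) (\<lambda>n. c n / of_nat n powr s) n =
        dirichlet_conv b c n / of_nat n powr s"
      unfolding dirichlet_conv_def sum_divide_distrib
    proof (rule sum.cong[OF refl])
      fix d assume "d \<in> {d. d dvd n}"
      then obtain e where e: "n = d * e" by auto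
      with n have de: "d \<ge> 1" "e \<ge> 1" by (auto simp: Suc_le_eq)
      have "complex_of_nat n powr s = of_nat d powr s * of_nat e powr s"
        using powr_times_real[of "of_nat d" "of_nat e" s] by (simp add: e)
      then show "b d / of_nat d powr s * (c (n div d) / of_nat (n div d) powr s) =
          b d * c (n div d) / of_nat n powr s"
        using de e by simp
    qed
  qed
qed

lemma dirichlet_unit_has_sum:
  "((\<lambda>n. (if n = 1 then z else 0) / of_nat n powr s) has_sum (z::complex)) {1..}"
  by (rule has_sum_finite_neutralI[of "{1}"]) auto

lemma ramanujan_series_const: "ramanujan_series (\<lambda>s. z) (\<lambda>n. if n = 1 then z else 0)"
proof (rule ramanujan_seriesI)
  show "ramanujan_hypothesis (\<lambda>n. if n = 1 then z else 0)"
    unfolding ramanujan_hypothesis_iff by (auto intro!: exI[of _ "cmod z"] simp: powr_ge_zero)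
qed (rule dirichlet_unit_has_sum)

lemma ramanujan_series_prod:
  assumes "finite I" "\<And>i. i \<in> I \<Longrightarrow> \<exists>b. ramanujan_series (f i) b"
  shows "\<exists>b. ramanujan_series (\<lambda>s. \<Prod>i\<in>I. f i s) b"
  using assms
proof (induction I rule: finite_induct)
  case empty
  then show ?case using ramanujan_series_const[of 1] by auto
next
  case (insert i I)
  from insert.prems[of i] insert.IH insert.prems
  obtain b c where "ramanujan_series (f i) b" "ramanujan_series (\<lambda>s. \<Prod>i\<in>I. f i s) c" by fast
  from ramanujan_series_mult[OF this] show ?case using insert by auto
qed

lemma ramanujan_series_power:
  assumes "ramanujan_series f b"
  shows "\<exists>b. ramanujan_series (\<lambda>s. f s ^ k) b"
  using ramanujan_series_prod[of "{..<k}" "\<lambda>_. f"] assms by (auto simp: prod_constant)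

lemma ramanujan_series_cong:
  assumes "ramanujan_series f b" "\<And>s. Re s > 1 \<Longrightarrow> f s = g s"
  shows "ramanujan_series g b"
  using assms by (auto simp: ramanujan_series_def has_dirichlet_expansion_def)

definition dirichlet_poly :: "(nat \<Rightarrow> complex) \<Rightarrow> nat \<Rightarrow> complex \<Rightarrow> complex" where
  "dirichlet_poly b N s = (\<Sum>n=1..N. b n / of_nat n powr s)"

lemma ramanujan_pointwise_mult:
  assumes "ramanujan_hypothesis b" "ramanujan_hypothesis c"
  shows "ramanujan_hypothesis (\<lambda>n. b n * c n)"
  unfolding ramanujan_hypothesis_iff
proof (intro allI impI)
  fix \<epsilon> :: real assume "\<epsilon> > 0"
  then have e: "\<epsilon> / 2 > 0" by simp
  obtain B where B: "B > 0" "\<And>n. n \<ge> 1 \<Longrightarrow> cmod (b n) \<le> B * real n powr (\<epsilon>/2)"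
    by (rule ramanujan_bound[OF assms(1) e]) blast
  obtain C where C: "C > 0" "\<And>n. n \<ge> 1 \<Longrightarrow> cmod (c n) \<le> C * real n powr (\<epsilon>/2)"
    by (rule ramanujan_bound[OF assms(2) e]) blast
  have "cmod (b n * c n) \<le> B * C * real n powr \<epsilon>" if n: "n \<ge> 1" for n
  proof -
    have "cmod (b n * c n) \<le> (B * real n powr (\<epsilon>/2)) * (C * real n powr (\<epsilon>/2))"
      unfolding norm_mult using B C n by (intro mult_mono) auto
    also have "\<dots> = B * C * real n powr \<epsilon>" by (simp flip: powr_add)
    finally show ?thesis .
  qed
  then show "\<exists>C. \<forall>n\<ge>1. cmod (b n * c n) \<le> C * real n powr \<epsilon>" by blast
qed

lemma ramanujan_add:
  assumes "ramanujan_hypothesis b" "ramanujan_hypothesis c"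
  shows "ramanujan_hypothesis (\<lambda>n. b n + c n)"
  unfolding ramanujan_hypothesis_iff
proof (intro allI impI)
  fix \<epsilon> :: real assume e: "\<epsilon> > 0"
  obtain B where B: "B > 0" "\<And>n. n \<ge> 1 \<Longrightarrow> cmod (b n) \<le> B * real n powr \<epsilon>"
    by (rule ramanujan_bound[OF assms(1) e]) blast
  obtain C where C: "C > 0" "\<And>n. n \<ge> 1 \<Longrightarrow> cmod (c n) \<le> C * real n powr \<epsilon>"
    by (rule ramanujan_bound[OF assms(2) e]) blast
  have "cmod (b n + c n) \<le> (B + C) * real n powr \<epsilon>" if n: "n \<ge> 1" for n
    using B(2)[OF n] C(2)[OF n] norm_triangle_ineq[of "b n" "c n"] by (simp add: algebra_simps)
  then show "\<exists>C. \<forall>n\<ge>1. cmod (b n + c n) \<le> C * real n powr \<epsilon>" by blast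
qed

lemma ramanujan_bounded:
  assumes "\<And>n. n \<ge> 1 \<Longrightarrow> cmod (b n) \<le> C"
  shows "ramanujan_hypothesis b"
  unfolding ramanujan_hypothesis_iff
proof (intro allI impI exI)
  fix \<epsilon> :: real and n :: nat assume "\<epsilon> > 0" "n \<ge> 1"
  then have "1 \<le> real n powr \<epsilon>" by (intro ge_one_powr_ge_zero) auto
  moreover have "0 \<le> C" using assms[of 1] norm_ge_zero[of "b 1"] by linarith
  ultimately have "C * 1 \<le> C * real n powr \<epsilon>" by (intro mult_left_mono)
  then show "cmod (b n) \<le> C * real n powr \<epsilon>" using assms[OF \<open>n \<ge> 1\<close>] by simp
qed

lemma ramanujan_ln: "ramanujan_hypothesis (\<lambda>n. - complex_of_real (ln (real n)))"
  unfolding ramanujan_hypothesis_iff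
proof (intro allI impI)
  fix \<epsilon> :: real assume e: "\<epsilon> > 0"
  have "cmod (- complex_of_real (ln (real n))) \<le> (1 / \<epsilon>) * real n powr \<epsilon>" if n: "n \<ge> 1" for n
  proof -
    have "cmod (- complex_of_real (ln (real n))) = ln (real n)" using n by simp
    also have "\<dots> \<le> real n powr \<epsilon> / \<epsilon>" using n e by (intro ln_powr_bound) auto
    finally show ?thesis by simp
  qed
  then show "\<exists>C. \<forall>n\<ge>1. cmod (- complex_of_real (ln (real n))) \<le> C * real n powr \<epsilon>" by blast
qed

lemma ramanujan_series_deriv:
  assumes "ramanujan_series f b"
  shows "f holomorphic_on {s. Re s > 1}"
    and "ramanujan_series (deriv f) (\<lambda>n. b n * - of_real (ln (real n)))"
proof -
  define F where "F = (\<lambda>n s. b (Suc n) / of_nat (Suc n) powr s)"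
  define F' where "F' = (\<lambda>n s. b (Suc n) * - of_real (ln (real (Suc n))) / of_nat (Suc n) powr s)"
  define S where "S = {s. Re s > 1}"
  have rb: "ramanujan_hypothesis b" using assms by (simp add: ramanujan_series_def)
  have opS: "open S" unfolding S_def by (rule open_halfspace_Re_gt)
  have der: "(F n has_field_derivative F' n x) (at x)" for n x
  proof -
    have nz: "complex_of_nat (Suc n) \<noteq> 0" by (simp del: of_nat_Suc)
    have L: "Ln (complex_of_nat (Suc n)) = of_real (ln (real (Suc n)))"
      by (metis Ln_of_real of_nat_0_less_iff of_real_of_nat_eq zero_less_Suc)
    have F_eq: "F n = (\<lambda>s. b (Suc n) * exp (- (s * of_real (ln (real (Suc n))))))"
      using nz L by (auto simp: F_def powr_def exp_minus divide_inverse fun_eq_iff simp del: of_nat_Suc)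
    have F'_eq: "F' n x = b (Suc n) * (exp (- (x * of_real (ln (real (Suc n))))) * - of_real (ln (real (Suc n))))"
      using nz L by (auto simp: F'_def powr_def exp_minus divide_inverse simp del: of_nat_Suc)
    show ?thesis unfolding F_eq F'_eq
      by (rule derivative_eq_intros refl | simp)+
  qed
  have "\<exists>g g'. \<forall>x\<in>S. ((\<lambda>n. F n x) sums g x) \<and> ((\<lambda>n. F' n x) sums g' x) \<and> (g has_field_derivative g' x) (at x)"
  proof (rule series_and_derivative_comparison_complex[OF opS der])
    fix x assume "x \<in> S"
    define d where "d = (Re x - 1) / 2"
    have d: "d > 0" "1 + d > 1" using \<open>x \<in> S\<close> by (auto simp: d_def S_def)
    define h where "h = (\<lambda>n. complex_of_real (cmod (b (Suc n)) * real (Suc n) powr -(1+d)))"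
    have "summable (\<lambda>n. cmod (b (Suc n)) * real (Suc n) powr -(1+d))"
      using ramanujan_abs_summable[OF rb d(2)] by (subst (asm) summable_on_from_1_iff) auto
    then have "summable h" unfolding h_def by (rule summable_of_real)
    moreover have "range h \<subseteq> \<real>\<^sub>\<ge>\<^sub>0" by (auto simp: h_def simp del: of_real_mult)
    moreover have "\<forall>y\<in>ball x d \<inter> S. cmod (F n y) \<le> cmod (h n)" for n
    proof
      fix y assume y: "y \<in> ball x d \<inter> S"
      have "Re x - Re y \<le> cmod (x - y)" using complex_Re_le_cmod[of "x - y"] by simp
      then have "Re y \<ge> 1 + d" using y by (simp add: dist_norm d_def field_simps)
      then have "cmod (b (Suc n)) * real (Suc n) powr - Re y \<le> cmod (b (Suc n)) * real (Suc n) powr -(1+d)"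
        by (intro mult_left_mono powr_mono) auto
      then show "cmod (F n y) \<le> cmod (h n)"
        unfolding F_def h_def by (subst norm_dirichlet_term) (auto simp del: of_real_mult of_nat_Suc)
    qed
    ultimately show "\<exists>d h. 0 < d \<and> summable h \<and> range h \<subseteq> \<real>\<^sub>\<ge>\<^sub>0 \<and>
        (\<forall>\<^sub>F n in sequentially. \<forall>y\<in>ball x d \<inter> S. cmod (F n y) \<le> cmod (h n))"
      using d by (intro exI[of _ d] exI[of _ h]) auto
  qed
  then obtain g g' where g: "\<And>x. x \<in> S \<Longrightarrow> (\<lambda>n. F n x) sums g x"
     "\<And>x. x \<in> S \<Longrightarrow> (\<lambda>n. F' n x) sums g' x" "\<And>x. x \<in> S \<Longrightarrow> (g has_field_derivative g' x) (at x)"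
    by blast
  have fg: "f x = g x" if "x \<in> S" for x
    using assms g(1)[OF that] that
    by (auto simp: ramanujan_series_def has_dirichlet_expansion_def S_def F_def intro: sums_unique2)
  have fd: "(f has_field_derivative g' x) (at x)" if "x \<in> S" for x
    by (rule has_field_derivative_transform_within_open[OF g(3)[OF that] opS that]) (simp add: fg)
  then show "f holomorphic_on {s. Re s > 1}"
    unfolding S_def[symmetric] by (auto simp: holomorphic_on_open[OF opS])
  have "deriv f x = g' x" if "x \<in> S" for x
    using fd[OF that] by (rule DERIV_imp_deriv)
  then show "ramanujan_series (deriv f) (\<lambda>n. b n * - of_real (ln (real n)))"
    using g(2) ramanujan_pointwise_mult[OF rb ramanujan_ln]
    by (auto simp: ramanujan_series_def has_dirichlet_expansion_def S_def F'_def)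
qed

text \<open>
  Every comparison of a function with its partial sums starts in the half-plane \<open>Re s \<ge> 2\<close>, where
  absolute convergence makes it uniform; any abscissa greater than \<open>1\<close> would serve.
\<close>

lemma ramanujan_series_tail:
  assumes "ramanujan_series f b" "e > 0"
  shows "\<exists>N0. \<forall>N\<ge>N0. \<forall>s. Re s \<ge> 2 \<longrightarrow> cmod (f s - dirichlet_poly b N s) \<le> e"
proof -
  have rb: "ramanujan_hypothesis b" using assms by (simp add: ramanujan_series_def)
  define g where "g = (\<lambda>n. cmod (b (Suc n)) * real (Suc n) powr -2)"
  have sg: "summable g"
    using ramanujan_abs_summable[OF rb, of 2]
      summable_on_from_1_iff[of "\<lambda>n. cmod (b n) * real n powr -2"] by (simp add: g_def)
  from suminf_exist_split[OF assms(2) sg] obtain N0 where N0: "\<And>N. N \<ge> N0 \<Longrightarrow> norm (\<Sum>i. g (i + N)) < e"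
    by blast
  have "cmod (f s - dirichlet_poly b N s) \<le> e" if "N \<ge> N0" "Re s \<ge> 2" for N s
  proof -
    have "(\<lambda>n. b (Suc n) / of_nat (Suc n) powr s) sums f s"
      using assms that by (auto simp: ramanujan_series_def has_dirichlet_expansion_def)
    then have sm: "(\<lambda>n. b (Suc (n + N)) / of_nat (Suc (n + N)) powr s) sums
        (f s - (\<Sum>n<N. b (Suc n) / of_nat (Suc n) powr s))"
      by (subst sums_iff_shift) (simp add: sums_iff)
    have "(\<Sum>n<N. b (Suc n) / of_nat (Suc n) powr s) = dirichlet_poly b N s"
      unfolding dirichlet_poly_def
      by (rule sum.reindex_bij_witness[of _ "\<lambda>n. n - 1" Suc]) auto
    with sm have sm: "(\<lambda>n. b (Suc (n + N)) / of_nat (Suc (n + N)) powr s) sums (f s - dirichlet_poly b N s)"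
      by simp
    have le: "norm (b (Suc (n + N)) / of_nat (Suc (n + N)) powr s) \<le> g (n + N)" for n
      unfolding g_def using that(2)
      by (subst norm_dirichlet_term) (auto intro!: mult_left_mono powr_mono simp del: of_nat_Suc)
    have sgN: "summable (\<lambda>n. g (n + N))" using sg by (subst summable_iff_shift)
    have "norm (\<Sum>n. b (Suc (n + N)) / of_nat (Suc (n + N)) powr s) \<le> (\<Sum>n. g (n + N))"
      by (rule norm_suminf_le[OF le sgN])
    also have "\<dots> \<le> e" using N0[OF that(1)] by simp
    finally show ?thesis using sums_unique[OF sm] by simp
  qed
  then show ?thesis by blast
qed

lemma norm_dirichlet_poly_le:
  assumes "Re s \<ge> 0"
  shows "cmod (dirichlet_poly b N s) \<le> (\<Sum>n=1..N. cmod (b n))"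
  unfolding dirichlet_poly_def
proof (rule sum_norm_le)
  fix n assume n: "n \<in> {1..N}"
  then have "real n powr - Re s \<le> real n powr 0" using assms by (intro powr_mono) auto
  then have "cmod (b n) * real n powr - Re s \<le> cmod (b n) * 1" using n by (intro mult_left_mono) auto
  then show "cmod (b n / of_nat n powr s) \<le> cmod (b n)" using n by (subst norm_dirichlet_term) auto
qed

lemma ramanujan_series_bounded:
  assumes "ramanujan_series f b"
  obtains B where "B > 0" "\<And>s. Re s \<ge> 2 \<Longrightarrow> cmod (f s) \<le> B"
proof -
  obtain N where N: "\<And>s. Re s \<ge> 2 \<Longrightarrow> cmod (f s - dirichlet_poly b N s) \<le> 1"
    using ramanujan_series_tail[OF assms, of 1] by force
  define B where "B = (\<Sum>n=1..N. cmod (b n)) + 1"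
  have "cmod (f s) \<le> B" if "Re s \<ge> 2" for s
    using N[OF that] norm_dirichlet_poly_le[of s b N] norm_triangle_sub[of "f s" "dirichlet_poly b N s"] that
    by (simp add: B_def)
  moreover have "B > 0" unfolding B_def by (intro add_nonneg_pos sum_nonneg) auto
  ultimately show ?thesis using that by blast
qed

text \<open>
  The terms with \<open>n \<ge> m + 1\<close> satisfy \<open>n\<^sup>-\<^sup>\<sigma> \<le> n\<^sup>-\<^sup>2 (m + 1)\<^sup>-\<^sup>(\<^sup>\<sigma>\<^sup>-\<^sup>2\<^sup>)\<close>, so the first nonzero term dominates
  as \<open>\<sigma> \<rightarrow> \<infinity>\<close>.
\<close>

lemma ramanujan_series_leading:
  assumes "ramanujan_series f b" "m \<ge> 1" "\<And>n. 1 \<le> n \<Longrightarrow> n < m \<Longrightarrow> b n = 0"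
  obtains B where "\<And>s. Re s \<ge> 2 \<Longrightarrow> cmod (f s - b m / of_nat m powr s) \<le> B * real (m + 1) powr - (Re s - 2)"
proof -
  have rb: "ramanujan_hypothesis b" using assms by (simp add: ramanujan_series_def)
  define g where "g = (\<lambda>n. cmod (b n) * real n powr -2)"
  have sg: "g summable_on {1..}"
    using ramanujan_abs_summable[OF rb, of 2] by (simp add: g_def)
  have "cmod (f s - b m / of_nat m powr s) \<le> infsum g {1..} * real (m + 1) powr - (Re s - 2)" if s: "Re s \<ge> 2" for s
  proof (rule norm_infsum_le)
    have "((\<lambda>n. b n / of_nat n powr s) has_sum f s) {1..}"
      using s by (intro ramanujan_series_has_sum[OF assms(1)]) auto
    moreover have "((\<lambda>n. (if n = m then b m / of_nat m powr s else 0)) has_sum b m / of_nat m powr s) {1..}"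
      by (rule has_sum_finite_neutralI[of "{m}"]) (use assms in auto)
    ultimately show "((\<lambda>n. b n / of_nat n powr s - (if n = m then b m / of_nat m powr s else 0)) has_sum
        (f s - b m / of_nat m powr s)) {1..}"
      unfolding diff_conv_add_uminus by (intro has_sum_add has_sum_uminusI)
    show "((\<lambda>n. g n * real (m + 1) powr - (Re s - 2)) has_sum infsum g {1..} * real (m + 1) powr - (Re s - 2)) {1..}"
      using sg by (intro has_sum_cmult_left) simp
    fix n :: nat assume n: "n \<in> {1..}"
    show "cmod (b n / of_nat n powr s - (if n = m then b m / of_nat m powr s else 0))
        \<le> g n * real (m + 1) powr - (Re s - 2)"
    proof (cases "n \<le> m")
      case True
      then show ?thesis using assms(3)[of n] n by (cases "n = m") (auto simp: g_def)
    next
      case False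
      have "real n powr - Re s = real n powr -2 * real n powr -(Re s - 2)"
        by (simp flip: powr_add)
      also have "\<dots> \<le> real n powr -2 * real (m + 1) powr -(Re s - 2)"
        using False s by (intro mult_left_mono powr_mono2') auto
      finally have "cmod (b n) * real n powr - Re s \<le> cmod (b n) * (real n powr -2 * real (m + 1) powr -(Re s - 2))"
        by (intro mult_left_mono) auto
      then show ?thesis using False n norm_dirichlet_term[of n b s] by (simp add: g_def mult.assoc)
    qed
  qed
  then show ?thesis using that by blast
qed

lemma ramanujan_series_limit:
  assumes "ramanujan_series f b"
  shows "((\<lambda>\<sigma>. f (complex_of_real \<sigma>)) \<longlongrightarrow> b 1) at_top"
proof -
  obtain B where B: "\<And>s. Re s \<ge> 2 \<Longrightarrow> cmod (f s - b 1 / of_nat 1 powr s) \<le> B * real (1 + 1) powr - (Re s - 2)"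
    by (rule ramanujan_series_leading[OF assms, of 1]) auto
  have "((\<lambda>\<sigma>::real. B * 2 powr - (\<sigma> - 2)) \<longlongrightarrow> 0) at_top"
    by real_asymp
  then have "((\<lambda>\<sigma>. f (complex_of_real \<sigma>) - b 1) \<longlongrightarrow> 0) at_top"
  proof (rule Lim_null_comparison[rotated])
    show "\<forall>\<^sub>F \<sigma> in at_top. cmod (f (complex_of_real \<sigma>) - b 1) \<le> B * 2 powr - (\<sigma> - 2)"
      using eventually_ge_at_top[of 2] by eventually_elim (use B[of "of_real _"] in auto)
  qed
  then show ?thesis by (simp add: LIM_zero_iff)
qed

text \<open>
  If \<open>m\<close> is the first index with a nonzero coefficient \<open>d m\<close> of the difference, multiplying by
  \<open>m\<^sup>\<sigma>\<close> and letting \<open>\<sigma> \<rightarrow> \<infinity>\<close> yields \<open>d m = 0\<close>.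
\<close>

lemma ramanujan_series_unique:
  assumes "ramanujan_series f b" "ramanujan_series f c" "n \<ge> 1"
  shows "b n = c n"
proof (rule ccontr)
  assume neq: "b n \<noteq> c n"
  define d where "d = (\<lambda>n. b n + (-1) * c n)"
  have "ramanujan_series (\<lambda>s. f s + (-1) * f s) d"
  proof (rule ramanujan_seriesI)
    have "ramanujan_hypothesis b" "ramanujan_hypothesis (\<lambda>n. (-1) * c n)"
      using assms ramanujan_pointwise_mult[OF ramanujan_bounded[of "\<lambda>_. -1" 1], of c]
      by (simp_all add: ramanujan_series_def)
    then show "ramanujan_hypothesis d" unfolding d_def by (rule ramanujan_add)
    fix s :: complex assume "Re s > 1"
    then show "((\<lambda>n. d n / of_nat n powr s) has_sum (f s + (-1) * f s)) {1..}"
      unfolding d_def add_divide_distrib times_divide_eq_right[symmetric]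
      by (intro has_sum_add has_sum_cmult_right ramanujan_series_has_sum assms)
  qed
  then have D: "ramanujan_series (\<lambda>s. 0) d" by simp
  define m where "m = (LEAST m. m \<ge> 1 \<and> d m \<noteq> 0)"
  have ex: "n \<ge> 1 \<and> d n \<noteq> 0" using assms neq by (simp add: d_def)
  have m: "m \<ge> 1" "d m \<noteq> 0" using LeastI[of "\<lambda>m. m \<ge> 1 \<and> d m \<noteq> 0", OF ex] by (auto simp: m_def)
  have "d k = 0" if "1 \<le> k" "k < m" for k
    using not_less_Least[of k "\<lambda>m. m \<ge> 1 \<and> d m \<noteq> 0"] that by (auto simp: m_def)
  then obtain B where B: "\<And>s. Re s \<ge> 2 \<Longrightarrow> cmod (0 - d m / of_nat m powr s) \<le> B * real (m + 1) powr - (Re s - 2)"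
    using ramanujan_series_leading[OF D m(1)] by blast
  define x where "x = real m"
  have x: "x \<ge> 1" using m by (simp add: x_def)
  have le: "cmod (d m) \<le> B * (x powr \<sigma> * (x + 1) powr - (\<sigma> - 2))" if "\<sigma> \<ge> 2" for \<sigma>
  proof -
    have "cmod (d m / of_nat m powr of_real \<sigma>) \<le> B * (x + 1) powr -(\<sigma> - 2)"
      using B[of "of_real \<sigma>"] that by (simp add: x_def add.commute)
    then have "cmod (d m) * x powr -\<sigma> \<le> B * (x + 1) powr -(\<sigma> - 2)"
      using m by (subst (asm) norm_dirichlet_term) (auto simp: x_def)
    then have "cmod (d m) * x powr -\<sigma> * x powr \<sigma> \<le> B * (x + 1) powr -(\<sigma> - 2) * x powr \<sigma>"
      by (rule mult_right_mono) auto
    then show ?thesis using x by (simp add: powr_minus mult_ac)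
  qed
  have ev: "\<forall>\<^sub>F \<sigma> in at_top. cmod (d m) \<le> B * (x powr \<sigma> * (x + 1) powr - (\<sigma> - 2))"
    using eventually_ge_at_top[of 2] by eventually_elim (rule le)
  have "((\<lambda>\<sigma>. B * (x powr \<sigma> * (x + 1) powr - (\<sigma> - 2))) \<longlongrightarrow> B * 0) at_top"
  proof (intro tendsto_mult tendsto_const)
    have eq: "x powr \<sigma> * (x + 1) powr - (\<sigma> - 2) = (x+1)^2 * exp (- (ln ((x+1)/x) * \<sigma>))" for \<sigma>
    proof -
      have "(x + 1) powr - (\<sigma> - 2) = (x + 1) powr (2 + - \<sigma>)" by simp
      also have "\<dots> = (x + 1)^2 * (x + 1) powr - \<sigma>" using x by (simp only: powr_add powr_numeral)
      also have "(x + 1) powr - \<sigma> = exp (- (ln (x+1) * \<sigma>))" using x by (simp add: powr_def)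
      finally have 1: "(x + 1) powr - (\<sigma> - 2) = (x + 1)^2 * exp (- (ln (x+1) * \<sigma>))" .
      have 2: "x powr \<sigma> = exp (ln x * \<sigma>)" using x by (simp add: powr_def)
      have 3: "- (ln ((x+1)/x) * \<sigma>) = - (ln (x+1) * \<sigma>) + ln x * \<sigma>"
        using x by (simp add: ln_div algebra_simps)
      show ?thesis unfolding 1 2 3 exp_add by simp
    qed
    have "ln ((x+1)/x) > 0" using x by (intro ln_gt_zero) (auto simp: field_simps)
    then have "((\<lambda>\<sigma>. (x+1)^2 * exp (- (ln ((x+1)/x) * \<sigma>))) \<longlongrightarrow> 0) at_top"
      by real_asymp
    then show "((\<lambda>\<sigma>. x powr \<sigma> * (x + 1) powr - (\<sigma> - 2)) \<longlongrightarrow> 0) at_top" by (simp only: eq)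
  qed
  then have "cmod (d m) \<le> B * 0" by (rule tendsto_lowerbound[OF _ ev]) simp
  then show False using m by simp
qed

section \<open>Euler products\<close>

text \<open>
  The completely multiplicative function with values \<open>\<beta> p\<close> at the primes.
\<close>

definition comp_mult :: "(nat \<Rightarrow> complex) \<Rightarrow> nat \<Rightarrow> complex" where
  "comp_mult \<beta> n = (\<Prod>p\<in>#prime_factorization n. \<beta> p)"

lemma comp_mult_mult: "m \<ge> 1 \<Longrightarrow> n \<ge> 1 \<Longrightarrow> comp_mult \<beta> (m * n) = comp_mult \<beta> m * comp_mult \<beta> n"
  by (simp add: comp_mult_def prime_factorization_mult)

lemma comp_mult_1 [simp]: "comp_mult \<beta> (Suc 0) = 1"
  by (simp add: comp_mult_def)

lemma comp_mult_prime: "prime p \<Longrightarrow> comp_mult \<beta> p = \<beta> p"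
  by (simp add: comp_mult_def prime_factorization_prime)

lemma comp_mult_prime_power: "prime p \<Longrightarrow> comp_mult \<beta> (p ^ r) = \<beta> p ^ r"
  by (simp add: comp_mult_def prime_factorization_prime_power)

lemma norm_comp_mult_le:
  assumes "\<And>p. prime p \<Longrightarrow> cmod (\<beta> p) \<le> 1"
  shows "cmod (comp_mult \<beta> n) \<le> 1"
proof -
  have "cmod (\<Prod>p\<in>#A. \<beta> p) \<le> 1" if "\<forall>p\<in>#A. cmod (\<beta> p) \<le> 1" for A
    using that by (induction A) (auto simp: norm_mult intro: mult_le_one)
  then show ?thesis unfolding comp_mult_def using assms by (auto simp: in_prime_factors_iff)
qed

subsection \<open>The Moebius function\<close>

definition moebius :: "nat \<Rightarrow> complex" where
  "moebius n = (if squarefree n then (-1) ^ size (prime_factorization n) else 0)"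

lemma norm_moebius_le: "cmod (moebius n) \<le> 1"
  by (simp add: moebius_def norm_power)

lemma moebius_prime_mult:
  assumes "prime p" "\<not> p dvd d" "d \<ge> 1"
  shows "moebius (p * d) = - moebius d"
proof -
  have "coprime p d" using assms by (simp add: prime_imp_coprime)
  then have "squarefree (p * d) \<longleftrightarrow> squarefree d"
    using assms squarefree_multD(2)[of p d] by (auto intro: squarefree_mult_coprime squarefree_prime)
  moreover have "size (prime_factorization (p * d)) = Suc (size (prime_factorization d))"
    using assms by (subst prime_factorization_mult) (auto simp: prime_factorization_prime dest: prime_gt_0_nat)
  ultimately show ?thesis by (simp add: moebius_def)
qed

text \<open>
  For a prime \<open>p\<close> dividing \<open>n\<close>, the squarefree divisors come in pairs \<open>d\<close>, \<open>p d\<close> with \<open>d\<close>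
  prime to \<open>p\<close>, and the two values are opposite.
\<close>

lemma sum_moebius_divisors:
  assumes "n \<ge> 1"
  shows "(\<Sum>d | d dvd n. moebius d) = (if n = 1 then 1 else 0)"
proof (cases "n = 1")
  case True
  then show ?thesis by (simp add: moebius_def)
next
  case False
  then obtain p where p: "prime p" "p dvd n" using prime_factor_nat by blast
  define D where "D = {d. d dvd n}"
  define D1 where "D1 = {d\<in>D. squarefree d \<and> \<not> p dvd d}"
  define D2 where "D2 = {d\<in>D. squarefree d \<and> p dvd d}"
  have fin: "finite D" using assms by (simp add: D_def)
  have pos: "d \<ge> 1" if "d \<in> D" for d using that assms by (auto simp: D_def Suc_le_eq intro!: Nat.gr0I)
  have "(\<Sum>d\<in>D. moebius d) = (\<Sum>d\<in>D1 \<union> D2. moebius d)"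
    by (rule sum.mono_neutral_right) (use fin in \<open>auto simp: D1_def D2_def moebius_def\<close>)
  also have "\<dots> = (\<Sum>d\<in>D1. moebius d) + (\<Sum>d\<in>D2. moebius d)"
    by (rule sum.union_disjoint) (use fin in \<open>auto simp: D1_def D2_def\<close>)
  also have "(\<Sum>d\<in>D2. moebius d) = (\<Sum>d\<in>D1. moebius (p * d))"
  proof (rule sum.reindex_bij_witness[of _ "\<lambda>d. p * d" "\<lambda>d. d div p"])
    fix d assume "d \<in> D1"
    then have d: "d dvd n" "squarefree d" "\<not> p dvd d" "d \<ge> 1" using pos by (auto simp: D1_def D_def)
    have "coprime p d" using d p by (simp add: prime_imp_coprime)
    then have "p * d dvd n" using d p by (simp add: divides_mult)
    moreover have "squarefree (p * d)"
      using \<open>coprime p d\<close> d(2) squarefree_prime[OF p(1)] by (intro squarefree_mult_coprime)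
    ultimately show "p * d \<in> D2" by (simp add: D2_def D_def)
    show "p * d div p = d" using p by (auto dest: prime_gt_0_nat)
  next
    fix d assume "d \<in> D2"
    then have d: "d dvd n" "squarefree d" "p dvd d" by (auto simp: D2_def D_def)
    then obtain e where e: "d = p * e" by auto
    have "\<not> p dvd e"
    proof
      assume "p dvd e"
      then have "p ^ 2 dvd d" using e by (auto simp: power2_eq_square)
      then have "p dvd 1" using squarefreeD[OF d(2)] by blast
      then show False using p by auto
    qed
    moreover have "squarefree e" using d(2) e by (auto dest: squarefree_multD)
    moreover have "e dvd n" using d e by (meson dvd_mult_right)
    ultimately show "d div p \<in> D1" "p * (d div p) = d" "moebius (p * (d div p)) = moebius d"
      using e p by (auto simp: D1_def D_def dest: prime_gt_0_nat)
  qed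
  also have "\<dots> = (\<Sum>d\<in>D1. - moebius d)"
    by (rule sum.cong) (use p pos in \<open>auto simp: D1_def moebius_prime_mult\<close>)
  finally show ?thesis using False by (simp add: D_def sum_negf)
qed

text \<open>
  Complete multiplicativity pulls the value at \<open>n\<close> out of the sum over the divisors.  Hence the
  reciprocal of the series of a completely multiplicative function \<open>\<chi>\<close> is the series of \<open>\<mu>\<chi>\<close>.
\<close>

lemma dirichlet_conv_moebius_comp_mult:
  assumes "n \<ge> 1"
  shows "dirichlet_conv (\<lambda>n. moebius n * comp_mult \<beta> n) (comp_mult \<beta>) n = (if n = 1 then 1 else 0)"
proof -
  have "dirichlet_conv (\<lambda>n. moebius n * comp_mult \<beta> n) (comp_mult \<beta>) n = (\<Sum>d | d dvd n. moebius d * comp_mult \<beta> n)"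
    unfolding dirichlet_conv_def
  proof (rule sum.cong[OF refl])
    fix d assume "d \<in> {d. d dvd n}"
    then obtain e where e: "n = d * e" by auto
    with assms have "d \<ge> 1" "e \<ge> 1" by (auto simp: Suc_le_eq)
    then show "moebius d * comp_mult \<beta> d * comp_mult \<beta> (n div d) = moebius d * comp_mult \<beta> n"
      using e by (simp add: comp_mult_mult)
  qed
  also have "\<dots> = (\<Sum>d | d dvd n. moebius d) * comp_mult \<beta> n"
    by (simp add: sum_distrib_right)
  also have "\<dots> = (if n = 1 then 1 else 0)"
    using assms by (subst sum_moebius_divisors) auto
  finally show ?thesis .
qed

subsection \<open>The sieve\<close>

text \<open>
  Multiplying by \<open>1 - F p\<close> removes the multiples of \<open>p\<close> from the sum.
\<close>

lemma euler_sieve: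
  fixes F :: "nat \<Rightarrow> complex"
  assumes abs: "(\<lambda>n. norm (F n)) summable_on {1..}"
    and mult: "\<And>m n. m \<ge> 1 \<Longrightarrow> n \<ge> 1 \<Longrightarrow> F (m * n) = F m * F n"
  shows "infsum F {1..} * (\<Prod>p\<in>{p. prime p \<and> p \<le> N}. 1 - F p)
      = infsum F {n. n \<ge> 1 \<and> (\<forall>p\<le>N. prime p \<longrightarrow> \<not> p dvd n)}"
proof (induction N)
  case 0
  have "{p. prime p \<and> p \<le> (0::nat)} = {}" by (auto dest: prime_gt_0_nat)
  moreover have "{n. n \<ge> 1 \<and> (\<forall>p\<le>0. prime p \<longrightarrow> \<not> p dvd n)} = {1::nat..}" by auto
  ultimately show ?case by (simp only: prod.empty) simp
next
  case (Suc N)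
  define R where "R = (\<lambda>N. {n::nat. n \<ge> 1 \<and> (\<forall>p\<le>N. prime p \<longrightarrow> \<not> p dvd n)})"
  have sub: "R k \<subseteq> {1..}" for k by (auto simp: R_def)
  have summ: "F summable_on A" if "A \<subseteq> {1..}" for A
    using summable_on_subset_banach[OF abs_summable_summable[OF abs] that] .
  show ?case
  proof (cases "prime (Suc N)")
    case False
    then have "{p. prime p \<and> p \<le> Suc N} = {p. prime p \<and> p \<le> N}" "R (Suc N) = R N"
      by (auto simp: R_def le_Suc_eq)
    then show ?thesis using Suc by (simp add: R_def)
  next
    case True
    define p where "p = Suc N"
    have p: "prime p" "p \<ge> 1" using True by (auto simp: p_def)
    have set: "{p. prime p \<and> p \<le> Suc N} = insert p {p. prime p \<and> p \<le> N}"
      using p by (auto simp: p_def le_Suc_eq)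
    have R: "R N = R p \<union> (\<lambda>n. p * n) ` R N"
    proof (intro equalityI subsetI)
      fix n assume n: "n \<in> R N"
      show "n \<in> R p \<union> (\<lambda>n. p * n) ` R N"
      proof (cases "p dvd n")
        case True
        then obtain k where k: "n = p * k" by auto
        with n have "k \<in> R N" by (auto simp: R_def Suc_le_eq)
        then show ?thesis using k by auto
      qed (use n in \<open>auto simp: R_def p_def le_Suc_eq\<close>)
    next
      fix n assume "n \<in> R p \<union> (\<lambda>n. p * n) ` R N"
      then show "n \<in> R N"
      proof
        assume "n \<in> (\<lambda>n. p * n) ` R N"
        then obtain k where k: "n = p * k" "k \<in> R N" by auto
        have "\<not> q dvd n" if q: "q \<le> N" "prime q" for q
        proof
          assume "q dvd n"
          then have "q dvd p \<or> q dvd k" using k q prime_dvd_mult_iff by blast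
          moreover have "\<not> q dvd k" using k q by (auto simp: R_def)
          moreover have "\<not> q dvd p"
            using q p primes_dvd_imp_eq[of q p] by (auto simp: p_def)
          ultimately show False by blast
        qed
        then show ?thesis using k p by (auto simp: R_def Suc_le_eq)
      qed (auto simp: R_def p_def)
    qed
    have disj: "R p \<inter> (\<lambda>n. p * n) ` R N = {}" using p by (auto simp: R_def)
    have sub': "(\<lambda>n. p * n) ` R N \<subseteq> {1..}" using R sub by blast
    have inj: "inj_on (\<lambda>n. p * n) (R N)" using p by (auto simp: inj_on_def)
    have "infsum F (R N) = infsum F (R p) + infsum F ((\<lambda>n. p * n) ` R N)"
      by (subst R, rule infsum_Un_disjoint[OF summ summ disj]) (use sub sub' in auto)
    also have "infsum F ((\<lambda>n. p * n) ` R N) = infsum (\<lambda>n. F p * F n) (R N)"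
      unfolding infsum_reindex[OF inj] o_def
      by (rule infsum_cong) (use p in \<open>auto simp: R_def intro!: mult\<close>)
    also have "\<dots> = F p * infsum F (R N)" by (rule infsum_cmult_right')
    finally have E: "infsum F (R N) = infsum F (R p) + F p * infsum F (R N)" .
    have "infsum F (R p) = infsum F (R N) * (1 - F p)" using E by algebra
    moreover have "(\<Prod>p\<in>{p. prime p \<and> p \<le> Suc N}. 1 - F p) = (1 - F p) * (\<Prod>p\<in>{p. prime p \<and> p \<le> N}. 1 - F p)"
      unfolding set by (subst prod.insert) (auto simp: p_def)
    ultimately show ?thesis using Suc by (simp add: R_def p_def mult_ac)
  qed
qed

text \<open>
  What the sieve leaves is the term at \<open>1\<close>, and terms at integers greater than \<open>N\<close>.
\<close>

lemma euler_product_inverse_tendsto: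
  fixes F :: "nat \<Rightarrow> complex"
  assumes abs: "(\<lambda>n. norm (F n)) summable_on {1..}"
    and mult: "\<And>m n. m \<ge> 1 \<Longrightarrow> n \<ge> 1 \<Longrightarrow> F (m * n) = F m * F n" and F1: "F 1 = 1"
  shows "(\<lambda>N. infsum F {1..} * (\<Prod>p\<in>{p. prime p \<and> p \<le> N}. 1 - F p)) \<longlonglongrightarrow> 1"
proof -
  define R where "R = (\<lambda>N. {n::nat. n \<ge> 1 \<and> (\<forall>p\<le>N. prime p \<longrightarrow> \<not> p dvd n)})"
  have eq: "infsum F {1..} * (\<Prod>p\<in>{p. prime p \<and> p \<le> N}. 1 - F p) = infsum F (R N)" for N
    unfolding R_def by (rule euler_sieve[OF abs mult])
  define G where "G = (\<lambda>n. norm (F n))"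
  have summF: "F summable_on A" and summG: "G summable_on A" if "A \<subseteq> {1..}" for A
    using summable_on_subset_banach[OF abs_summable_summable[OF abs] that]
      summable_on_subset_banach[OF abs that] by (auto simp: G_def)
  have bound: "norm (infsum F (R N) - 1) \<le> infsum G {1..} - sum G {1..N}" if "N \<ge> 1" for N
  proof -
    have R1: "1 \<in> R N" by (auto simp: R_def)
    have sub: "R N - {1} \<subseteq> {1..} - {1..N}"
    proof
      fix n assume n: "n \<in> R N - {1}"
      then obtain p where p: "prime p" "p dvd n" using prime_factor_nat[of n] by auto
      then have "p > N" using n by (auto simp: R_def not_le[symmetric])
      moreover have "p \<le> n" using p n by (auto simp: R_def intro: dvd_imp_le)
      ultimately show "n \<in> {1..} - {1..N}" using n by (auto simp: R_def)
    qed
    have "infsum F (R N) = infsum F {1} + infsum F (R N - {1})"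
      using infsum_Un_disjoint[of F "{1}" "R N - {1}"] summF[of "R N - {1}"] R1
      by (simp add: insert_absorb R_def subset_iff)
    then have "infsum F (R N) - 1 = infsum F (R N - {1})" using F1 by simp
    also have "norm \<dots> \<le> infsum G (R N - {1})"
      unfolding G_def by (rule norm_infsum_bound) (use summG[of "R N - {1}"] in \<open>auto simp: G_def R_def subset_iff\<close>)
    also have "\<dots> \<le> infsum G ({1..} - {1..N})"
      by (rule infsum_mono2) (use sub summG in \<open>auto simp: G_def R_def subset_iff\<close>)
    also have "\<dots> = infsum G {1..} - infsum G {1..N}"
      by (rule infsum_Diff) (auto intro!: summG)
    finally show ?thesis by simp
  qed
  have "(\<lambda>N. sum G {1..N}) \<longlonglongrightarrow> infsum G {1..}"
    using summG[of "{1..}"] by (intro has_sum_imp_partial_sums) simp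
  then have "(\<lambda>N. infsum G {1..} - sum G {1..N}) \<longlonglongrightarrow> infsum G {1..} - infsum G {1..}"
    by (intro tendsto_diff tendsto_const)
  then have lim0: "(\<lambda>N. infsum G {1..} - sum G {1..N}) \<longlonglongrightarrow> 0" by simp
  have "(\<lambda>N. infsum F (R N) - 1) \<longlonglongrightarrow> 0"
    by (rule Lim_null_comparison[OF _ lim0])
       (use bound in \<open>auto simp: eventually_sequentially intro!: exI[of _ 1]\<close>)
  then show ?thesis unfolding eq by (simp add: LIM_zero_iff)
qed

text \<open>
  Along the powers of a prime, Dirichlet convolution is multiplication of power series.  In this
  form the Euler factor at \<open>p\<close> can be read off from the coefficients.
\<close>

lemma dirichlet_conv_prime_power:
  fixes b c :: "nat \<Rightarrow> complex"
  assumes "prime p"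
  shows "Abs_fps (\<lambda>r. dirichlet_conv b c (p ^ r)) = Abs_fps (\<lambda>r. b (p ^ r)) * Abs_fps (\<lambda>r. c (p ^ r))"
proof (rule fps_ext)
  fix r :: nat
  have p: "p > 1" using assms by (rule prime_gt_1_nat)
  have set: "{d. d dvd p ^ r} = (\<lambda>i. p ^ i) ` {0..r}"
    using assms by (auto simp: divides_primepow_nat)
  have "dirichlet_conv b c (p ^ r) = (\<Sum>i=0..r. b (p ^ i) * c (p ^ r div p ^ i))"
    unfolding dirichlet_conv_def set
    by (subst sum.reindex) (use p in \<open>auto simp: inj_on_def\<close>)
  also have "\<dots> = (\<Sum>i=0..r. b (p ^ i) * c (p ^ (r - i)))"
    by (rule sum.cong) (use p in \<open>auto simp: power_diff\<close>)
  finally show "Abs_fps (\<lambda>r. dirichlet_conv b c (p ^ r)) $ r = (Abs_fps (\<lambda>r. b (p ^ r)) * Abs_fps (\<lambda>r. c (p ^ r))) $ r"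
    by (simp add: fps_mult_nth)
qed

lemma ramanujan_series_prod_coeffs:
  assumes "finite I" "\<And>i. i \<in> I \<Longrightarrow> ramanujan_series (f i) (c i)"
  shows "\<exists>b. ramanujan_series (\<lambda>s. \<Prod>i\<in>I. f i s) b \<and> b 1 = (\<Prod>i\<in>I. c i 1) \<and>
    (\<forall>p. prime p \<longrightarrow> Abs_fps (\<lambda>r. b (p ^ r)) = (\<Prod>i\<in>I. Abs_fps (\<lambda>r. c i (p ^ r))))"
  using assms
proof (induction I rule: finite_induct)
  case empty
  have "Abs_fps (\<lambda>r. if p ^ r = 1 then (1::complex) else 0) = 1" if "prime p" for p :: nat
    by (rule fps_ext) (use that in \<open>auto simp: prime_gt_0_nat dest: prime_gt_1_nat\<close>)
  then show ?case using ramanujan_series_const[of 1] by (intro exI[of _ "\<lambda>n. if n = 1 then 1 else 0"]) auto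
next
  case (insert i I)
  from insert.IH insert.prems obtain b where b: "ramanujan_series (\<lambda>s. \<Prod>i\<in>I. f i s) b" "b 1 = (\<Prod>i\<in>I. c i 1)"
    "\<And>p. prime p \<Longrightarrow> Abs_fps (\<lambda>r. b (p ^ r)) = (\<Prod>i\<in>I. Abs_fps (\<lambda>r. c i (p ^ r)))" by blast
  have "ramanujan_series (\<lambda>s. \<Prod>i\<in>insert i I. f i s) (dirichlet_conv (c i) b)"
    using ramanujan_series_mult[OF insert.prems[of i] b(1)] insert by simp
  moreover have "dirichlet_conv (c i) b 1 = (\<Prod>i\<in>insert i I. c i 1)"
    using insert b(2) by (simp add: dirichlet_conv_def)
  moreover have "Abs_fps (\<lambda>r. dirichlet_conv (c i) b (p ^ r)) = (\<Prod>i\<in>insert i I. Abs_fps (\<lambda>r. c i (p ^ r)))"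
    if "prime p" for p
    using dirichlet_conv_prime_power[OF that, of "c i" b] b(3)[OF that] insert by simp
  ultimately show ?case by blast
qed

definition comp_mult_series :: "(nat \<Rightarrow> complex) \<Rightarrow> complex \<Rightarrow> complex" where
  "comp_mult_series \<beta> s = (\<Sum>\<^sub>\<infinity>n\<in>{1..}. comp_mult \<beta> n / of_nat n powr s)"

lemma ramanujan_comp_mult_series:
  assumes "\<And>p. prime p \<Longrightarrow> cmod (\<beta> p) \<le> 1"
  shows "ramanujan_series (comp_mult_series \<beta>) (comp_mult \<beta>)"
  unfolding comp_mult_series_def [abs_def]
  by (rule ramanujan_series_infsum[OF ramanujan_bounded[OF norm_comp_mult_le[OF assms]]])

lemma comp_mult_series_inverse:
  assumes \<beta>: "\<And>p. prime p \<Longrightarrow> cmod (\<beta> p) \<le> 1"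
  shows "\<exists>c. ramanujan_series (\<lambda>s. inverse (comp_mult_series \<beta> s)) c"
proof -
  define c where "c = (\<lambda>n. moebius n * comp_mult \<beta> n)"
  define M where "M = (\<lambda>s. \<Sum>\<^sub>\<infinity>n\<in>{1..}. c n / of_nat n powr s)"
  have "ramanujan_hypothesis c"
    unfolding c_def
    by (rule ramanujan_pointwise_mult[OF ramanujan_bounded[OF norm_moebius_le]
          ramanujan_bounded[OF norm_comp_mult_le[OF \<beta>]]])
  then have M: "ramanujan_series M c"
    unfolding M_def by (rule ramanujan_series_infsum)
  have prod: "ramanujan_series (\<lambda>s. M s * comp_mult_series \<beta> s) (dirichlet_conv c (comp_mult \<beta>))"
    by (rule ramanujan_series_mult[OF M ramanujan_comp_mult_series[OF \<beta>]])
  have "M s = inverse (comp_mult_series \<beta> s)" if "Re s > 1" for s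
  proof -
    have "((\<lambda>n. dirichlet_conv c (comp_mult \<beta>) n / of_nat n powr s) has_sum M s * comp_mult_series \<beta> s) {1..}"
      by (rule ramanujan_series_has_sum[OF prod that])
    then have "((\<lambda>n. (if n = 1 then 1 else 0) / of_nat n powr s) has_sum M s * comp_mult_series \<beta> s) {1..}"
      by (rule has_sum_cong[THEN iffD1, rotated])
         (use dirichlet_conv_moebius_comp_mult[of _ \<beta>] in \<open>auto simp: c_def\<close>)
    from has_sum_unique[OF this dirichlet_unit_has_sum] have "M s * comp_mult_series \<beta> s = 1" .
    then show ?thesis by (simp add: inverse_unique mult.commute)
  qed
  with M have "ramanujan_series (\<lambda>s. inverse (comp_mult_series \<beta> s)) c"
    by (rule ramanujan_series_cong)
  then show ?thesis by blast
qed

text \<open>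
  With \<open>D\<close> the product of the series, \<open>P N\<close> the partial Euler products and \<open>Q N\<close> their reciprocals,
  the sieve gives \<open>D Q N \<rightarrow> 1\<close>.  Together with \<open>P N Q N = 1\<close> and \<open>P N \<rightarrow> K\<close> this yields \<open>D = K\<close>, and the
  limit \<open>1\<close> excludes \<open>D = 0\<close>.
\<close>

lemma euler_product_eq:
  fixes \<gamma> :: "nat \<Rightarrow> nat \<Rightarrow> complex"
  assumes \<gamma>: "\<And>j p. j \<in> {1..m} \<Longrightarrow> prime p \<Longrightarrow> cmod (\<gamma> j p) \<le> 1" and s: "Re s > 1"
    and prod: "(\<lambda>p. if prime p then \<Prod>j=1..m. inverse (1 - \<gamma> j p / of_nat p powr s) else 1) has_prod K"
  shows "K = (\<Prod>j=1..m. comp_mult_series (\<gamma> j) s)" and "K \<noteq> 0"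
proof -
  define F where "F = (\<lambda>j n. comp_mult (\<gamma> j) n / of_nat n powr s)"
  define P where "P = (\<lambda>N. \<Prod>p\<le>N. if prime p then \<Prod>j=1..m. inverse (1 - \<gamma> j p / of_nat p powr s) else 1)"
  define Q where "Q = (\<lambda>N. \<Prod>j=1..m. \<Prod>p\<in>{p. prime p \<and> p \<le> N}. 1 - F j p)"
  define D where "D = (\<Prod>j=1..m. comp_mult_series (\<gamma> j) s)"
  have P: "P \<longlonglongrightarrow> K" unfolding P_def by (rule has_prod_imp_tendsto[OF prod])
  have "(\<lambda>N. infsum (F j) {1..} * (\<Prod>p\<in>{p. prime p \<and> p \<le> N}. 1 - F j p)) \<longlonglongrightarrow> 1" if j: "j \<in> {1..m}" for j
  proof (rule euler_product_inverse_tendsto)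
    have "ramanujan_hypothesis (comp_mult (\<gamma> j))"
      using ramanujan_comp_mult_series[of "\<gamma> j"] \<gamma>[OF j] by (auto simp: ramanujan_series_def)
    then show "(\<lambda>n. norm (F j n)) summable_on {1..}"
      unfolding F_def using s by (rule ramanujan_abs_summable_term)
    fix k n :: nat assume kn: "k \<ge> 1" "n \<ge> 1"
    have "complex_of_nat (k * n) powr s = of_nat k powr s * of_nat n powr s"
      using powr_times_real[of "of_nat k" "of_nat n" s] by simp
    then show "F j (k * n) = F j k * F j n"
      using kn by (simp add: F_def comp_mult_mult del: of_nat_mult)
  qed (auto simp: F_def)
  then have "(\<lambda>N. \<Prod>j=1..m. infsum (F j) {1..} * (\<Prod>p\<in>{p. prime p \<and> p \<le> N}. 1 - F j p)) \<longlonglongrightarrow> (\<Prod>j=1..m. 1)"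
    by (intro tendsto_prod) auto
  then have lim: "(\<lambda>N. D * Q N) \<longlonglongrightarrow> 1"
    by (simp add: D_def Q_def F_def comp_mult_series_def prod.distrib)
  have "P N * Q N = 1" for N
  proof -
    have fin: "finite {p. prime p \<and> p \<le> N}" by (rule finite_subset[of _ "{..N}"]) auto
    have "P N = (\<Prod>p\<in>{p\<in>{..N}. prime p}. \<Prod>j=1..m. inverse (1 - \<gamma> j p / of_nat p powr s))"
      unfolding P_def by (subst prod.inter_filter) (auto intro: prod.cong)
    also have "{p\<in>{..N}. prime p} = {p. prime p \<and> p \<le> N}" by auto
    also have "(\<Prod>p\<in>{p. prime p \<and> p \<le> N}. \<Prod>j=1..m. inverse (1 - \<gamma> j p / of_nat p powr s)) =
       (\<Prod>j=1..m. \<Prod>p\<in>{p. prime p \<and> p \<le> N}. inverse (1 - \<gamma> j p / of_nat p powr s))"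
      by (rule prod.swap)
    also have "\<dots> = (\<Prod>j=1..m. \<Prod>p\<in>{p. prime p \<and> p \<le> N}. inverse (1 - F j p))"
      by (intro prod.cong) (auto simp: F_def comp_mult_prime)
    finally have "P N * Q N = (\<Prod>j=1..m. \<Prod>p\<in>{p. prime p \<and> p \<le> N}. inverse (1 - F j p) * (1 - F j p))"
      by (simp add: Q_def prod.distrib)
    also have "\<dots> = (\<Prod>j=1..m. \<Prod>p\<in>{p. prime p \<and> p \<le> N}. 1)"
    proof (intro prod.cong refl)
      fix j p assume j: "j \<in> {1..m}" and p: "p \<in> {p. prime p \<and> p \<le> N}"
      then have p': "p > 1" "prime p" by (auto dest: prime_gt_1_nat)
      have "cmod (F j p) = cmod (\<gamma> j p) * real p powr - Re s"
        unfolding F_def using p' by (subst norm_dirichlet_term) (auto simp: comp_mult_prime)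
      also have "\<dots> \<le> 1 * real p powr - Re s" using \<gamma>[OF j] p' by (intro mult_right_mono) auto
      also have "\<dots> < 1 * real p powr 0" using p' s by (intro mult_strict_left_mono powr_less_mono) auto
      finally have "cmod (F j p) < 1" using p' by simp
      then have "1 - F j p \<noteq> 0" by auto
      then show "inverse (1 - F j p) * (1 - F j p) = 1" by simp
    qed
    finally show ?thesis by simp
  qed
  then have "(\<lambda>N. D * Q N * P N) = (\<lambda>N. D)" by (auto simp: mult_ac)
  moreover have "(\<lambda>N. D * Q N * P N) \<longlonglongrightarrow> 1 * K" by (rule tendsto_mult[OF lim P])
  ultimately have "K = D" by (simp add: LIMSEQ_const_iff)
  then show "K = (\<Prod>j=1..m. comp_mult_series (\<gamma> j) s)" by (simp add: D_def)
  have "D \<noteq> 0"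
  proof
    assume "D = 0"
    with lim have "(\<lambda>N::nat. 0::complex) \<longlonglongrightarrow> 1" by simp
    then show False by (simp add: LIMSEQ_const_iff)
  qed
  with \<open>K = D\<close> show "K \<noteq> 0" by simp
qed

subsection \<open>Reciprocal and logarithm of a polynomial Euler product\<close>

text \<open>
  By the Ramanujan hypothesis the power series \<open>A(X) = \<Sum> a(p\<^sup>r) p\<^sup>-\<^sup>r X\<^sup>r\<close> converges for \<open>|X| < p\<close>.  It is the
  product of the geometric series of \<open>1/(1 - \<gamma>\<^sub>i X)\<close>, so \<open>A(X) \<Prod>(1 - \<gamma>\<^sub>i X) = 1\<close> in this disc.  If
  \<open>|\<gamma>\<^sub>j| > 1/p\<close>, the point \<open>1/\<gamma>\<^sub>j\<close> belongs to the disc, and there the left-hand side is \<open>0\<close>.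
\<close>

lemma euler_roots_bound:
  fixes \<gamma> :: "nat \<Rightarrow> nat \<Rightarrow> complex"
  assumes a: "ramanujan_hypothesis a" and p: "prime p" and fin: "finite I"
    and eq: "Abs_fps (\<lambda>r. a (p ^ r) / of_nat (p ^ r)) = (\<Prod>j\<in>I. Abs_fps (\<lambda>r. \<gamma> j p ^ r))"
    and j: "j \<in> I"
  shows "cmod (of_nat p * \<gamma> j p) \<le> 1"
proof (rule ccontr)
  assume "\<not> ?thesis"
  then have gt: "cmod (\<gamma> j p) > 1 / real p"
    using p prime_gt_0_nat[OF p] by (simp add: norm_mult field_simps)
  have p1: "real p > 1" using prime_gt_1_nat[OF p] by simp
  define A where "A = Abs_fps (\<lambda>r. a (p ^ r) / of_nat (p ^ r))"
  define G where "G = (\<lambda>j. 1 - fps_const (\<gamma> j p) * fps_X)"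
  have one: "Abs_fps (\<lambda>r. c ^ r) * (1 - fps_const c * fps_X) = 1" for c :: complex
  proof (rule fps_ext)
    fix n
    have "Abs_fps (\<lambda>r. c ^ r) * (1 - fps_const c * fps_X) =
        Abs_fps (\<lambda>r. c ^ r) - fps_const c * (Abs_fps (\<lambda>r. c ^ r) * fps_X)"
      by (simp add: right_diff_distrib mult.left_commute)
    then show "(Abs_fps (\<lambda>r. c ^ r) * (1 - fps_const c * fps_X)) $ n = 1 $ n"
      by (cases n) auto
  qed
  have "A * (\<Prod>i\<in>I. G i) = (\<Prod>i\<in>I. Abs_fps (\<lambda>r. \<gamma> i p ^ r) * G i)"
    by (simp only: A_def eq prod.distrib)
  also have "\<dots> = 1" unfolding G_def one by simp
  finally have AG: "A * (\<Prod>i\<in>I - {j}. G i) * G j = 1"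
    using fin j by (simp add: prod.remove mult_ac)
  have radX: "fps_conv_radius (fps_const c * fps_X) = \<infinity>" for c :: complex
    using fps_conv_radius_mult[of "fps_const c" fps_X] by simp
  have radG: "fps_conv_radius (G i) = \<infinity>" for i
    using fps_conv_radius_diff[of 1 "fps_const (\<gamma> i p) * fps_X"] radX by (simp add: G_def)
  have radA: "fps_conv_radius A \<ge> ereal (real p)"
    unfolding fps_conv_radius_def
  proof (rule conv_radius_geI_ex')
    fix r :: real assume r: "0 < r" "ereal r < ereal (real p)"
    (* As q^2 = p / r, the bound a(p^n) = O(q^n) makes the n-th term O((q r / p)^n) = O(q^-n).
       The exponent epsilon is chosen so that p^epsilon = q. *)
    define q where "q = sqrt (real p / r)"
    have q: "q > 1" "q * q = real p / r" using r p1 by (auto simp: q_def)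
    define \<epsilon> where "\<epsilon> = ln q / ln (real p)"
    have \<epsilon>: "\<epsilon> > 0" "real p powr \<epsilon> = q" using q p1 by (auto simp: \<epsilon>_def powr_def)
    obtain C where C: "C > 0" "\<And>n. n \<ge> 1 \<Longrightarrow> cmod (a n) \<le> C * real n powr \<epsilon>"
      by (rule ramanujan_bound[OF a \<epsilon>(1)]) blast
    show "summable (\<lambda>n. fps_nth A n * of_real r ^ n)"
    proof (rule summable_comparison_test')
      show "summable (\<lambda>n. C * (1 / q) ^ n)" using q by (intro summable_mult summable_geometric) auto
      fix n :: nat assume "n \<ge> 0"
      have pn: "p ^ n \<ge> 1" using p1 by simp
      have "real (p ^ n) powr \<epsilon> = (real p powr \<epsilon>) ^ n"
        using p1 by (simp add: powr_powr powr_realpow[symmetric] mult.commute)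
      then have "cmod (a (p ^ n)) \<le> C * q ^ n" using C(2)[OF pn] \<epsilon> by simp
      then have "cmod (a (p ^ n)) * (r ^ n / real p ^ n) \<le> C * q ^ n * (r ^ n / real p ^ n)"
        using r by (intro mult_right_mono) auto
      also have "C * q ^ n * (r ^ n / real p ^ n) = C * (q * r / real p) ^ n"
        by (simp add: power_mult_distrib power_divide)
      also have "q * r / real p = 1 / q" using q r p1 by (simp add: field_simps)
      finally show "norm (fps_nth A n * of_real r ^ n) \<le> C * (1 / q) ^ n"
        using r by (simp add: A_def norm_mult norm_divide norm_power)
    qed
  qed
  define z where "z = 1 / \<gamma> j p"
  have nz: "\<gamma> j p \<noteq> 0" using gt p1 by auto
  have z: "ereal (norm z) < ereal (real p)"
    using gt p1 nz by (simp add: z_def norm_divide field_simps)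
  have radR: "fps_conv_radius (A * (\<Prod>i\<in>I - {j}. G i)) \<ge> ereal (real p)"
  proof -
    have "fps_conv_radius (\<Prod>i\<in>J. G i) \<ge> ereal (real p)" if "finite J" for J
      using that by (induction J rule: finite_induct) (auto simp: radG intro!: fps_conv_radius_mult_ge)
    then show ?thesis using radA fin by (intro fps_conv_radius_mult_ge) auto
  qed
  have "eval_fps (A * (\<Prod>i\<in>I - {j}. G i) * G j) z = eval_fps (A * (\<Prod>i\<in>I - {j}. G i)) z * eval_fps (G j) z"
    by (rule eval_fps_mult[OF less_le_trans[OF z radR]]) (simp add: radG)
  also have "eval_fps (G j) z = 0"
    using nz by (simp add: G_def eval_fps_diff eval_fps_mult radX z_def)
  finally show False using AG by simp
qed

text \<open>
  Since the factors do not vanish for \<open>Re s > 1\<close>, the roots satisfy \<open>|\<beta>\<^sub>j(p)| \<le> p\<close>.  This suffices to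
  expand \<open>L(s + 1)\<close>, whose roots are \<open>\<beta>\<^sub>j(p)/p\<close>, into a product of absolutely convergent series with
  completely multiplicative coefficients.  By uniqueness the coefficients of the product are
  \<open>a(n)/n\<close>, and \<open>euler_roots_bound\<close> improves the bound to \<open>|\<beta>\<^sub>j(p)| \<le> 1\<close>.  Now \<open>L\<close> itself is a
  product of such series, each of which Moebius inversion inverts.
\<close>

lemma polynomial_euler_product_inverse:
  assumes L: "ramanujan_series L a" and euler: "polynomial_euler_product L"
  shows "a 1 = 1" and "\<And>s. Re s > 1 \<Longrightarrow> L s \<noteq> 0" and "\<exists>c. ramanujan_series (\<lambda>s. inverse (L s)) c"
proof -
  from euler obtain m :: nat and \<beta> :: "nat \<Rightarrow> nat \<Rightarrow> complex" where E: "\<forall>s. Re s > 1 \<longrightarrow>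
        (\<forall>p. prime p \<longrightarrow> (\<forall>j\<in>{1..m}. 1 - \<beta> j p / of_nat p powr s \<noteq> 0)) \<and>
        (\<lambda>p. if prime p then \<Prod>j=1..m. inverse (1 - \<beta> j p / of_nat p powr s) else 1) has_prod L s"
    unfolding polynomial_euler_product_def by blast
  have nz: "1 - \<beta> j p / of_nat p powr s \<noteq> 0" if "Re s > 1" "prime p" "j \<in> {1..m}" for s p j
    using E[rule_format, OF that(1), THEN conjunct1] that(2,3) by blast
  have prod: "(\<lambda>p. if prime p then \<Prod>j=1..m. inverse (1 - \<beta> j p / of_nat p powr s) else 1) has_prod L s"
    if "Re s > 1" for s
    using E[rule_format, OF that] by (rule conjunct2)
  have ra: "ramanujan_hypothesis a" using L by (simp add: ramanujan_series_def)
  have le_p: "cmod (\<beta> j p) \<le> real p" if "j \<in> {1..m}" "prime p" for j p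
  proof (rule ccontr)
    assume "\<not> ?thesis"
    then have gt: "cmod (\<beta> j p) > real p" by simp
    have p: "real p > 1" using prime_gt_1_nat[OF that(2)] by simp
    then have b0: "\<beta> j p \<noteq> 0" using gt by auto
    (* At this point p^s = beta, so the factor vanishes although Re s > 1. *)
    define s where "s = Ln (\<beta> j p) / of_real (ln (real p))"
    have "Re s = ln (cmod (\<beta> j p)) / ln (real p)" using b0 by (simp add: s_def)
    also have "\<dots> > 1"
    proof -
      have "ln (real p) < ln (cmod (\<beta> j p))" using gt p by (subst ln_less_cancel_iff) linarith+
      then show ?thesis using p by simp
    qed
    finally have "Re s > 1" .
    moreover have "complex_of_nat p powr s = \<beta> j p"
      using p b0 Ln_of_real[of "real p"] by (auto simp: powr_def s_def)
    ultimately show False using nz[OF _ that(2,1), of s] b0 by auto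
  qed
  define \<gamma> where "\<gamma> = (\<lambda>j p. \<beta> j p / of_nat p)"
  have \<gamma>: "cmod (\<gamma> j p) \<le> 1" if "j \<in> {1..m}" "prime p" for j p
    using le_p[OF that] prime_gt_0_nat[OF that(2)] by (simp add: \<gamma>_def norm_divide)
  have powr1: "complex_of_nat n powr (s + 1) = of_nat n * of_nat n powr s" for n s
    by (cases "n = 0") (auto simp: powr_add)
  have shift: "L (s + 1) = (\<Prod>j=1..m. comp_mult_series (\<gamma> j) s)" if s: "Re s > 1" for s
  proof (rule euler_product_eq(1)[OF \<gamma> s])
    have "Re (s + 1) > 1" using s by simp
    have "\<beta> j p / of_nat p powr (s + 1) = \<gamma> j p / of_nat p powr s" for j p
      by (simp add: powr1 \<gamma>_def)
    with prod[OF \<open>Re (s + 1) > 1\<close>]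
    show "(\<lambda>p. if prime p then \<Prod>j=1..m. inverse (1 - \<gamma> j p / of_nat p powr s) else 1) has_prod L (s + 1)"
      by (simp only:)
  qed
  have S1: "ramanujan_series (\<lambda>s. L (s + 1)) (\<lambda>n. a n * (1 / of_nat n))"
  proof (rule ramanujan_seriesI)
    show "ramanujan_hypothesis (\<lambda>n. a n * (1 / of_nat n))"
      using ra by (rule ramanujan_pointwise_mult) (rule ramanujan_bounded[of _ 1], simp add: norm_divide)
    fix s :: complex assume "Re s > 1"
    then show "((\<lambda>n. a n * (1 / of_nat n) / of_nat n powr s) has_sum L (s + 1)) {1..}"
      using ramanujan_series_has_sum[OF L, of "s + 1"] by (simp add: powr1)
  qed
  obtain b where b: "ramanujan_series (\<lambda>s. \<Prod>j=1..m. comp_mult_series (\<gamma> j) s) b"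
     "\<And>p. prime p \<Longrightarrow> Abs_fps (\<lambda>r. b (p ^ r)) = (\<Prod>j=1..m. Abs_fps (\<lambda>r. comp_mult (\<gamma> j) (p ^ r)))"
    using ramanujan_series_prod_coeffs[of "{1..m}" "\<lambda>j. comp_mult_series (\<gamma> j)" "\<lambda>j. comp_mult (\<gamma> j)"]
      ramanujan_comp_mult_series[OF \<gamma>] by auto
  have ab: "a n * (1 / of_nat n) = b n" if "n \<ge> 1" for n
    by (rule ramanujan_series_unique[OF S1 ramanujan_series_cong[OF b(1)] that]) (simp add: shift)
  have \<beta>: "cmod (\<beta> j p) \<le> 1" if j: "j \<in> {1..m}" and p: "prime p" for j p
  proof -
    have "a (p ^ r) / of_nat (p ^ r) = b (p ^ r)" for r
      using ab[of "p ^ r"] prime_gt_0_nat[OF p] by simp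
    then have "Abs_fps (\<lambda>r. a (p ^ r) / of_nat (p ^ r)) = (\<Prod>j=1..m. Abs_fps (\<lambda>r. \<gamma> j p ^ r))"
      using b(2)[OF p] p by (simp add: comp_mult_prime_power)
    from euler_roots_bound[where \<gamma> = \<gamma> and I = "{1..m}", OF ra p finite_atLeastAtMost this j] show ?thesis
      using prime_gt_0_nat[OF p] by (simp add: \<gamma>_def)
  qed
  have Leq: "L s = (\<Prod>j=1..m. comp_mult_series (\<beta> j) s)" if "Re s > 1" for s
    by (rule euler_product_eq(1)[OF \<beta> that prod[OF that]])
  show "L s \<noteq> 0" if "Re s > 1" for s
    by (rule euler_product_eq(2)[OF \<beta> that prod[OF that]])
  obtain d where d: "ramanujan_series (\<lambda>s. \<Prod>j=1..m. comp_mult_series (\<beta> j) s) d"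
     "d 1 = (\<Prod>j=1..m. comp_mult (\<beta> j) 1)"
    using ramanujan_series_prod_coeffs[of "{1..m}" "\<lambda>j. comp_mult_series (\<beta> j)" "\<lambda>j. comp_mult (\<beta> j)"]
      ramanujan_comp_mult_series[OF \<beta>] by auto
  have "a 1 = d 1"
    by (rule ramanujan_series_unique[OF L ramanujan_series_cong[OF d(1)]]) (simp_all add: Leq)
  then show "a 1 = 1" using d(2) by simp
  have "\<exists>c. ramanujan_series (\<lambda>s. \<Prod>j=1..m. inverse (comp_mult_series (\<beta> j) s)) c"
    by (rule ramanujan_series_prod) (use comp_mult_series_inverse[OF \<beta>] in auto)
  then obtain c where "ramanujan_series (\<lambda>s. \<Prod>j=1..m. inverse (comp_mult_series (\<beta> j) s)) c" ..
  then have "ramanujan_series (\<lambda>s. inverse (L s)) c"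
    by (rule ramanujan_series_cong) (simp add: Leq prod_inversef[symmetric] o_def)
  then show "\<exists>c. ramanujan_series (\<lambda>s. inverse (L s)) c" by blast
qed

text \<open>
  Termwise integration divides the coefficients of \<open>L'/L\<close> by \<open>- ln n\<close>, which keeps the Ramanujan
  bound.  At \<open>n = 1\<close> this is a division by zero, of value \<open>0\<close>; it yields the right coefficient
  because \<open>c 1 = 0\<close> and the logarithm vanishes at \<open>+\<infinity>\<close>.
\<close>

lemma normalized_log_series:
  assumes L: "ramanujan_series L a" and a1: "a 1 = 1" and nz: "\<And>s. Re s > 1 \<Longrightarrow> L s \<noteq> 0"
    and c: "ramanujan_series (\<lambda>s. deriv L s / L s) c" and c1: "c 1 = 0"
  obtains lg b where "is_normalized_log L lg" "ramanujan_series lg b"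
    "\<And>s. Re s > 1 \<Longrightarrow> (lg has_field_derivative deriv L s / L s) (at s)"
proof -
  define b where "b = (\<lambda>n. c n * - of_real (1 / ln (real n)))"
  have rc: "ramanujan_hypothesis c" using c by (simp add: ramanujan_series_def)
  have rb: "ramanujan_hypothesis b" unfolding b_def
  proof (rule ramanujan_pointwise_mult[OF rc ramanujan_bounded])
    fix n :: nat assume "n \<ge> 1"
    show "cmod (- complex_of_real (1 / ln (real n))) \<le> 1 / ln 2"
    proof (cases "n = 1")
      case False
      then have "ln 2 \<le> ln (real n)" using \<open>n \<ge> 1\<close> by simp
      then have "1 / ln (real n) \<le> 1 / ln 2" by (rule frac_le[rotated 3]) simp_all
      moreover have "ln (real n) > 0" using False \<open>n \<ge> 1\<close> by simp
      ultimately show ?thesis by (simp add: norm_divide)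
    next
      case True
      then show ?thesis by simp
    qed
  qed
  define lg where "lg = (\<lambda>s. \<Sum>\<^sub>\<infinity>n\<in>{1..}. b n / of_nat n powr s)"
  have lg: "ramanujan_series lg b"
    unfolding lg_def by (rule ramanujan_series_infsum[OF rb])
  have S: "open {s::complex. Re s > 1}" "connected {s::complex. Re s > 1}"
    by (auto intro: open_halfspace_Re_gt convex_connected convex_halfspace_Re_gt)
  have holL: "L holomorphic_on {s. Re s > 1}" by (rule ramanujan_series_deriv(1)[OF L])
  have hol: "lg holomorphic_on {s. Re s > 1}" by (rule ramanujan_series_deriv(1)[OF lg])
  have der: "deriv lg s = deriv L s / L s" if s: "Re s > 1" for s
  proof -
    have "((\<lambda>n. (b n * - of_real (ln (real n))) / of_nat n powr s) has_sum deriv lg s) {1..}"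
      by (rule ramanujan_series_has_sum[OF ramanujan_series_deriv(2)[OF lg] s])
    then have "((\<lambda>n. c n / of_nat n powr s) has_sum deriv lg s) {1..}"
    proof (rule has_sum_cong[THEN iffD1, rotated])
      fix n :: nat assume "n \<in> {1..}"
      then show "(b n * - of_real (ln (real n))) / of_nat n powr s = c n / of_nat n powr s"
        using c1 by (cases "n = 1") (auto simp: b_def)
    qed
    from has_sum_unique[OF this ramanujan_series_has_sum[OF c s]] show ?thesis .
  qed
  have lg': "(lg has_field_derivative deriv L s / L s) (at s)" if "Re s > 1" for s
    using holomorphic_derivI[OF hol S(1), of s] that by (simp add: der)
  have L': "(L has_field_derivative deriv L s) (at s)" if "Re s > 1" for s
    using holomorphic_derivI[OF holL S(1), of s] that by simp
  (* H has derivative zero and limit 1 at infinity. *)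
  define H where "H = (\<lambda>s. exp (lg s) / L s)"
  have "\<exists>k. \<forall>s\<in>{s. Re s > 1}. H s = k"
  proof -
    have "(H has_field_derivative 0) (at s within {s. Re s > 1})" if "s \<in> {s. Re s > 1}" for s
    proof -
      have s: "Re s > 1" using that by simp
      have "(H has_field_derivative 0) (at s)"
        unfolding H_def
        by (rule derivative_eq_intros lg'[OF s] L'[OF s] refl nz[OF s])+
           (use nz[OF s] in \<open>simp add: field_simps\<close>)
      then show ?thesis by (rule DERIV_subset) auto
    qed
    then show ?thesis
      using has_field_derivative_zero_constant[OF convex_halfspace_Re_gt, of 1 H] by (metis mem_Collect_eq)
  qed
  then obtain k where k: "\<And>s. Re s > 1 \<Longrightarrow> H s = k" by auto
  have b1: "b 1 = 0" by (simp add: b_def)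
  have lim: "((\<lambda>\<sigma>. lg (complex_of_real \<sigma>)) \<longlongrightarrow> 0) at_top"
    using ramanujan_series_limit[OF lg] b1 by simp
  have "((\<lambda>\<sigma>. H (complex_of_real \<sigma>)) \<longlongrightarrow> exp 0 / 1) at_top"
    unfolding H_def using ramanujan_series_limit[OF L] a1 lim by (intro tendsto_intros) auto
  moreover have "((\<lambda>\<sigma>. H (complex_of_real \<sigma>)) \<longlongrightarrow> k) at_top"
    by (rule tendsto_eventually) (use eventually_gt_at_top[of 1] in eventually_elim, simp add: k)
  ultimately have "k = 1" using tendsto_unique[OF trivial_limit_at_top_linorder] by fastforce
  then have "exp (lg s) = L s" if "Re s > 1" for s
    using k[OF that] nz[OF that] by (simp add: H_def)
  then have "is_normalized_log L lg"
    unfolding is_normalized_log_def using hol lim by auto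
  then show ?thesis using that lg lg' by blast
qed

section \<open>Normal families\<close>

text \<open>
  Stereographic projection, with \<open>complex \<times> real\<close> in the role of the space around the sphere.  It turns
  the chordal metric into a Euclidean distance and thereby provides the triangle inequality.
\<close>

definition stereo :: "complex option \<Rightarrow> complex \<times> real" where
  "stereo p = (case p of None \<Rightarrow> (0, 1)
     | Some z \<Rightarrow> (2 * z / of_real (1 + cmod z ^ 2), 1 - 2 / (1 + cmod z ^ 2)))"

lemma chordal_eq_dist: "chordal p q = dist (stereo p) (stereo q)"
proof -
  have pos: "1 + cmod z ^ 2 > 0" for z using zero_le_power2[of "cmod z"] by linarith
  have SS: "chordal (Some z) (Some w) = dist (stereo (Some z)) (stereo (Some w))" for z w
  proof -
    define A B where "A = 1 + cmod z ^ 2" and "B = 1 + cmod w ^ 2"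
    have AB: "A > 0" "B > 0" using pos by (auto simp: A_def B_def)
    have A2: "cmod z ^ 2 = A - 1" and B2: "cmod w ^ 2 = B - 1" by (auto simp: A_def B_def)
    define R where "R = Re (z * cnj w)"
    have sq: "cmod (u - v) ^ 2 = cmod u ^ 2 + cmod v ^ 2 - 2 * Re (u * cnj v)" for u v
      unfolding cmod_power2 by (simp add: power2_eq_square algebra_simps)
    have st: "stereo (Some z) = (2 * z / of_real A, 1 - 2 / A)" "stereo (Some w) = (2 * w / of_real B, 1 - 2 / B)"
      by (simp_all add: stereo_def A_def B_def)
    have "dist (stereo (Some z)) (stereo (Some w)) ^ 2 =
        cmod (2 * z / of_real A - 2 * w / of_real B) ^ 2 + \<bar>1 - 2 / A - (1 - 2 / B)\<bar> ^ 2"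
      unfolding st dist_prod_def by (simp only: fst_conv snd_conv dist_norm real_norm_def)
        (rule real_sqrt_pow2, intro add_nonneg_nonneg zero_le_power2)
    also have "\<bar>1 - 2 / A - (1 - 2 / B)\<bar> ^ 2 = (2 / B - 2 / A) ^ 2" by simp
    also have "cmod (2 * z / of_real A - 2 * w / of_real B) ^ 2 =
       4 * (A - 1) / A ^ 2 + 4 * (B - 1) / B ^ 2 - 8 * R / (A * B)"
      unfolding sq using AB
      by (simp add: norm_divide norm_mult power_divide power_mult_distrib A2 B2 R_def)
    also have "4 * (A - 1) / A ^ 2 + 4 * (B - 1) / B ^ 2 - 8 * R / (A * B) + (2 / B - 2 / A) ^ 2
       = 4 * (A + B - 2 - 2 * R) / (A * B)"
      using AB by (simp add: field_simps power2_eq_square)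
    also have "A + B - 2 - 2 * R = cmod (z - w) ^ 2"
      unfolding sq A2 B2 R_def by simp
    also have "4 * cmod (z - w) ^ 2 / (A * B) = chordal (Some z) (Some w) ^ 2"
      using AB by (simp add: power_divide power_mult_distrib A_def B_def)
    finally have "dist (stereo (Some z)) (stereo (Some w)) ^ 2 = chordal (Some z) (Some w) ^ 2" .
    moreover have "chordal (Some z) (Some w) \<ge> 0" by simp
    ultimately show ?thesis by (metis power2_eq_imp_eq zero_le_dist)
  qed
  have SN: "2 / sqrt (1 + cmod z ^ 2) = dist (stereo (Some z)) (stereo None)" for z
  proof -
    define A where "A = 1 + cmod z ^ 2"
    have A: "A > 0" "cmod z ^ 2 = A - 1" using pos by (auto simp: A_def)
    have st: "stereo (Some z) = (2 * z / of_real A, 1 - 2 / A)" "stereo None = (0, 1)"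
      by (simp_all add: stereo_def A_def)
    have "dist (stereo (Some z)) (stereo None) ^ 2 =
        cmod (2 * z / of_real A - 0) ^ 2 + \<bar>1 - 2 / A - 1\<bar> ^ 2"
      unfolding st dist_prod_def by (simp only: fst_conv snd_conv dist_norm real_norm_def)
        (rule real_sqrt_pow2, intro add_nonneg_nonneg zero_le_power2)
    also have "\<dots> = 4 * (A - 1) / A ^ 2 + 4 / A ^ 2"
      using A by (simp add: norm_divide norm_mult power_divide power_mult_distrib)
    also have "\<dots> = (2 / sqrt A) ^ 2" using A by (simp add: field_simps power2_eq_square)
    finally have "dist (stereo (Some z)) (stereo None) ^ 2 = (2 / sqrt A) ^ 2" .
    then show ?thesis using A by (metis A_def power2_eq_imp_eq zero_le_dist divide_nonneg_nonneg real_sqrt_ge_zero less_imp_le zero_le_numeral)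
  qed
  show ?thesis
    using SS SN by (cases p; cases q) (auto simp: dist_commute)
qed

lemma chordal_triangle: "chordal p r \<le> chordal p q + chordal q r"
  unfolding chordal_eq_dist by (rule dist_triangle)

lemma chordal_commute: "chordal p q = chordal q p"
  unfolding chordal_eq_dist by (rule dist_commute)

lemma chordal_le_dist: "chordal (Some z) (Some w) \<le> 2 * cmod (z - w)"
proof -
  have "1 \<le> sqrt (1 + cmod z ^ 2)" "1 \<le> sqrt (1 + cmod w ^ 2)" by simp_all
  then have "1 * 1 \<le> sqrt (1 + cmod z ^ 2) * sqrt (1 + cmod w ^ 2)" by (rule mult_mono) auto
  then have "2 * cmod (z - w) / (sqrt (1 + cmod z ^ 2) * sqrt (1 + cmod w ^ 2)) \<le> 2 * cmod (z - w) / 1"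
    by (intro divide_left_mono) auto
  then show ?thesis by simp
qed

lemma chordal_infinity_gt_1: "chordal (Some w) None < 1 \<Longrightarrow> cmod w > 1"
proof (rule ccontr)
  assume *: "chordal (Some w) None < 1" "\<not> cmod w > 1"
  then have "cmod w ^ 2 \<le> 1" by (simp add: power_le_one)
  then have "sqrt (1 + cmod w ^ 2) \<le> sqrt 4" by (intro real_sqrt_le_mono) simp
  then have s: "sqrt (1 + cmod w ^ 2) \<le> 2" by simp
  have "sqrt (1 + cmod w ^ 2) > 0" using zero_le_power2[of "cmod w"] by (simp add: add_pos_nonneg)
  then have "2 / sqrt (1 + cmod w ^ 2) \<ge> 1" using s by simp
  with * show False by simp
qed

lemma inverse_norm_le_chordal:
  assumes "cmod w > 1"
  shows "1 / cmod w \<le> chordal (Some w) None"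
proof -
  have "1 \<le> cmod w ^ 2" using assms by simp
  then have "1 + cmod w ^ 2 \<le> (2 * cmod w) ^ 2" by (simp add: power_mult_distrib)
  then have "sqrt (1 + cmod w ^ 2) \<le> 2 * cmod w" by (intro real_le_lsqrt) auto
  moreover have "sqrt (1 + cmod w ^ 2) > 0" using zero_le_power2[of "cmod w"] by (simp add: add_pos_nonneg)
  ultimately have "2 / (2 * cmod w) \<le> 2 / sqrt (1 + cmod w ^ 2)" by (intro frac_le) auto
  then show ?thesis by simp
qed

lemma norm_le_chordal_infinity:
  assumes "c > 0" "chordal (Some w) None \<ge> c"
  shows "cmod w \<le> 2 / c"
proof -
  have "cmod w \<le> sqrt (1 + cmod w ^ 2)" by (rule real_le_rsqrt) simp
  moreover have s: "sqrt (1 + cmod w ^ 2) > 0" using zero_le_power2[of "cmod w"] by (simp add: add_pos_nonneg)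
  have "c * sqrt (1 + cmod w ^ 2) \<le> 2" using assms(2) s by (simp add: pos_le_divide_eq)
  then have "sqrt (1 + cmod w ^ 2) \<le> 2 / c" using assms(1) by (simp add: field_simps)
  ultimately show ?thesis by linarith
qed

text \<open>
  The values \<open>g z\<close> and \<open>g z0\<close> are compared by way of a fixed member \<open>h N\<close>, which is continuous at \<open>z0\<close>
  and close to \<open>g\<close> at both points.
\<close>

lemma chordal_limit_locally_close:
  assumes op: "open \<Omega>" and hol: "\<And>j::nat. h j holomorphic_on \<Omega>"
    and lim: "\<And>K e. compact K \<Longrightarrow> K \<subseteq> \<Omega> \<Longrightarrow> e > 0 \<Longrightarrow> \<forall>\<^sub>F j in sequentially. \<forall>z\<in>K. chordal (Some (h j z)) (g z) < e"
    and z0: "z0 \<in> \<Omega>" and e: "e > 0"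
  obtains \<rho> N where "\<rho> > 0" "ball z0 \<rho> \<subseteq> \<Omega>" "\<And>j z. j \<ge> N \<Longrightarrow> z \<in> ball z0 \<rho> \<Longrightarrow> chordal (Some (h j z)) (g z0) < 4 * e"
proof -
  obtain \<rho>0 where \<rho>0: "\<rho>0 > 0" "cball z0 \<rho>0 \<subseteq> \<Omega>" using op z0 open_contains_cball by blast
  obtain N where N: "\<And>j z. j \<ge> N \<Longrightarrow> z \<in> cball z0 \<rho>0 \<Longrightarrow> chordal (Some (h j z)) (g z) < e"
    using lim[OF compact_cball \<rho>0(2) e] unfolding eventually_sequentially by blast
  have "isCont (h N) z0"
    using holomorphic_on_imp_continuous_on[OF hol[of N]] op z0 by (simp add: continuous_on_eq_continuous_at)
  then obtain \<rho>1 where \<rho>1: "\<rho>1 > 0" "\<And>z. dist z z0 < \<rho>1 \<Longrightarrow> dist (h N z) (h N z0) < e / 2"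
    unfolding continuous_at_eps_delta using e half_gt_zero by blast
  have "chordal (Some (h j z)) (g z0) < 4 * e" if "j \<ge> N" "z \<in> ball z0 (min \<rho>0 \<rho>1)" for j z
  proof -
    have z: "z \<in> cball z0 \<rho>0" "dist z z0 < \<rho>1" using that by (auto simp: dist_commute)
    have "chordal (Some (h N z)) (Some (h N z0)) \<le> 2 * cmod (h N z - h N z0)" by (rule chordal_le_dist)
    also have "\<dots> < e" using \<rho>1(2)[OF z(2)] by (simp add: dist_norm)
    finally have 1: "chordal (Some (h N z)) (Some (h N z0)) < e" .
    have 2: "chordal (Some (h j z)) (g z) < e" "chordal (g z) (Some (h N z)) < e" "chordal (Some (h N z0)) (g z0) < e"
      using N[OF that(1) z(1)] N[OF order_refl z(1)] N[OF order_refl, of z0] \<rho>0(1) by (auto simp: chordal_commute)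
    show ?thesis
      using chordal_triangle[of "Some (h j z)" "g z0" "g z"] chordal_triangle[of "g z" "g z0" "Some (h N z)"]
        chordal_triangle[of "Some (h N z)" "g z0" "Some (h N z0)"] 1 2 by linarith
  qed
  moreover have "ball z0 (min \<rho>0 \<rho>1) \<subseteq> \<Omega>" using \<rho>0(2) by auto
  ultimately show ?thesis using that[of "min \<rho>0 \<rho>1" N] \<rho>0(1) \<rho>1(1) by simp
qed

text \<open>
  The reciprocals \<open>1/h\<^sub>j\<close> are bounded by \<open>1\<close> and have no zeros.  By Montel's theorem they have a limit
  along a subsequence; it vanishes at \<open>z0\<close> but not at \<open>z1\<close>, contrary to Hurwitz's theorem.
\<close>

lemma no_pole_next_to_bounded:
  assumes \<rho>: "\<rho> > 0" and hol: "\<And>j::nat. h j holomorphic_on ball z0 \<rho>"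
    and large: "\<And>j z. z \<in> ball z0 \<rho> \<Longrightarrow> cmod (h j z) > 1"
    and pole: "\<And>e. e > 0 \<Longrightarrow> \<forall>\<^sub>F j in sequentially. 1 / cmod (h j z0) < e"
    and z1: "z1 \<in> ball z0 \<rho>" and bdd: "\<And>j. cmod (h j z1) \<le> C"
  shows False
proof -
  define S where "S = ball z0 \<rho>"
  define \<phi> where "\<phi> = (\<lambda>j z. 1 / h j z)"
  have nz: "h j z \<noteq> 0" if "z \<in> S" for j z using large[of z j] that by (auto simp: S_def)
  have hol\<phi>: "\<phi> j holomorphic_on S" for j
    unfolding \<phi>_def using hol nz by (intro holomorphic_intros) (auto simp: S_def)
  obtain G r where G: "G holomorphic_on S" "strict_mono (r::nat\<Rightarrow>nat)"
    "\<And>x. x \<in> S \<Longrightarrow> (\<lambda>n. \<phi> (r n) x) \<longlonglongrightarrow> G x"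
    "\<And>K. compact K \<Longrightarrow> K \<subseteq> S \<Longrightarrow> uniform_limit K (\<phi> \<circ> r) G sequentially"
  proof (rule Montel[of S "range \<phi>" \<phi>])
    show "\<exists>B. \<forall>h\<in>range \<phi>. \<forall>z\<in>K. cmod (h z) \<le> B" if "compact K" "K \<subseteq> S" for K
    proof (intro exI[of _ 1] ballI)
      fix f z assume "f \<in> range \<phi>" "z \<in> K"
      then obtain j where "f = \<phi> j" by auto
      moreover have "z \<in> S" using that \<open>z \<in> K\<close> by auto
      ultimately show "cmod (f z) \<le> 1" using large[of z j] by (auto simp: \<phi>_def S_def norm_divide divide_le_eq)
    qed
  qed (use hol\<phi> in \<open>auto simp: S_def\<close>)
  have z0S: "z0 \<in> S" and z1S: "z1 \<in> S" using \<rho> z1 by (auto simp: S_def)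
  have "(\<lambda>n. \<phi> n z0) \<longlonglongrightarrow> 0"
  proof (rule tendstoI)
    fix e :: real assume "e > 0"
    from pole[OF this] show "\<forall>\<^sub>F j in sequentially. dist (\<phi> j z0) 0 < e"
      by (simp add: \<phi>_def norm_divide)
  qed
  then have "(\<lambda>n. \<phi> (r n) z0) \<longlonglongrightarrow> 0" using LIMSEQ_subseq_LIMSEQ[OF _ G(2)] by (auto simp: o_def)
  with G(3)[OF z0S] have G0: "G z0 = 0" by (rule LIMSEQ_unique)
  have C: "C > 0" using large[OF z1, of 0] bdd[of 0] by linarith
  have "1 / C \<le> cmod (\<phi> (r n) z1)" for n
    using bdd[of "r n"] large[OF z1, of "r n"] by (auto simp: \<phi>_def norm_divide intro!: frac_le)
  then have "1 / C \<le> cmod (G z1)"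
    by (intro tendsto_lowerbound[OF tendsto_norm[OF G(3)[OF z1S]]] always_eventually) auto
  then have G1: "G z1 \<noteq> 0" using C by auto
  have "G z0 \<noteq> 0"
  proof (rule Hurwitz_no_zeros[of S "\<phi> \<circ> r" G])
    show "\<not> G constant_on S" using G0 G1 z0S z1S unfolding constant_on_def by metis
    show "(\<phi> \<circ> r) n z \<noteq> 0" if "z \<in> S" for n z using nz[OF that] by (auto simp: \<phi>_def)
    show "(\<phi> \<circ> r) n holomorphic_on S" for n using hol\<phi> by simp
  qed (use G z0S in \<open>auto simp: S_def\<close>)
  with G0 show False by simp
qed

text \<open>
  For a chordally convergent sequence the points with a neighbourhood of boundedness form an open
  set, and so do the remaining points: near a point where the limit is \<open>\<infinity>\<close> there is no point of
  boundedness, by \<open>no_pole_next_to_bounded\<close>.  On a connected domain the bound on \<open>V\<close> therefore excludes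
  the value \<open>\<infinity>\<close> altogether, and a compact set needs only finitely many of the neighbourhoods.
\<close>

lemma chordal_normal_family_bounded:
  assumes op: "open \<Omega>" and con: "connected \<Omega>" and hol: "\<And>f. f \<in> \<F> \<Longrightarrow> f holomorphic_on \<Omega>"
    and normal: "chordal_normal_family \<Omega> \<F>"
    and V: "open V" "V \<subseteq> \<Omega>" "V \<noteq> {}" "\<And>f z. f \<in> \<F> \<Longrightarrow> z \<in> V \<Longrightarrow> cmod (f z) \<le> B"
    and K: "compact K" "K \<subseteq> \<Omega>"
  shows "\<exists>M. \<forall>f\<in>\<F>. \<forall>z\<in>K. cmod (f z) \<le> M"
proof (rule ccontr)
  assume neg: "\<not> ?thesis"
  have "\<exists>f z. f \<in> \<F> \<and> z \<in> K \<and> cmod (f z) > real i" for i :: nat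
    using neg by (meson not_le)
  then obtain f where "\<forall>i. \<exists>z. f i \<in> \<F> \<and> z \<in> K \<and> cmod (f i z) > real i" by metis
  then obtain z where fz: "\<And>i::nat. f i \<in> \<F>" "\<And>i. z i \<in> K" "\<And>i. cmod (f i (z i)) > real i"
    by metis
  obtain r g where r: "strict_mono (r::nat\<Rightarrow>nat)" and
     lim: "\<And>K e. compact K \<Longrightarrow> K \<subseteq> \<Omega> \<Longrightarrow> e > 0 \<Longrightarrow> \<forall>\<^sub>F j in sequentially. \<forall>z\<in>K. chordal (Some (f (r j) z)) (g z) < e"
  proof -
    have "range f \<subseteq> \<F>" using fz(1) by blast
    from normal[unfolded chordal_normal_family_def, rule_format, OF this]
    obtain r g where "strict_mono r" and lim: "\<forall>K. compact K \<and> K \<subseteq> \<Omega> \<longrightarrow>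
        (\<forall>e>0. \<forall>\<^sub>F j in sequentially. \<forall>z\<in>K. chordal (Some (f (r j) z)) (g z) < e)"
      by blast
    then show ?thesis by (intro that[of r g]) blast+
  qed
  define h where "h = (\<lambda>j. f (r j))"
  have holh: "h j holomorphic_on \<Omega>" for j using hol fz(1) by (simp add: h_def)
  have limh: "\<forall>\<^sub>F j in sequentially. \<forall>z\<in>K. chordal (Some (h j z)) (g z) < e" if "compact K" "K \<subseteq> \<Omega>" "e > 0" for K e
    using lim[OF that] by (simp add: h_def)
  define Bd where "Bd = (\<lambda>z0. \<exists>\<rho>>0. \<exists>C N. ball z0 \<rho> \<subseteq> \<Omega> \<and> (\<forall>j\<ge>N. \<forall>z\<in>ball z0 \<rho>. cmod (h j z) \<le> C))"
  have finite_Bd: "Bd z0" if z0: "z0 \<in> \<Omega>" and g: "g z0 = Some w" for z0 w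
  proof -
    define c where "c = chordal (Some w) None"
    have c: "c > 0" using zero_le_power2[of "cmod w"] by (simp add: c_def add_pos_nonneg)
    obtain \<rho> N where \<rho>: "\<rho> > 0" "ball z0 \<rho> \<subseteq> \<Omega>"
      "\<And>j z. j \<ge> N \<Longrightarrow> z \<in> ball z0 \<rho> \<Longrightarrow> chordal (Some (h j z)) (g z0) < 4 * (c / 8)"
      by (rule chordal_limit_locally_close[where h = h and g = g and e = "c / 8", OF op holh limh z0]) (use c in auto)
    have "cmod (h j z) \<le> 2 / (c / 2)" if "j \<ge> N" "z \<in> ball z0 \<rho>" for j z
    proof (rule norm_le_chordal_infinity)
      show "c / 2 \<le> chordal (Some (h j z)) None"
        using \<rho>(3)[OF that, unfolded g] chordal_triangle[of "Some w" None "Some (h j z)"]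
          chordal_commute[of "Some w" "Some (h j z)"] unfolding c_def[symmetric] by linarith
    qed (use c in simp)
    then show ?thesis using \<rho>(1,2) unfolding Bd_def by blast
  qed
  have not_Bd: "\<exists>\<rho>>0. ball z0 \<rho> \<subseteq> \<Omega> \<and> (\<forall>z1\<in>ball z0 \<rho>. \<not> Bd z1)" if z0: "z0 \<in> \<Omega>" and nBd: "\<not> Bd z0" for z0
  proof -
    have g: "g z0 = None" using finite_Bd[OF z0] nBd by (cases "g z0") auto
    obtain \<rho> N where \<rho>: "\<rho> > 0" "ball z0 \<rho> \<subseteq> \<Omega>"
      "\<And>j z. j \<ge> N \<Longrightarrow> z \<in> ball z0 \<rho> \<Longrightarrow> chordal (Some (h j z)) (g z0) < 4 * (1 / 4)"
      by (rule chordal_limit_locally_close[where h = h and g = g and e = "1 / 4", OF op holh limh z0]) auto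
    have large: "cmod (h j z) > 1" if "j \<ge> N" "z \<in> ball z0 \<rho>" for j z
      using \<rho>(3)[OF that] g by (intro chordal_infinity_gt_1) simp
    have "\<not> Bd z1" if z1: "z1 \<in> ball z0 \<rho>" for z1
    proof
      assume "Bd z1"
      then obtain \<rho>' C N' where b: "\<rho>' > 0" "\<And>j z. j \<ge> N' \<Longrightarrow> z \<in> ball z1 \<rho>' \<Longrightarrow> cmod (h j z) \<le> C"
        unfolding Bd_def by blast
      define k where "k = (\<lambda>j. h (j + max N N'))"
      show False
      proof (rule no_pole_next_to_bounded[of \<rho> k z0 z1 C])
        show "k j holomorphic_on ball z0 \<rho>" for j
          unfolding k_def using holh holomorphic_on_subset \<rho>(2) by blast
        show "cmod (k j z) > 1" if "z \<in> ball z0 \<rho>" for j z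
          unfolding k_def using that by (intro large) auto
        show "cmod (k j z1) \<le> C" for j unfolding k_def using b by (intro b(2)) auto
        show "\<forall>\<^sub>F j in sequentially. 1 / cmod (k j z0) < e" if e: "e > 0" for e
        proof -
          have "\<forall>\<^sub>F j in sequentially. \<forall>z\<in>{z0}. chordal (Some (h j z)) (g z) < e"
            using z0 e by (intro limh) auto
          then have "\<forall>\<^sub>F j in sequentially. chordal (Some (k j z0)) None < e"
            unfolding k_def g[symmetric] by (subst eventually_sequentially_seg) simp
          then show ?thesis
          proof eventually_elim
            case (elim j)
            have "cmod (k j z0) > 1" unfolding k_def using \<rho>(1) by (intro large) auto
            from inverse_norm_le_chordal[OF this] elim show ?case by linarith
          qed
        qed
      qed (use \<rho>(1) z1 in auto)
    qed
    then show ?thesis using \<rho>(1,2) by blast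
  qed
  define U W where "U = {z\<in>\<Omega>. Bd z}" and "W = {z\<in>\<Omega>. \<not> Bd z}"
  have "open U" unfolding open_contains_ball
  proof
    fix z0 assume "z0 \<in> U"
    then obtain \<rho> C N where \<rho>: "\<rho> > 0" "ball z0 \<rho> \<subseteq> \<Omega>" "\<And>j z. j \<ge> N \<Longrightarrow> z \<in> ball z0 \<rho> \<Longrightarrow> cmod (h j z) \<le> C"
      unfolding U_def Bd_def by blast
    have "ball z0 \<rho> \<subseteq> U"
    proof
      fix z1 assume z1: "z1 \<in> ball z0 \<rho>"
      then obtain \<rho>' where "\<rho>' > 0" "ball z1 \<rho>' \<subseteq> ball z0 \<rho>" using open_contains_ball[of "ball z0 \<rho>"] by blast
      then show "z1 \<in> U" unfolding U_def Bd_def using \<rho> z1 by blast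
    qed
    then show "\<exists>e>0. ball z0 e \<subseteq> U" using \<rho>(1) by blast
  qed
  moreover have "open W" unfolding open_contains_ball W_def using not_Bd by blast
  moreover have "U \<inter> W = {}" "\<Omega> \<subseteq> U \<union> W" by (auto simp: U_def W_def)
  moreover have "U \<inter> \<Omega> \<noteq> {}"
  proof -
    obtain v where v: "v \<in> V" using V(3) by blast
    then obtain \<rho> where "\<rho> > 0" "ball v \<rho> \<subseteq> V" using V(1) open_contains_ball by blast
    then have "Bd v" unfolding Bd_def h_def using V(2,4) fz(1) by blast
    then show ?thesis using v V(2) by (auto simp: U_def)
  qed
  ultimately have "W \<inter> \<Omega> = {}" using con unfolding connected_def by blast
  then have all: "Bd z0" if "z0 \<in> \<Omega>" for z0 using that by (auto simp: W_def)
  have "\<forall>n. z (r n) \<in> K" using fz by auto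
  then obtain l s where ls: "l \<in> K" "strict_mono (s::nat\<Rightarrow>nat)" "(\<lambda>n. z (r (s n))) \<longlonglongrightarrow> l"
    using K(1)[unfolded compact_def, rule_format, of "\<lambda>n. z (r n)"] by (auto simp: o_def)
  then obtain \<rho> C N where \<rho>: "\<rho> > 0" "\<And>j z. j \<ge> N \<Longrightarrow> z \<in> ball l \<rho> \<Longrightarrow> cmod (h j z) \<le> C"
    using all[of l] K(2) unfolding Bd_def by blast
  have "\<forall>\<^sub>F n in sequentially. dist (z (r (s n))) l < \<rho>" using ls(3) \<rho>(1) by (rule tendstoD)
  moreover have "\<forall>\<^sub>F n in sequentially. n \<ge> N" by (rule eventually_ge_at_top)
  moreover have "\<forall>\<^sub>F n in sequentially. real n \<ge> C" using filterlim_real_sequentially by (simp add: filterlim_at_top)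
  ultimately have "\<forall>\<^sub>F n in sequentially. False"
  proof eventually_elim
    case (elim n)
    have sn: "s n \<ge> n" "r (s n) \<ge> s n" using ls(2) r by (auto intro: seq_suble)
    have "cmod (h (s n) (z (r (s n)))) \<le> C" using elim sn by (intro \<rho>(2)) (auto simp: dist_commute)
    moreover have "cmod (h (s n) (z (r (s n)))) > real (r (s n))" unfolding h_def by (rule fz)
    moreover have "real (r (s n)) \<ge> real n" using sn by simp
    ultimately show False using elim by linarith
  qed
  then show False by simp
qed

text \<open>
  A qualitative two-constants theorem.  If it failed, Montel's theorem would give a limit of
  functions that tend to \<open>0\<close> on \<open>V\<close>; it vanishes on \<open>\<Omega>\<close> by the identity theorem, but is at least \<open>\<eta>\<close>
  somewhere on the compact set \<open>K\<close>.
\<close>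

lemma two_constants:
  assumes op: "open \<Omega>" and con: "connected \<Omega>" and V: "open V" "V \<subseteq> \<Omega>" "V \<noteq> {}"
    and K: "compact K" "K \<subseteq> \<Omega>" and \<eta>: "\<eta> > 0"
  shows "\<exists>\<tau>>0. \<forall>h. h holomorphic_on \<Omega> \<and> (\<forall>z\<in>\<Omega>. cmod (h z) \<le> 1) \<and> (\<forall>z\<in>V. cmod (h z) \<le> \<tau>)
            \<longrightarrow> (\<forall>z\<in>K. cmod (h z) \<le> \<eta>)"
proof (rule ccontr)
  assume neg: "\<not> ?thesis"
  have "\<exists>h z. h holomorphic_on \<Omega> \<and> (\<forall>z\<in>\<Omega>. cmod (h z) \<le> 1) \<and> (\<forall>z\<in>V. cmod (h z) \<le> 1 / real (Suc n)) \<and> z \<in> K \<and> \<not> cmod (h z) \<le> \<eta>" for n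
  proof -
    have "1 / real (Suc n) > 0" by simp
    with neg show ?thesis by blast
  qed
  then obtain h z where "\<And>n. h n holomorphic_on \<Omega> \<and> (\<forall>z\<in>\<Omega>. cmod (h n z) \<le> 1) \<and> (\<forall>x\<in>V. cmod (h n x) \<le> 1 / real (Suc n)) \<and> z n \<in> K \<and> \<not> cmod (h n (z n)) \<le> \<eta>"
    by metis
  then have h: "\<And>n. h n holomorphic_on \<Omega>" "\<And>n z. z \<in> \<Omega> \<Longrightarrow> cmod (h n z) \<le> 1"
    "\<And>n z. z \<in> V \<Longrightarrow> cmod (h n z) \<le> 1 / real (Suc n)" "\<And>n. z n \<in> K" "\<And>n. cmod (h n (z n)) > \<eta>"
    by (simp_all add: not_le)
  obtain G r where G: "G holomorphic_on \<Omega>" "strict_mono (r::nat\<Rightarrow>nat)"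
    "\<And>x. x \<in> \<Omega> \<Longrightarrow> (\<lambda>n. h (r n) x) \<longlonglongrightarrow> G x"
    "\<And>K. compact K \<Longrightarrow> K \<subseteq> \<Omega> \<Longrightarrow> uniform_limit K (h \<circ> r) G sequentially"
  proof (rule Montel[of \<Omega> "range h" h])
    show "\<exists>B. \<forall>f\<in>range h. \<forall>z\<in>K. cmod (f z) \<le> B" if "compact K" "K \<subseteq> \<Omega>" for K
      using h(2) that by (intro exI[of _ 1]) auto
  qed (use op h in auto)
  have GV: "G v = 0" if v: "v \<in> V" for v
  proof -
    have "(\<lambda>n. h n v) \<longlonglongrightarrow> 0"
      by (rule Lim_null_comparison[OF _ LIMSEQ_inverse_real_of_nat])
         (use h(3)[OF v] in \<open>auto simp: inverse_eq_divide\<close>)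
    then have "(\<lambda>n. h (r n) v) \<longlonglongrightarrow> 0" using LIMSEQ_subseq_LIMSEQ[OF _ G(2)] by (auto simp: o_def)
    moreover have "v \<in> \<Omega>" using v V(2) by blast
    ultimately show ?thesis using G(3) LIMSEQ_unique by blast
  qed
  obtain v where v: "v \<in> V" using V(3) by blast
  have "v islimpt V" using v V(1) by (simp add: interior_limit_point interior_open)
  then have G0: "G w = 0" if "w \<in> \<Omega>" for w
    using analytic_continuation[OF G(1) op con V(2) _ _ GV that, of v] v V(2) by blast
  have "\<forall>\<^sub>F n in sequentially. \<forall>x\<in>K. dist ((h \<circ> r) n x) (G x) < \<eta>"
    using uniform_limitD[OF G(4)[OF K] \<eta>] .
  then obtain n where "\<forall>x\<in>K. dist ((h \<circ> r) n x) (G x) < \<eta>"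
    using eventually_happens trivial_limit_sequentially by blast
  then have "dist (h (r n) (z (r n))) (G (z (r n))) < \<eta>" using h(4) by simp
  moreover have "G (z (r n)) = 0" using h(4) K(2) by (intro G0) blast
  ultimately show False using h(5)[of "r n"] by simp
qed

text \<open>
  The homogeneous form, with \<open>\<kappa> = 1/\<tau>\<close> for the \<open>\<tau>\<close> of \<open>two_constants\<close>: that lemma applies to \<open>h/B\<close> if
  \<open>v \<le> \<tau> B\<close>, and otherwise \<open>B \<le> \<kappa> v\<close>.
\<close>

lemma two_constants_scaled:
  assumes "open \<Omega>" "connected \<Omega>" "open V" "V \<subseteq> \<Omega>" "V \<noteq> {}" "compact K" "K \<subseteq> \<Omega>" "\<eta> > 0"
  obtains \<kappa> where "\<kappa> > 0" "\<And>h B v z. h holomorphic_on \<Omega> \<Longrightarrow> (\<And>z. z \<in> \<Omega> \<Longrightarrow> cmod (h z) \<le> B) \<Longrightarrow>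
     (\<And>z. z \<in> V \<Longrightarrow> cmod (h z) \<le> v) \<Longrightarrow> z \<in> K \<Longrightarrow> cmod (h z) \<le> \<eta> * B + \<kappa> * v"
proof -
  obtain \<tau> where \<tau>: "\<tau> > 0" "\<And>h z. h holomorphic_on \<Omega> \<Longrightarrow> (\<And>z. z \<in> \<Omega> \<Longrightarrow> cmod (h z) \<le> 1) \<Longrightarrow>
     (\<And>z. z \<in> V \<Longrightarrow> cmod (h z) \<le> \<tau>) \<Longrightarrow> z \<in> K \<Longrightarrow> cmod (h z) \<le> \<eta>"
    using two_constants[OF assms] by metis
  have "cmod (h z) \<le> \<eta> * B + (1 / \<tau>) * v" if h: "h holomorphic_on \<Omega>" "\<And>z. z \<in> \<Omega> \<Longrightarrow> cmod (h z) \<le> B"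
     "\<And>z. z \<in> V \<Longrightarrow> cmod (h z) \<le> v" and z: "z \<in> K" for h B v z
  proof -
    obtain x where x: "x \<in> V" using assms by blast
    have v0: "v \<ge> 0" using h(3)[OF x] norm_ge_zero[of "h x"] by linarith
    have B0: "B \<ge> 0" using h(2)[of x] x assms(4) norm_ge_zero[of "h x"] by (meson order_trans subsetD)
    have zB: "cmod (h z) \<le> B" using h(2) z assms by blast
    show ?thesis
    proof (cases "B = 0")
      case True
      then show ?thesis using zB v0 \<tau>(1) by (simp add: field_simps)
    next
      case False
      then have B: "B > 0" using B0 by simp
      show ?thesis
      proof (cases "v \<le> \<tau> * B")
        case True
        have "cmod (h z / of_real B) \<le> \<eta>"
        proof (rule \<tau>(2)[of "\<lambda>z. h z / of_real B"])
          show "(\<lambda>z. h z / of_real B) holomorphic_on \<Omega>" using h(1) B by (intro holomorphic_intros) auto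
          show "cmod (h z / of_real B) \<le> 1" if "z \<in> \<Omega>" for z using h(2)[OF that] B by (simp add: norm_divide)
          show "cmod (h z / of_real B) \<le> \<tau>" if "z \<in> V" for z
            using h(3)[OF that] True B by (simp add: norm_divide field_simps)
        qed (rule z)
        then have "cmod (h z) \<le> \<eta> * B" using B by (simp add: norm_divide field_simps)
        also have "\<dots> \<le> \<eta> * B + (1 / \<tau>) * v" using v0 \<tau>(1) by simp
        finally show ?thesis .
      next
        case False
        then have "B \<le> (1 / \<tau>) * v" using \<tau>(1) by (simp add: field_simps)
        moreover have "0 \<le> \<eta> * B" using assms(8) B by simp
        ultimately show ?thesis using zB by linarith
      qed
    qed
  qed
  then show ?thesis using \<tau>(1) that[of "1 / \<tau>"] by simp
qed

section \<open>Mean values of Dirichlet polynomials\<close>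

lemma integral_cis_le:
  fixes x :: real
  assumes "x \<noteq> 0" "a \<le> b"
  obtains I where "((\<lambda>t. cis (x * t)) has_integral I) {a..b}" "cmod I \<le> 2 / \<bar>x\<bar>"
proof -
  define G where "G = (\<lambda>t. - \<i> / of_real x * cis (x * t))"
  have der: "(G has_vector_derivative cis (x * t)) (at t within {a..b})" for t
  proof -
    have "((\<lambda>t. cis (x * t)) has_vector_derivative (x *\<^sub>R (\<i> * cis (x * t)))) (at t within {a..b})"
      by (auto simp: has_vector_derivative_def intro!: derivative_eq_intros ext simp: scaleR_conv_of_real)
    then have "(G has_vector_derivative (- \<i> / of_real x * (x *\<^sub>R (\<i> * cis (x * t))))) (at t within {a..b})"
      unfolding G_def by (rule has_vector_derivative_mult_right)
    then show ?thesis using assms(1) by (simp add: scaleR_conv_of_real field_simps)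
  qed
  have "((\<lambda>t. cis (x * t)) has_integral (G b - G a)) {a..b}"
    by (rule fundamental_theorem_of_calculus[OF assms(2) der])
  moreover have "cmod (G b - G a) \<le> 2 / \<bar>x\<bar>"
  proof -
    have "cmod (G b - G a) \<le> cmod (G b) + cmod (G a)" by (rule norm_triangle_ineq4)
    also have "\<dots> = 2 / \<bar>x\<bar>" by (simp add: G_def norm_mult norm_divide)
    finally show ?thesis .
  qed
  ultimately show ?thesis by (rule that)
qed

text \<open>
  Expanding the square, the diagonal yields the main term, while every oscillating term integrates to
  at most \<open>2/|\<omega>\<^sub>m - \<omega>\<^sub>k|\<close>.  The error is independent of the interval; in the mean over a long
  interval it disappears.
\<close>

lemma exponential_sum_mean_square:
  fixes d :: "'i \<Rightarrow> complex" and \<omega> :: "'i \<Rightarrow> real"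
  assumes "inj_on \<omega> S" "a \<le> b"
  shows "\<bar>integral {a..b} (\<lambda>t. cmod (\<Sum>m\<in>S. d m * cis (- (\<omega> m * t))) ^ 2) - (b - a) * (\<Sum>m\<in>S. cmod (d m) ^ 2)\<bar>
      \<le> (\<Sum>m\<in>S. \<Sum>k\<in>S - {m}. cmod (d m) * cmod (d k) * (2 / \<bar>\<omega> m - \<omega> k\<bar>))"
proof (cases "finite S")
  case fin: True
  define J where "J = (\<lambda>m k. if m = k then of_real (b - a) else (SOME I. ((\<lambda>t. cis ((\<omega> k - \<omega> m) * t)) has_integral I) {a..b} \<and> cmod I \<le> 2 / \<bar>\<omega> k - \<omega> m\<bar>))"
  have J: "((\<lambda>t. cis ((\<omega> k - \<omega> m) * t)) has_integral J m k) {a..b} \<and> (m \<noteq> k \<longrightarrow> cmod (J m k) \<le> 2 / \<bar>\<omega> m - \<omega> k\<bar>)"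
    if mk: "m \<in> S" "k \<in> S" for m k
  proof (cases "m = k")
    case True
    then show ?thesis using has_integral_const_real[of "1::complex" a b] assms(2) by (simp add: J_def scaleR_conv_of_real)
  next
    case False
    then have "\<omega> k - \<omega> m \<noteq> 0" using assms(1) mk by (auto dest: inj_onD)
    from integral_cis_le[OF this assms(2)] obtain I where
      "((\<lambda>t. cis ((\<omega> k - \<omega> m) * t)) has_integral I) {a..b} \<and> cmod I \<le> 2 / \<bar>\<omega> k - \<omega> m\<bar>" by blast
    from someI[of "\<lambda>I. ((\<lambda>t. cis ((\<omega> k - \<omega> m) * t)) has_integral I) {a..b} \<and> cmod I \<le> 2 / \<bar>\<omega> k - \<omega> m\<bar>", OF this]
    show ?thesis using False by (simp add: J_def abs_minus_commute)
  qed
  define F where "F = (\<lambda>t. \<Sum>m\<in>S. d m * cis (- (\<omega> m * t)))"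
  have sq: "of_real (cmod (F t) ^ 2) = (\<Sum>m\<in>S. \<Sum>k\<in>S. d m * cnj (d k) * cis ((\<omega> k - \<omega> m) * t))" for t
  proof -
    have "of_real (cmod (F t) ^ 2) = F t * cnj (F t)" by (simp only: complex_norm_square)
    also have "\<dots> = (\<Sum>m\<in>S. \<Sum>k\<in>S. (d m * cis (- (\<omega> m * t))) * cnj (d k * cis (- (\<omega> k * t))))"
      by (simp add: F_def sum_product)
    also have "\<dots> = (\<Sum>m\<in>S. \<Sum>k\<in>S. d m * cnj (d k) * cis ((\<omega> k - \<omega> m) * t))"
    proof (intro sum.cong refl)
      fix m k
      have "cis (- (\<omega> m * t)) * cis (\<omega> k * t) = cis ((\<omega> k - \<omega> m) * t)"
        by (simp add: cis_mult algebra_simps)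
      moreover have "(d m * cis (- (\<omega> m * t))) * cnj (d k * cis (- (\<omega> k * t))) =
          d m * cnj (d k) * (cis (- (\<omega> m * t)) * cis (\<omega> k * t))"
        by (simp add: cis_cnj)
      ultimately show "(d m * cis (- (\<omega> m * t))) * cnj (d k * cis (- (\<omega> k * t))) =
          d m * cnj (d k) * cis ((\<omega> k - \<omega> m) * t)" by simp
    qed
    finally show ?thesis .
  qed
  have int: "((\<lambda>t. of_real (cmod (F t) ^ 2) :: complex) has_integral (\<Sum>m\<in>S. \<Sum>k\<in>S. d m * cnj (d k) * J m k)) {a..b}"
    unfolding sq using J fin by (intro has_integral_sum has_integral_mult_right) auto
  have "continuous_on {a..b} (\<lambda>t. cmod (F t) ^ 2)"
    unfolding F_def cis_conv_exp by (intro continuous_intros)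
  then have "(\<lambda>t. cmod (F t) ^ 2) integrable_on {a..b}" by (rule integrable_continuous_real)
  then have "((\<lambda>t. of_real (cmod (F t) ^ 2) :: complex) has_integral of_real (integral {a..b} (\<lambda>t. cmod (F t) ^ 2))) {a..b}"
    by (intro has_integral_of_real integrable_integral)
  from has_integral_unique[OF this int]
  have eq: "of_real (integral {a..b} (\<lambda>t. cmod (F t) ^ 2)) = (\<Sum>m\<in>S. \<Sum>k\<in>S. d m * cnj (d k) * J m k)" .
  have nsq: "d m * cnj (d m) = (of_real (cmod (d m)))\<^sup>2" for m
    by (metis complex_norm_square of_real_power)
  have "(\<Sum>m\<in>S. \<Sum>k\<in>S. d m * cnj (d k) * J m k) =
     (\<Sum>m\<in>S. of_real (cmod (d m) ^ 2) * of_real (b - a) + (\<Sum>k\<in>S - {m}. d m * cnj (d k) * J m k))"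
    by (intro sum.cong refl, subst sum.remove[OF fin]) (auto simp: nsq J_def)
  also have "\<dots> = (\<Sum>m\<in>S. of_real (cmod (d m) ^ 2) * of_real (b - a)) + (\<Sum>m\<in>S. \<Sum>k\<in>S - {m}. d m * cnj (d k) * J m k)"
    by (rule sum.distrib)
  also have "(\<Sum>m\<in>S. of_real (cmod (d m) ^ 2) * complex_of_real (b - a)) = of_real ((b - a) * (\<Sum>m\<in>S. cmod (d m) ^ 2))"
    by (subst mult.commute[of "b - a"]) (simp only: sum_distrib_right of_real_sum of_real_mult)
  finally have "of_real (integral {a..b} (\<lambda>t. cmod (F t) ^ 2)) - of_real ((b - a) * (\<Sum>m\<in>S. cmod (d m) ^ 2)) =
      (\<Sum>m\<in>S. \<Sum>k\<in>S - {m}. d m * cnj (d k) * J m k)"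
    unfolding eq by (rule iffD2[OF diff_eq_eq, OF trans[OF _ add.commute]])
  then have "of_real (integral {a..b} (\<lambda>t. cmod (F t) ^ 2) - (b - a) * (\<Sum>m\<in>S. cmod (d m) ^ 2)) =
      (\<Sum>m\<in>S. \<Sum>k\<in>S - {m}. d m * cnj (d k) * J m k)"
    by (simp only: of_real_diff)
  then have "\<bar>integral {a..b} (\<lambda>t. cmod (F t) ^ 2) - (b - a) * (\<Sum>m\<in>S. cmod (d m) ^ 2)\<bar> =
      cmod (\<Sum>m\<in>S. \<Sum>k\<in>S - {m}. d m * cnj (d k) * J m k)"
    by (subst norm_of_real[symmetric]) (rule arg_cong)
  also have "\<dots> \<le> (\<Sum>m\<in>S. \<Sum>k\<in>S - {m}. cmod (d m) * cmod (d k) * (2 / \<bar>\<omega> m - \<omega> k\<bar>))"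
  proof (intro sum_norm_le)
    fix m k assume "m \<in> S" "k \<in> S - {m}"
    then have "cmod (J m k) \<le> 2 / \<bar>\<omega> m - \<omega> k\<bar>" using J[of m k] by auto
    then show "cmod (d m * cnj (d k) * J m k) \<le> cmod (d m) * cmod (d k) * (2 / \<bar>\<omega> m - \<omega> k\<bar>)"
      unfolding norm_mult complex_mod_cnj by (intro mult_left_mono) auto
  qed
  finally show ?thesis by (simp add: F_def)
qed simp

lemma exponential_sum_mean:
  fixes d :: "'i \<Rightarrow> complex" and \<omega> :: "'i \<Rightarrow> real"
  assumes "inj_on \<omega> S" "a \<le> b" "finite S" "k \<in> S" "\<omega> k = 0"
  shows "cmod (integral {a..b} (\<lambda>t. \<Sum>m\<in>S. d m * cis (- (\<omega> m * t))) - (b - a) *\<^sub>R d k)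
      \<le> (\<Sum>m\<in>S - {k}. cmod (d m) * (2 / \<bar>\<omega> m\<bar>))"
proof -
  have "\<exists>I. ((\<lambda>t. cis (- (\<omega> m * t))) has_integral I) {a..b} \<and> cmod I \<le> 2 / \<bar>\<omega> m\<bar>" if m: "m \<in> S - {k}" for m
  proof -
    have "- \<omega> m \<noteq> 0" using assms(1,4,5) m inj_onD[of \<omega> S m k] by auto
    from integral_cis_le[OF this assms(2)] show ?thesis by auto
  qed
  then obtain J where J: "\<And>m. m \<in> S - {k} \<Longrightarrow> ((\<lambda>t. cis (- (\<omega> m * t))) has_integral J m) {a..b}"
    "\<And>m. m \<in> S - {k} \<Longrightarrow> cmod (J m) \<le> 2 / \<bar>\<omega> m\<bar>" by metis
  have "((\<lambda>t. d k + (\<Sum>m\<in>S - {k}. d m * cis (- (\<omega> m * t)))) has_integral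
       ((b - a) *\<^sub>R d k + (\<Sum>m\<in>S - {k}. d m * J m))) {a..b}"
    using J assms has_integral_const_real[of "d k" a b]
    by (intro has_integral_add has_integral_sum has_integral_mult_right) auto
  moreover have "(\<lambda>t. d k + (\<Sum>m\<in>S - {k}. d m * cis (- (\<omega> m * t)))) = (\<lambda>t. \<Sum>m\<in>S. d m * cis (- (\<omega> m * t)))"
    using assms by (auto simp: sum.remove[of S k] fun_eq_iff)
  ultimately have "integral {a..b} (\<lambda>t. \<Sum>m\<in>S. d m * cis (- (\<omega> m * t))) = (b - a) *\<^sub>R d k + (\<Sum>m\<in>S - {k}. d m * J m)"
    by (simp add: integral_unique)
  then have "cmod (integral {a..b} (\<lambda>t. \<Sum>m\<in>S. d m * cis (- (\<omega> m * t))) - (b - a) *\<^sub>R d k) = cmod (\<Sum>m\<in>S - {k}. d m * J m)"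
    by simp
  also have "\<dots> \<le> (\<Sum>m\<in>S - {k}. cmod (d m) * (2 / \<bar>\<omega> m\<bar>))"
  proof (rule sum_norm_le)
    fix m assume "m \<in> S - {k}"
    then show "cmod (d m * J m) \<le> cmod (d m) * (2 / \<bar>\<omega> m\<bar>)"
      unfolding norm_mult by (intro mult_left_mono J(2)) auto
  qed
  finally show ?thesis .
qed

lemma dirichlet_term_cis:
  assumes "n \<ge> 1"
  shows "c n / of_nat n powr (Complex \<sigma> t) = c n * of_real (real n powr -\<sigma>) * cis (- (ln (real n) * t))"
proof -
  have L: "Ln (complex_of_nat n) = of_real (ln (real n))"
    using assms by (metis Ln_of_real of_nat_0_less_iff of_real_of_nat_eq less_le_trans zero_less_one)
  have "complex_of_nat n powr (Complex \<sigma> t) = exp (Complex \<sigma> t * of_real (ln (real n)))"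
    using assms L by (simp add: powr_def)
  also have "Complex \<sigma> t * of_real (ln (real n)) = of_real (\<sigma> * ln (real n)) + \<i> * of_real (ln (real n) * t)"
    by (simp add: complex_eq_iff)
  also have "exp \<dots> = of_real (real n powr \<sigma>) * cis (ln (real n) * t)"
  proof -
    have "exp (complex_of_real (\<sigma> * ln (real n))) = of_real (real n powr \<sigma>)"
      using assms by (simp only: exp_of_real) (simp add: powr_def)
    then show ?thesis by (simp only: exp_add cis_conv_exp)
  qed
  finally have "inverse (complex_of_nat n powr (Complex \<sigma> t)) = of_real (real n powr -\<sigma>) * cis (- (ln (real n) * t))"
    by (simp add: powr_minus)
  then show ?thesis by (simp add: divide_inverse mult.assoc)
qed

lemma dirichlet_poly_cis:
  "dirichlet_poly c N (Complex \<sigma> t) = (\<Sum>n=1..N. c n * of_real (real n powr -\<sigma>) * cis (- (ln (real n) * t)))"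
  unfolding dirichlet_poly_def by (intro sum.cong refl dirichlet_term_cis) auto

lemma inj_on_ln_nat: "inj_on (\<lambda>n. ln (real n)) {1..N}"
  by (auto simp: inj_on_def)

lemma powr_nonpos_le_1: "n \<ge> 1 \<Longrightarrow> \<sigma> \<ge> 0 \<Longrightarrow> real n powr -\<sigma> \<le> 1"
  using powr_mono[of "-\<sigma>" 0 "real n"] by simp

text \<open>
  The constant works for all \<open>\<sigma> \<ge> 0\<close> at once because \<open>n\<^sup>-\<^sup>\<sigma> \<le> 1\<close>.  This is the source of the uniformity in \<open>\<sigma>\<close>.
\<close>

lemma dirichlet_poly_mean_square:
  "\<exists>K\<ge>0. \<forall>\<sigma>\<ge>0. \<forall>a b. a \<le> b \<longrightarrow> \<bar>integral {a..b} (\<lambda>t. cmod (dirichlet_poly c N (Complex \<sigma> t)) ^ 2)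
      - (b - a) * (\<Sum>n=1..N. cmod (c n) ^ 2 * real n powr (-2 * \<sigma>))\<bar> \<le> K"
proof (intro exI conjI allI impI)
  define K where "K = (\<Sum>m=1..N. \<Sum>k\<in>{1..N} - {m}. cmod (c m) * cmod (c k) * (2 / \<bar>ln (real m) - ln (real k)\<bar>))"
  show "K \<ge> 0" unfolding K_def by (intro sum_nonneg) auto
  fix \<sigma> a b :: real assume \<sigma>: "\<sigma> \<ge> 0" and ab: "a \<le> b"
  define d where "d = (\<lambda>n. c n * of_real (real n powr -\<sigma>))"
  have dc: "cmod (d n) \<le> cmod (c n)" if "n \<ge> 1" for n
    using mult_left_mono[OF powr_nonpos_le_1[OF that \<sigma>], of "cmod (c n)"] by (simp add: d_def norm_mult)
  have "cmod (d n) ^ 2 = cmod (c n) ^ 2 * real n powr (-2 * \<sigma>)" for n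
    by (simp add: d_def norm_mult power_mult_distrib power2_eq_square[of "_ powr _"] flip: powr_add)
  then have eq: "(\<Sum>n=1..N. cmod (c n) ^ 2 * real n powr (-2 * \<sigma>)) = (\<Sum>n=1..N. cmod (d n) ^ 2)" by simp
  have "\<bar>integral {a..b} (\<lambda>t. cmod (\<Sum>n=1..N. d n * cis (- (ln (real n) * t))) ^ 2) - (b - a) * (\<Sum>n=1..N. cmod (d n) ^ 2)\<bar>
     \<le> (\<Sum>m=1..N. \<Sum>k\<in>{1..N} - {m}. cmod (d m) * cmod (d k) * (2 / \<bar>ln (real m) - ln (real k)\<bar>))"
    by (rule exponential_sum_mean_square[OF inj_on_ln_nat ab])
  also have "\<dots> \<le> K" unfolding K_def
    using dc by (intro sum_mono mult_right_mono mult_mono) auto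
  finally show "\<bar>integral {a..b} (\<lambda>t. cmod (dirichlet_poly c N (Complex \<sigma> t)) ^ 2)
      - (b - a) * (\<Sum>n=1..N. cmod (c n) ^ 2 * real n powr (-2 * \<sigma>))\<bar> \<le> K"
    unfolding dirichlet_poly_cis eq d_def .
qed

lemma dirichlet_poly_mean:
  assumes "N \<ge> 1"
  shows "\<exists>K. \<forall>\<sigma>\<ge>0. \<forall>a b. a \<le> b \<longrightarrow> cmod (integral {a..b} (\<lambda>t. dirichlet_poly c N (Complex \<sigma> t)) - (b - a) *\<^sub>R c 1) \<le> K"
proof (intro exI conjI allI impI)
  define K where "K = (\<Sum>m\<in>{1..N} - {1}. cmod (c m) * (2 / \<bar>ln (real m)\<bar>))"
  fix \<sigma> a b :: real assume \<sigma>: "\<sigma> \<ge> 0" and ab: "a \<le> b"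
  define d where "d = (\<lambda>n. c n * of_real (real n powr -\<sigma>))"
  have dc: "cmod (d n) \<le> cmod (c n)" if "n \<ge> 1" for n
    using mult_left_mono[OF powr_nonpos_le_1[OF that \<sigma>], of "cmod (c n)"] by (simp add: d_def norm_mult)
  have "cmod (integral {a..b} (\<lambda>t. \<Sum>n=1..N. d n * cis (- (ln (real n) * t))) - (b - a) *\<^sub>R d 1)
     \<le> (\<Sum>m\<in>{1..N} - {1}. cmod (d m) * (2 / \<bar>ln (real m)\<bar>))"
    by (rule exponential_sum_mean[OF inj_on_ln_nat ab]) (use assms in auto)
  also have "\<dots> \<le> K" unfolding K_def
    using dc by (intro sum_mono mult_right_mono) auto
  finally show "cmod (integral {a..b} (\<lambda>t. dirichlet_poly c N (Complex \<sigma> t)) - (b - a) *\<^sub>R c 1) \<le> K"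
    unfolding dirichlet_poly_cis by (simp add: d_def)
qed

section \<open>Suprema on rectangles\<close>

lemma contour_integral_horizontal_bound:
  assumes cont: "continuous_on (closed_segment (Complex x1 y) (Complex x2 y)) g"
    and xx: "x1 \<le> x2" and q: "continuous_on {0..1} (\<lambda>\<tau>. q (x1 + \<tau> * (x2 - x1)))"
    and bound: "\<And>x. x \<in> {x1..x2} \<Longrightarrow> cmod (g (Complex x y)) \<le> q x"
  shows "cmod (contour_integral (linepath (Complex x1 y) (Complex x2 y)) g)
      \<le> (x2 - x1) * integral {0..1} (\<lambda>\<tau>. q (x1 + \<tau> * (x2 - x1)))"
proof -
  let ?p = "linepath (Complex x1 y) (Complex x2 y)"
  have lp: "?p \<tau> = Complex (x1 + \<tau> * (x2 - x1)) y" for \<tau>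
    by (simp add: linepath_def complex_eq_iff algebra_simps)
  have "(g has_contour_integral contour_integral ?p g) ?p"
    by (rule has_contour_integral_integral[OF contour_integrable_continuous_linepath[OF cont]])
  then have hi: "((\<lambda>\<tau>. g (?p \<tau>) * (Complex x2 y - Complex x1 y)) has_integral contour_integral ?p g) {0..1}"
    by (simp only: has_contour_integral_linepath)
  have "cmod (integral {0..1} (\<lambda>\<tau>. g (?p \<tau>) * (Complex x2 y - Complex x1 y))) \<le> integral {0..1} (\<lambda>\<tau>. q (x1 + \<tau> * (x2 - x1)) * (x2 - x1))"
  proof (rule integral_norm_bound_integral)
    show "(\<lambda>\<tau>. g (?p \<tau>) * (Complex x2 y - Complex x1 y)) integrable_on {0..1}" using hi by (rule has_integral_integrable)
    show "(\<lambda>\<tau>. q (x1 + \<tau> * (x2 - x1)) * (x2 - x1)) integrable_on {0..1}"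
      using q by (intro integrable_continuous_real continuous_intros)
    fix \<tau> :: real assume \<tau>: "\<tau> \<in> {0..1}"
    have "0 \<le> \<tau> * (x2 - x1)" "\<tau> * (x2 - x1) \<le> x2 - x1"
      using \<tau> xx by (auto intro: mult_left_le_one_le)
    then have "cmod (g (?p \<tau>)) \<le> q (x1 + \<tau> * (x2 - x1))" unfolding lp by (intro bound) auto
    moreover have "cmod (Complex x2 y - Complex x1 y) = x2 - x1" using xx by (simp add: cmod_def)
    ultimately show "norm (g (?p \<tau>) * (Complex x2 y - Complex x1 y)) \<le> q (x1 + \<tau> * (x2 - x1)) * (x2 - x1)"
      unfolding norm_mult using xx by (simp add: mult_right_mono)
  qed
  then show ?thesis unfolding integral_unique[OF hi] by (simp add: mult.commute)
qed

lemma contour_integral_vertical_bound: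
  assumes cont: "continuous_on {y1..y2} (\<lambda>t. g (Complex x t))"
    and yy: "y1 < y2" and q: "continuous_on {y1..y2} q"
    and bound: "\<And>t. t \<in> {y1..y2} \<Longrightarrow> cmod (g (Complex x t)) \<le> q t"
  shows "cmod (contour_integral (linepath (Complex x y1) (Complex x y2)) g) \<le> integral {y1..y2} q"
proof -
  have "contour_integral (linepath (Complex x y1) (Complex x y2)) g = \<i> * integral {y1..y2} (\<lambda>t. g (Complex x t))"
    by (rule contour_integral_linepath_same_Re) (use yy in auto)
  then have "cmod (contour_integral (linepath (Complex x y1) (Complex x y2)) g) = cmod (integral {y1..y2} (\<lambda>t. g (Complex x t)))"
    by (simp add: norm_mult)
  also have "\<dots> \<le> integral {y1..y2} q"
    using bound q cont by (intro integral_norm_bound_integral integrable_continuous_real)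
  finally show ?thesis .
qed

lemma continuous_on_Complex [continuous_intros]:
  assumes "continuous_on S f" "continuous_on S g"
  shows "continuous_on S (\<lambda>x. Complex (f x) (g x))"
  unfolding Complex_eq using assms by (intro continuous_intros)

text \<open>
  Cauchy's formula for \<open>h\<^sup>2\<close>, with the kernel \<open>1/(w - s)\<close> bounded by \<open>1/\<delta>\<close> on the boundary.
\<close>

lemma square_le_rectangle_boundary:
  fixes h :: "complex \<Rightarrow> complex"
  assumes hol: "h holomorphic_on UNIV" and x: "x1 < x2" and y: "y1 < y2" and \<delta>: "\<delta> > 0"
    and s: "x1 + \<delta> \<le> Re s" "Re s \<le> x2 - \<delta>" "y1 + \<delta> \<le> Im s" "Im s \<le> y2 - \<delta>"
  shows "2 * pi * \<delta> * cmod (h s) ^ 2 \<le>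
     integral {y1..y2} (\<lambda>t. cmod (h (Complex x1 t)) ^ 2) + integral {y1..y2} (\<lambda>t. cmod (h (Complex x2 t)) ^ 2)
     + (x2 - x1) * (integral {0..1} (\<lambda>\<tau>. cmod (h (Complex (x1 + \<tau> * (x2 - x1)) y1)) ^ 2)
                  + integral {0..1} (\<lambda>\<tau>. cmod (h (Complex (x1 + \<tau> * (x2 - x1)) y2)) ^ 2))"
proof -
  define g where "g = (\<lambda>w. h w ^ 2 / (w - s))"
  define a1 a2 a3 a4 where "a1 = Complex x1 y1" and "a2 = Complex x2 y1" and "a3 = Complex x2 y2" and "a4 = Complex x1 y2"
  note a = a1_def a2_def a3_def a4_def
  have conth: "continuous_on A h" for A
    using holomorphic_on_imp_continuous_on[OF hol] continuous_on_subset by blast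
  have contq: "continuous_on A (\<lambda>t. cmod (h (Complex (u t) (v t))) ^ 2 / \<delta>)"
    if "continuous_on A u" "continuous_on A v" for A :: "real set" and u v
    by (intro continuous_intros continuous_on_compose2[OF conth[of UNIV]] that) (use \<delta> in auto)
  have gcont: "continuous_on A g" if "s \<notin> A" for A
    unfolding g_def using that by (intro continuous_intros conth) auto
  have dist: "cmod (w - s) \<ge> \<delta>" if "Re w \<in> {x1, x2} \<or> Im w \<in> {y1, y2}" for w
  proof -
    have "\<delta> \<le> \<bar>Re (w - s)\<bar> \<or> \<delta> \<le> \<bar>Im (w - s)\<bar>" using that s by auto
    then show ?thesis using abs_Re_le_cmod[of "w - s"] abs_Im_le_cmod[of "w - s"] by linarith
  qed
  have gle: "cmod (g w) \<le> cmod (h w) ^ 2 / \<delta>" if "Re w \<in> {x1, x2} \<or> Im w \<in> {y1, y2}" for w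
    using dist[OF that] \<delta> by (auto simp: g_def norm_divide norm_power intro!: divide_left_mono mult_pos_pos)
  have seg: "s \<notin> closed_segment (Complex u y) (Complex v y)" if "y \<in> {y1, y2}" for u v y
    using that s \<delta> by (auto simp: closed_segment_same_Im)
  have seg': "s \<notin> closed_segment (Complex x u) (Complex x v)" if "x \<in> {x1, x2}" for u v x
    using that s \<delta> by (auto simp: closed_segment_same_Re)
  have ci: "g contour_integrable_on linepath a1 a2" "g contour_integrable_on linepath a2 a3"
     "g contour_integrable_on linepath a3 a4" "g contour_integrable_on linepath a4 a1"
    unfolding a by (intro contour_integrable_continuous_linepath gcont seg seg', simp)+
  have box: "s \<in> box a1 a3" using s \<delta> by (auto simp: in_box_complex_iff a)
  have "((\<lambda>w. h w ^ 2 / (w - s)) has_contour_integral (2 * pi * \<i> * winding_number (rectpath a1 a3) s * h s ^ 2)) (rectpath a1 a3)"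
  proof (rule Cauchy_integral_formula_convex_simple[of UNIV])
    have "path_image (rectpath a1 a3) = cbox a1 a3 - box a1 a3"
      using x y by (intro path_image_rectpath_cbox_minus_box) (auto simp: a)
    then show "path_image (rectpath a1 a3) \<subseteq> UNIV - {s}" using box by auto
  qed (use hol in \<open>auto intro!: holomorphic_intros\<close>)
  then have "contour_integral (rectpath a1 a3) g = 2 * pi * \<i> * h s ^ 2"
    using winding_number_rectpath[OF box] by (simp add: g_def contour_integral_unique)
  moreover have "contour_integral (rectpath a1 a3) g = contour_integral (linepath a1 a2) g + contour_integral (linepath a2 a3) g
      + contour_integral (linepath a3 a4) g + contour_integral (linepath a4 a1) g"
    using ci unfolding rectpath_def Let_def a by (simp add: contour_integrable_joinI)
  moreover have "contour_integral (linepath a3 a4) g = - contour_integral (linepath a4 a3) g"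
    unfolding a by (intro contour_integral_reverse_linepath gcont seg) simp
  moreover have "contour_integral (linepath a4 a1) g = - contour_integral (linepath a1 a4) g"
    unfolding a by (intro contour_integral_reverse_linepath gcont seg') simp
  ultimately have E: "2 * pi * \<i> * h s ^ 2 = contour_integral (linepath a1 a2) g + contour_integral (linepath a2 a3) g
      - contour_integral (linepath a4 a3) g - contour_integral (linepath a1 a4) g" by simp
  have "cmod (2 * pi * \<i> * h s ^ 2) \<le> cmod (contour_integral (linepath a1 a2) g) + cmod (contour_integral (linepath a2 a3) g)
      + cmod (contour_integral (linepath a4 a3) g) + cmod (contour_integral (linepath a1 a4) g)"
    unfolding E
    using norm_triangle_ineq4[of "contour_integral (linepath a1 a2) g + contour_integral (linepath a2 a3) g
        - contour_integral (linepath a4 a3) g" "contour_integral (linepath a1 a4) g"]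
      norm_triangle_ineq4[of "contour_integral (linepath a1 a2) g + contour_integral (linepath a2 a3) g"
        "contour_integral (linepath a4 a3) g"]
      norm_triangle_ineq[of "contour_integral (linepath a1 a2) g" "contour_integral (linepath a2 a3) g"]
    by linarith
  moreover have "cmod (contour_integral (linepath a1 a2) g) \<le> (x2 - x1) * integral {0..1} (\<lambda>\<tau>. cmod (h (Complex (x1 + \<tau> * (x2 - x1)) y1)) ^ 2 / \<delta>)"
    unfolding a using x by (intro contour_integral_horizontal_bound[where q = "\<lambda>x. cmod (h (Complex x y1)) ^ 2 / \<delta>"]
        gcont seg contq continuous_intros gle) auto
  moreover have "cmod (contour_integral (linepath a4 a3) g) \<le> (x2 - x1) * integral {0..1} (\<lambda>\<tau>. cmod (h (Complex (x1 + \<tau> * (x2 - x1)) y2)) ^ 2 / \<delta>)"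
    unfolding a using x by (intro contour_integral_horizontal_bound[where q = "\<lambda>x. cmod (h (Complex x y2)) ^ 2 / \<delta>"]
        gcont seg contq continuous_intros gle) auto
  moreover have "cmod (contour_integral (linepath a2 a3) g) \<le> integral {y1..y2} (\<lambda>t. cmod (h (Complex x2 t)) ^ 2 / \<delta>)"
  proof -
    have "continuous_on {y1..y2} (\<lambda>t. g (Complex x2 t))"
      by (rule continuous_on_compose2[OF gcont[of "- {s}"]]) (use s \<delta> in \<open>auto intro!: continuous_intros\<close>)
    then show ?thesis unfolding a using y
      by (intro contour_integral_vertical_bound contq continuous_intros gle) auto
  qed
  moreover have "cmod (contour_integral (linepath a1 a4) g) \<le> integral {y1..y2} (\<lambda>t. cmod (h (Complex x1 t)) ^ 2 / \<delta>)"
  proof -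
    have "continuous_on {y1..y2} (\<lambda>t. g (Complex x1 t))"
      by (rule continuous_on_compose2[OF gcont[of "- {s}"]]) (use s \<delta> in \<open>auto intro!: continuous_intros\<close>)
    then show ?thesis unfolding a using y
      by (intro contour_integral_vertical_bound contq continuous_intros gle) auto
  qed
  ultimately have "2 * pi * cmod (h s) ^ 2 \<le> (integral {y1..y2} (\<lambda>t. cmod (h (Complex x1 t)) ^ 2) + integral {y1..y2} (\<lambda>t. cmod (h (Complex x2 t)) ^ 2)
     + (x2 - x1) * (integral {0..1} (\<lambda>\<tau>. cmod (h (Complex (x1 + \<tau> * (x2 - x1)) y1)) ^ 2)
                  + integral {0..1} (\<lambda>\<tau>. cmod (h (Complex (x1 + \<tau> * (x2 - x1)) y2)) ^ 2))) / \<delta>"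
    by (simp add: norm_mult norm_power add_divide_distrib distrib_left)
  then show ?thesis using \<delta> by (simp add: field_simps)
qed

lemma continuous_on_norm_square_line:
  assumes "h holomorphic_on UNIV" "continuous_on A u" "continuous_on A v"
  shows "continuous_on A (\<lambda>x. cmod (h (Complex (u x) (v x))) ^ 2)"
  by (intro continuous_intros continuous_on_compose2[OF holomorphic_on_imp_continuous_on[OF assms(1)]] assms) auto

text \<open>
  For the rectangle of one block, Cauchy's formula involves integrals over horizontal edges.  Their mean over all
  blocks would be a mean of \<open>|h|\<^sup>2\<close> over heights in arithmetic progression, where a Dirichlet
  polynomial may resonate and be large all the time.  The inequality is therefore averaged over the
  height \<open>y\<close> of the lower edge, in an interval \<open>B\<close> of length \<open>\<delta>\<close>; what remains are the integrals \<open>I x\<close>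
  over vertical lines, for which the mean square is known.
\<close>

lemma square_le_line_integrals:
  fixes h :: "complex \<Rightarrow> complex"
  assumes hol: "h holomorphic_on UNIV" and x: "x1 \<le> x2" and y: "y1 \<le> y2" and \<delta>: "\<delta> > 0"
    and s: "x1 \<le> Re s" "Re s \<le> x2" "y1 \<le> Im s" "Im s \<le> y2"
  defines "I \<equiv> (\<lambda>x. integral {y1 - 2*\<delta>..y2 + 2*\<delta>} (\<lambda>t. cmod (h (Complex x t)) ^ 2))" and "W \<equiv> x2 - x1 + 2 * \<delta>"
  shows "2 * pi * \<delta> * \<delta> * cmod (h s) ^ 2 \<le>
     \<delta> * (I (x1 - \<delta>) + I (x2 + \<delta>)) + 2 * W * integral {0..1} (\<lambda>\<tau>. I (x1 - \<delta> + \<tau> * W))"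
proof -
  define H where "H = y2 - y1 + 3 * \<delta>"
  define q where "q = (\<lambda>\<tau> t. cmod (h (Complex (x1 - \<delta> + \<tau> * W) t)) ^ 2)"
  define B where "B = {y1 - 2*\<delta>..y1 - \<delta>}"
  have W: "W > 0" using x \<delta> by (simp add: W_def)
  note cont = continuous_on_norm_square_line[OF hol]
  have Iint: "(\<lambda>t. cmod (h (Complex x t)) ^ 2) integrable_on {a..b}" for a b x
    by (intro integrable_continuous_real cont continuous_intros)
  have qint: "(\<lambda>t. q \<tau> t) integrable_on {a..b}" for a b \<tau>
    unfolding q_def by (rule Iint)
  have sub: "integral {a..b} (\<lambda>t. cmod (h (Complex x t)) ^ 2) \<le> I x" if "y1 - 2*\<delta> \<le> a" "b \<le> y2 + 2*\<delta>" for a b x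
    unfolding I_def by (rule integral_subset_le) (use that Iint in auto)
  have contI: "continuous_on {0..1} (\<lambda>\<tau>. I (x1 - \<delta> + \<tau> * W))"
    unfolding I_def
    by (rule integral_continuous_on_param[where a = "y1 - 2*\<delta>" and b = "y2 + 2*\<delta>", simplified])
       (unfold split_beta, intro cont continuous_intros)
  have contJ: "continuous_on B (\<lambda>y. integral {0..1} (\<lambda>\<tau>. q \<tau> (y + c)))" for c
    unfolding q_def
    by (rule integral_continuous_on_param[where a = 0 and b = "1::real", simplified])
       (unfold split_beta, intro cont continuous_intros)
  (* Averaging an edge over B and exchanging the integrals turns horizontal into vertical lines;
     c = 0 is the lower edge, c = H the upper one. *)
  have J: "integral B (\<lambda>y. integral {0..1} (\<lambda>\<tau>. q \<tau> (y + c))) \<le> integral {0..1} (\<lambda>\<tau>. I (x1 - \<delta> + \<tau> * W))"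
    if c: "0 \<le> c" "c \<le> y2 - y1 + 3 * \<delta>" for c
  proof -
    have "integral B (\<lambda>y. integral {0..1} (\<lambda>\<tau>. q \<tau> (y + c))) = integral {0..1} (\<lambda>\<tau>. integral B (\<lambda>y. q \<tau> (y + c)))"
      using integral_swap_continuous[of "y1 - 2*\<delta>" 0 "y1 - \<delta>" 1 "\<lambda>y \<tau>. q \<tau> (y + c)"]
      unfolding B_def q_def by (simp add: split_beta cont continuous_intros)
    also have "\<dots> \<le> integral {0..1} (\<lambda>\<tau>. I (x1 - \<delta> + \<tau> * W))"
    proof (rule integral_le)
      show "(\<lambda>\<tau>. I (x1 - \<delta> + \<tau> * W)) integrable_on {0..1}" by (rule integrable_continuous_real[OF contI])
      show "(\<lambda>\<tau>. integral B (\<lambda>y. q \<tau> (y + c))) integrable_on {0..1}"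
        unfolding q_def B_def
        by (rule integrable_continuous_real, rule integral_continuous_on_param[where a = "y1 - 2*\<delta>" and b = "y1 - \<delta>", simplified])
           (unfold split_beta, intro cont continuous_intros)
      fix \<tau> :: real assume "\<tau> \<in> {0..1}"
      have "integral B (\<lambda>y. q \<tau> (y + c)) = integral {y1 - 2*\<delta> + c..y1 - \<delta> + c} (q \<tau>)"
        using integral_shift[of "y1 - 2*\<delta>" c "y1 - \<delta>" "q \<tau>"] unfolding B_def q_def
        by (simp add: o_def cont continuous_intros)
      also have "\<dots> \<le> I (x1 - \<delta> + \<tau> * W)" unfolding q_def using c \<delta> y by (intro sub) auto
      finally show "integral B (\<lambda>y. q \<tau> (y + c)) \<le> I (x1 - \<delta> + \<tau> * W)" .
    qed
    finally show ?thesis .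
  qed
  have main: "2 * pi * \<delta> * cmod (h s) ^ 2 \<le> I (x1 - \<delta>) + I (x2 + \<delta>)
      + W * (integral {0..1} (\<lambda>\<tau>. q \<tau> (y + 0)) + integral {0..1} (\<lambda>\<tau>. q \<tau> (y + H)))" if yB: "y \<in> B" for y
  proof -
    have W': "x2 + \<delta> - (x1 - \<delta>) = W" by (simp add: W_def)
    have "2 * pi * \<delta> * cmod (h s) ^ 2 \<le>
       integral {y..y + H} (\<lambda>t. cmod (h (Complex (x1 - \<delta>) t)) ^ 2) + integral {y..y + H} (\<lambda>t. cmod (h (Complex (x2 + \<delta>) t)) ^ 2)
       + (x2 + \<delta> - (x1 - \<delta>)) * (integral {0..1} (\<lambda>\<tau>. cmod (h (Complex (x1 - \<delta> + \<tau> * (x2 + \<delta> - (x1 - \<delta>))) y)) ^ 2)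
                  + integral {0..1} (\<lambda>\<tau>. cmod (h (Complex (x1 - \<delta> + \<tau> * (x2 + \<delta> - (x1 - \<delta>))) (y + H))) ^ 2))"
      by (rule square_le_rectangle_boundary[OF hol]) (use yB x y \<delta> s in \<open>auto simp: B_def H_def\<close>)
    also have "\<dots> \<le> I (x1 - \<delta>) + I (x2 + \<delta>) + W * (integral {0..1} (\<lambda>\<tau>. q \<tau> (y + 0)) + integral {0..1} (\<lambda>\<tau>. q \<tau> (y + H)))"
      unfolding W' q_def using yB y \<delta> by (intro add_mono[OF add_mono] sub) (auto simp: B_def H_def)
    finally show ?thesis .
  qed
  have "integral B (\<lambda>y. 2 * pi * \<delta> * cmod (h s) ^ 2) \<le> integral B (\<lambda>y. I (x1 - \<delta>) + I (x2 + \<delta>)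
      + W * (integral {0..1} (\<lambda>\<tau>. q \<tau> (y + 0)) + integral {0..1} (\<lambda>\<tau>. q \<tau> (y + H))))"
    unfolding B_def
    by (rule integral_le) (use main contJ in \<open>auto simp: B_def simp del: add_0_right intro!: integrable_continuous_real continuous_intros\<close>)
  also have "\<dots> = integral B (\<lambda>y. I (x1 - \<delta>) + I (x2 + \<delta>)) + W * (integral B (\<lambda>y. integral {0..1} (\<lambda>\<tau>. q \<tau> (y + 0)))
      + integral B (\<lambda>y. integral {0..1} (\<lambda>\<tau>. q \<tau> (y + H))))"
  proof -
    have i: "(\<lambda>y. integral {0..1} (\<lambda>\<tau>. q \<tau> (y + c))) integrable_on B" for c
      using contJ[of c] unfolding B_def by (rule integrable_continuous_real)
    have k: "(\<lambda>y. k) integrable_on B" for k :: real unfolding B_def by (rule integrable_const_ivl)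
    show ?thesis
      by (rule integral_unique) (intro has_integral_add has_integral_mult_right integrable_integral i k)
  qed
  also have "\<dots> \<le> integral B (\<lambda>y. I (x1 - \<delta>) + I (x2 + \<delta>)) + W * (integral {0..1} (\<lambda>\<tau>. I (x1 - \<delta> + \<tau> * W)) + integral {0..1} (\<lambda>\<tau>. I (x1 - \<delta> + \<tau> * W)))"
    using W y \<delta> by (intro add_left_mono mult_left_mono add_mono J) (auto simp: H_def)
  finally show ?thesis using \<delta> by (simp add: B_def algebra_simps)
qed

lemma dirichlet_poly_holomorphic: "dirichlet_poly c N holomorphic_on UNIV"
proof -
  have "(\<lambda>s. c n / of_nat n powr s) holomorphic_on UNIV" if "n \<in> {1..N}" for n
    using that by (intro holomorphic_intros) auto
  then show ?thesis unfolding dirichlet_poly_def [abs_def] by (intro holomorphic_on_sum)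
qed

lemma sum_integral_blocks:
  fixes f :: "real \<Rightarrow> real"
  assumes "continuous_on UNIV f" "l > 0"
  shows "(\<Sum>n=1..X. integral {A + real n * l..A + (real n + 1) * l} f) = integral {A + l..A + (real X + 1) * l} f"
proof (induction X)
  case (Suc X)
  have "integral {A + l..A + (real X + 1) * l} f + integral {A + (real X + 1) * l..A + (real X + 2) * l} f =
     integral {A + l..A + (real X + 2) * l} f"
    using assms by (intro Henstock_Kurzweil_Integration.integral_combine integrable_continuous_real)
      (auto intro: continuous_on_subset simp: algebra_simps)
  then show ?case using Suc by (simp add: algebra_simps)
qed simp

text \<open>
  Blocks enlarged by \<open>k\<close> neighbours on either side cover every point at most \<open>2k + 1\<close> times.
\<close>

lemma sum_integral_overlapping_blocks:
  fixes f :: "real \<Rightarrow> real"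
  assumes f: "continuous_on UNIV f" "\<And>t. f t \<ge> 0" and l: "l > 0"
    and bound: "\<And>a b. a \<le> b \<Longrightarrow> integral {a..b} f \<le> (b - a) * S + K"
  shows "(\<Sum>n=1..X. integral {real n * l - real k * l..(real n + 1) * l + real k * l} f) \<le> real (2*k+1) * (real X * l * S + K)"
proof -
  have int: "f integrable_on {a..b}" for a b
    using f(1) by (intro integrable_continuous_real) (auto intro: continuous_on_subset)
  have split: "integral {B..B + real j * l} f = (\<Sum>i<j. integral {B + real i * l..B + (real i + 1) * l} f)" for B j
  proof (induction j)
    case (Suc j)
    have "integral {B..B + real j * l} f + integral {B + real j * l..B + (real j + 1) * l} f = integral {B..B + (real j + 1) * l} f"
      using l int by (intro Henstock_Kurzweil_Integration.integral_combine) (auto simp: algebra_simps)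
    then show ?case using Suc by (simp add: add.commute)
  qed simp
  have "(\<Sum>n=1..X. integral {real n * l - real k * l..(real n + 1) * l + real k * l} f) =
        (\<Sum>n=1..X. \<Sum>i<2*k+1. integral {(real i - real k) * l + real n * l..(real i - real k) * l + (real n + 1) * l} f)"
  proof (intro sum.cong refl)
    fix n
    have "(real n + 1) * l + real k * l = (real n * l - real k * l) + real (2*k+1) * l" by (simp add: algebra_simps)
    then have "integral {real n * l - real k * l..(real n + 1) * l + real k * l} f =
      (\<Sum>i<2*k+1. integral {(real n * l - real k * l) + real i * l..(real n * l - real k * l) + (real i + 1) * l} f)"
      by (simp only: split)
    also have "\<dots> = (\<Sum>i<2*k+1. integral {(real i - real k) * l + real n * l..(real i - real k) * l + (real n + 1) * l} f)"
      by (intro sum.cong refl) (simp add: algebra_simps)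
    finally show "integral {real n * l - real k * l..(real n + 1) * l + real k * l} f = \<dots>" .
  qed
  also have "\<dots> = (\<Sum>i<2*k+1. \<Sum>n=1..X. integral {(real i - real k) * l + real n * l..(real i - real k) * l + (real n + 1) * l} f)"
    by (rule sum.swap)
  also have "\<dots> = (\<Sum>i<2*k+1. integral {(real i - real k) * l + l..(real i - real k) * l + (real X + 1) * l} f)"
    by (simp only: sum_integral_blocks[OF f(1) l])
  also have "\<dots> \<le> (\<Sum>i<2*k+1. real X * l * S + K)"
  proof (rule sum_mono)
    fix i
    have "integral {(real i - real k) * l + l..(real i - real k) * l + (real X + 1) * l} f \<le>
       ((real i - real k) * l + (real X + 1) * l - ((real i - real k) * l + l)) * S + K"
      using l by (intro bound) (simp add: algebra_simps)
    then show "integral {(real i - real k) * l + l..(real i - real k) * l + (real X + 1) * l} f \<le> real X * l * S + K"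
      by (simp add: algebra_simps)
  qed
  also have "\<dots> = real (2*k+1) * (real X * l * S + K)" by simp
  finally show ?thesis .
qed

section \<open>Blockwise suprema\<close>

definition block_rect :: "real \<Rightarrow> real \<Rightarrow> real \<Rightarrow> real \<Rightarrow> nat \<Rightarrow> complex set" where
  "block_rect l x1 x2 \<delta> n = {s. x1 \<le> Re s \<and> Re s \<le> x2 \<and> real n * l - \<delta> \<le> Im s \<and> Im s \<le> (real n + 1) * l + \<delta>}"

text \<open>
  In essence, \<open>c\<close> bounds the upper limit of the averages over \<open>n \<le> X\<close>, \<open>n \<in> J\<close> of
  \<open>sup {|h s|^2. s \<in> R n}\<close>.  It is phrased through a majorant \<open>y\<close> of the suprema: this
  avoids all questions of boundedness, and majorants can be added and spliced.
\<close>

definition mean_sup_le :: "(nat \<Rightarrow> complex set) \<Rightarrow> nat set \<Rightarrow> (complex \<Rightarrow> complex) \<Rightarrow> real \<Rightarrow> bool" where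
  "mean_sup_le R J h c \<longleftrightarrow> (\<exists>y :: nat \<Rightarrow> real. (\<forall>n. y n \<ge> 0) \<and> (\<forall>n\<in>J. \<forall>s\<in>R n. cmod (h s) ^ 2 \<le> y n) \<and>
     (\<forall>\<^sub>F X in sequentially. (\<Sum>n=1..X. y n) \<le> c * real X))"

lemma mean_sup_leE:
  assumes "mean_sup_le R J h c"
  obtains y :: "nat \<Rightarrow> real" where "\<And>n. y n \<ge> 0" "\<And>n s. n \<in> J \<Longrightarrow> s \<in> R n \<Longrightarrow> cmod (h s) ^ 2 \<le> y n"
    "\<forall>\<^sub>F X in sequentially. (\<Sum>n=1..X. y n) \<le> c * real X"
  using assms unfolding mean_sup_le_def by blast

lemma mean_sup_leI:
  fixes y :: "nat \<Rightarrow> real"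
  assumes "\<And>n. y n \<ge> 0" "\<And>n s. n \<in> J \<Longrightarrow> s \<in> R n \<Longrightarrow> cmod (h s) ^ 2 \<le> y n"
    "\<forall>\<^sub>F X in sequentially. (\<Sum>n=1..X. y n) \<le> c * real X"
  shows "mean_sup_le R J h c"
  using assms unfolding mean_sup_le_def by blast

lemma mean_sup_le_mono:
  assumes "mean_sup_le R J h c" "c \<le> d" "J' \<subseteq> J"
  shows "mean_sup_le R J' h d"
proof -
  obtain y where y: "\<And>n. y n \<ge> 0" "\<And>n s. n \<in> J \<Longrightarrow> s \<in> R n \<Longrightarrow> cmod (h s) ^ 2 \<le> y n"
    "\<forall>\<^sub>F X in sequentially. (\<Sum>n=1..X. y n) \<le> c * real X" by (rule mean_sup_leE[OF assms(1)]) blast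
  have "\<forall>\<^sub>F X in sequentially. (\<Sum>n=1..X. y n) \<le> d * real X"
    using y(3)
  proof eventually_elim
    case (elim X)
    have "c * real X \<le> d * real X" using assms(2) by (intro mult_right_mono) auto
    then show ?case using elim by linarith
  qed
  then show ?thesis using y(1,2) assms(3) by (intro mean_sup_leI[of y]) auto
qed

lemma mean_sup_le_add:
  assumes "mean_sup_le R J f c" "mean_sup_le R J g d"
  shows "mean_sup_le R J (\<lambda>s. f s + g s) (2 * c + 2 * d)"
proof -
  obtain y where y: "\<And>n. y n \<ge> 0" "\<And>n s. n \<in> J \<Longrightarrow> s \<in> R n \<Longrightarrow> cmod (f s) ^ 2 \<le> y n"
    "\<forall>\<^sub>F X in sequentially. (\<Sum>n=1..X. y n) \<le> c * real X" by (rule mean_sup_leE[OF assms(1)]) blast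
  obtain z where z: "\<And>n. z n \<ge> 0" "\<And>n s. n \<in> J \<Longrightarrow> s \<in> R n \<Longrightarrow> cmod (g s) ^ 2 \<le> z n"
    "\<forall>\<^sub>F X in sequentially. (\<Sum>n=1..X. z n) \<le> d * real X" by (rule mean_sup_leE[OF assms(2)]) blast
  show ?thesis
  proof (rule mean_sup_leI[of "\<lambda>n. 2 * y n + 2 * z n"])
    fix n s assume n: "n \<in> J" "s \<in> R n"
    have "cmod (f s + g s) ^ 2 \<le> (cmod (f s) + cmod (g s)) ^ 2"
      by (intro power_mono norm_triangle_ineq) auto
    also have "\<dots> \<le> 2 * cmod (f s) ^ 2 + 2 * cmod (g s) ^ 2"
      using zero_le_power2[of "cmod (f s) - cmod (g s)"] by (simp add: power2_eq_square algebra_simps)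
    finally show "cmod (f s + g s) ^ 2 \<le> 2 * y n + 2 * z n" using y(2)[OF n] z(2)[OF n] by linarith
  next
    show "\<forall>\<^sub>F X in sequentially. (\<Sum>n=1..X. 2 * y n + 2 * z n) \<le> (2 * c + 2 * d) * real X"
      using y(3) z(3)
    proof eventually_elim
      case (elim X)
      have "(\<Sum>n=1..X. 2 * y n + 2 * z n) = 2 * (\<Sum>n=1..X. y n) + 2 * (\<Sum>n=1..X. z n)"
        by (simp add: sum.distrib sum_distrib_left)
      also have "\<dots> \<le> 2 * (c * real X) + 2 * (d * real X)" using elim by linarith
      finally show ?case by (simp add: algebra_simps)
    qed
  qed (use y(1) z(1) in \<open>simp add: add_nonneg_nonneg\<close>)
qed

text \<open>
  It is essential that \<open>C\<close> depends on the geometry only, and neither on the coefficients nor on \<open>N\<close>.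
  The error of the mean square does depend on them, but it is bounded in the length of the interval, and
  \<open>e\<close> absorbs it.
\<close>

lemma dirichlet_poly_mean_sup:
  fixes l \<delta>0 x0 x1 x2 :: real
  assumes l: "l > 0" and \<delta>0: "\<delta>0 \<ge> 0" and x: "0 \<le> x0" "x0 < x1" "x1 \<le> x2"
  shows "\<exists>C>0. \<forall>c N. \<forall>e>0. mean_sup_le (block_rect l x1 x2 \<delta>0) UNIV (dirichlet_poly c N)
     (C * (\<Sum>m=1..N. cmod (c m) ^ 2 * real m powr (-2 * x0)) + e)"
proof -
  define \<delta> where "\<delta> = x1 - x0"
  have \<delta>: "\<delta> > 0" using x by (simp add: \<delta>_def)
  define W where "W = x2 - x1 + 2 * \<delta>"
  have W: "W > 0" using x \<delta> by (simp add: W_def)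
  (* k neighbouring blocks on each side cover the enlargement by delta0 + 2 delta. *)
  define k where "k = nat \<lceil>(\<delta>0 + 2 * \<delta>) / l\<rceil>"
  have k: "\<delta>0 + 2 * \<delta> \<le> real k * l"
  proof -
    have "(\<delta>0 + 2 * \<delta>) / l \<le> real k" unfolding k_def by (rule real_nat_ceiling_ge)
    then show ?thesis using l by (simp add: field_simps)
  qed
  define A where "A = (2 * \<delta> + 2 * W) * real (2*k+1) / (2 * pi * \<delta> * \<delta>)"
  have A: "A > 0" using \<delta> W by (simp add: A_def)
  have "mean_sup_le (block_rect l x1 x2 \<delta>0) UNIV (dirichlet_poly c N)
     ((A * l) * (\<Sum>m=1..N. cmod (c m) ^ 2 * real m powr (-2 * x0)) + e)" if e: "e > 0" for c N e
  proof -
    define P where "P = dirichlet_poly c N"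
    have hol: "P holomorphic_on UNIV" unfolding P_def by (rule dirichlet_poly_holomorphic)
    note cont = continuous_on_norm_square_line[OF hol]
    have Pcont: "continuous_on B (\<lambda>t. cmod (P (Complex x t)) ^ 2)" for x B by (intro cont continuous_intros)
    then have Pint: "(\<lambda>t. cmod (P (Complex x t)) ^ 2) integrable_on {a..b}" for x a b
      by (rule integrable_continuous_real)
    define S where "S = (\<Sum>m=1..N. cmod (c m) ^ 2 * real m powr (-2 * x0))"
    have S0: "S \<ge> 0" unfolding S_def by (intro sum_nonneg) auto
    obtain K where K: "K \<ge> 0" "\<And>\<sigma> a b. \<sigma> \<ge> 0 \<Longrightarrow> a \<le> b \<Longrightarrow> \<bar>integral {a..b} (\<lambda>t. cmod (P (Complex \<sigma> t)) ^ 2)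
      - (b - a) * (\<Sum>n=1..N. cmod (c n) ^ 2 * real n powr (-2 * \<sigma>))\<bar> \<le> K"
      using dirichlet_poly_mean_square[of c N] unfolding P_def by blast
    have bound: "integral {a..b} (\<lambda>t. cmod (P (Complex \<sigma> t)) ^ 2) \<le> (b - a) * S + K" if "\<sigma> \<ge> x0" "a \<le> b" for \<sigma> a b
    proof -
      have "(\<Sum>n=1..N. cmod (c n) ^ 2 * real n powr (-2 * \<sigma>)) \<le> S"
        unfolding S_def using that x by (intro sum_mono mult_left_mono[OF powr_mono]) auto
      then have "(b - a) * (\<Sum>n=1..N. cmod (c n) ^ 2 * real n powr (-2 * \<sigma>)) \<le> (b - a) * S"
        using that by (intro mult_left_mono) auto
      then show ?thesis using K(2)[of \<sigma> a b] that x by linarith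
    qed
    define I where "I = (\<lambda>n x. integral {real n * l - \<delta>0 - 2*\<delta>..(real n + 1) * l + \<delta>0 + 2*\<delta>} (\<lambda>t. cmod (P (Complex x t)) ^ 2))"
    have I0: "I n x \<ge> 0" for n x unfolding I_def by (rule integral_nonneg[OF Pint]) auto
    have sumI: "(\<Sum>n=1..X. I n \<sigma>) \<le> real (2*k+1) * (real X * l * S + K)" if \<sigma>: "\<sigma> \<ge> x0" for X \<sigma>
    proof -
      have "(\<Sum>n=1..X. I n \<sigma>) \<le> (\<Sum>n=1..X. integral {real n * l - real k * l..(real n + 1) * l + real k * l} (\<lambda>t. cmod (P (Complex \<sigma> t)) ^ 2))"
        unfolding I_def
        by (intro sum_mono integral_subset_le) (use k Pint in auto)
      also have "\<dots> \<le> real (2*k+1) * (real X * l * S + K)"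
        by (rule sum_integral_overlapping_blocks) (use l bound[OF \<sigma>] Pcont in auto)
      finally show ?thesis .
    qed
    have contI: "continuous_on {0..1} (\<lambda>\<tau>. I n (x1 - \<delta> + \<tau> * W))" for n
      unfolding I_def
      by (rule integral_continuous_on_param[where a = "real n * l - \<delta>0 - 2*\<delta>" and b = "(real n + 1) * l + \<delta>0 + 2*\<delta>", simplified])
         (unfold split_beta, intro cont continuous_intros)
    have intI: "(\<lambda>\<tau>. I n (x1 - \<delta> + \<tau> * W)) integrable_on {0..1}" for n
      by (rule integrable_continuous_real[OF contI])
    define y where "y = (\<lambda>n. (\<delta> * (I n (x1 - \<delta>) + I n (x2 + \<delta>)) + 2 * W * integral {0..1} (\<lambda>\<tau>. I n (x1 - \<delta> + \<tau> * W))) / (2 * pi * \<delta> * \<delta>))"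
    have y0: "y n \<ge> 0" for n
      unfolding y_def using \<delta> W I0 intI by (intro divide_nonneg_nonneg add_nonneg_nonneg mult_nonneg_nonneg integral_nonneg) auto
    have sup: "cmod (P s) ^ 2 \<le> y n" if s: "x1 \<le> Re s" "Re s \<le> x2" "real n * l - \<delta>0 \<le> Im s" "Im s \<le> (real n + 1) * l + \<delta>0" for n s
    proof -
      have "real n * l - \<delta>0 \<le> (real n + 1) * l + \<delta>0" using l \<delta>0 by (simp add: algebra_simps)
      from square_le_line_integrals[OF hol x(3) this \<delta> s]
      have "2 * pi * \<delta> * \<delta> * cmod (P s) ^ 2 \<le> \<delta> * (I n (x1 - \<delta>) + I n (x2 + \<delta>)) + 2 * W * integral {0..1} (\<lambda>\<tau>. I n (x1 - \<delta> + \<tau> * W))"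
        by (simp add: I_def W_def)
      then show ?thesis unfolding y_def using \<delta> by (simp add: pos_le_divide_eq mult_ac)
    qed
    have sumy: "(\<Sum>n=1..X. y n) \<le> A * (real X * l * S + K)" for X
    proof -
      define Q where "Q = real (2*k+1) * (real X * l * S + K)"
      have "(\<Sum>n=1..X. y n) = (\<delta> * ((\<Sum>n=1..X. I n (x1 - \<delta>)) + (\<Sum>n=1..X. I n (x2 + \<delta>)))
          + 2 * W * (\<Sum>n=1..X. integral {0..1} (\<lambda>\<tau>. I n (x1 - \<delta> + \<tau> * W)))) / (2 * pi * \<delta> * \<delta>)"
        by (simp add: y_def sum_divide_distrib[symmetric] sum.distrib sum_distrib_left distrib_left)
      also have "(\<Sum>n=1..X. integral {0..1} (\<lambda>\<tau>. I n (x1 - \<delta> + \<tau> * W))) = integral {0..1} (\<lambda>\<tau>. \<Sum>n=1..X. I n (x1 - \<delta> + \<tau> * W))"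
        using intI by (intro integral_sum[symmetric]) auto
      also have "(\<delta> * ((\<Sum>n=1..X. I n (x1 - \<delta>)) + (\<Sum>n=1..X. I n (x2 + \<delta>))) + 2 * W * integral {0..1} (\<lambda>\<tau>. \<Sum>n=1..X. I n (x1 - \<delta> + \<tau> * W))) / (2 * pi * \<delta> * \<delta>)
        \<le> (\<delta> * (Q + Q) + 2 * W * Q) / (2 * pi * \<delta> * \<delta>)"
      proof (intro divide_right_mono add_mono mult_left_mono)
        show "(\<Sum>n=1..X. I n (x1 - \<delta>)) \<le> Q" "(\<Sum>n=1..X. I n (x2 + \<delta>)) \<le> Q"
          unfolding Q_def using x \<delta> by (intro sumI; simp add: \<delta>_def)+
        have "integral {0..1} (\<lambda>\<tau>. \<Sum>n=1..X. I n (x1 - \<delta> + \<tau> * W)) \<le> integral {0..1} (\<lambda>\<tau>::real. Q)"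
          unfolding Q_def using intI W
          by (intro integral_le sumI integrable_sum) (auto simp: \<delta>_def)
        then show "integral {0..1} (\<lambda>\<tau>. \<Sum>n=1..X. I n (x1 - \<delta> + \<tau> * W)) \<le> Q" by simp
      qed (use \<delta> W in auto)
      also have "\<dots> = A * (real X * l * S + K)"
        by (simp add: A_def Q_def algebra_simps add_divide_distrib)
      finally show ?thesis .
    qed
    have "\<forall>\<^sub>F X in sequentially. real X \<ge> A * K / e"
      using filterlim_real_sequentially by (simp add: filterlim_at_top)
    then have "\<forall>\<^sub>F X in sequentially. (\<Sum>n=1..X. y n) \<le> (A * l * S + e) * real X"
    proof eventually_elim
      case (elim X)
      then have "A * K \<le> e * real X" using e by (simp add: field_simps)
      then show ?case using sumy[of X] by (simp add: algebra_simps)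
    qed
    then show ?thesis using y0 sup unfolding P_def S_def by (intro mean_sup_leI[of y]) (auto simp: block_rect_def)
  qed
  moreover have "A * l > 0" using A l by simp
  ultimately show ?thesis by blast
qed

section \<open>Approximation on blocks\<close>

definition half_strip :: "real \<Rightarrow> real \<Rightarrow> real \<Rightarrow> nat \<Rightarrow> complex set" where
  "half_strip l x \<delta> n = {s. Re s > x \<and> real n * l - \<delta> < Im s \<and> Im s < (real n + 1) * l + \<delta>}"

definition bdd_on_blocks :: "real \<Rightarrow> real \<Rightarrow> real \<Rightarrow> (complex \<Rightarrow> complex) \<Rightarrow> nat set \<Rightarrow> bool" where
  "bdd_on_blocks l x \<delta> g J \<longleftrightarrow>
     (\<exists>M. \<forall>n\<in>J. g holomorphic_on half_strip l x \<delta> n \<and> (\<forall>s\<in>half_strip l x \<delta> n. cmod (g s) \<le> M))"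

lemma half_strip_open: "open (half_strip l x \<delta> n)" and half_strip_convex: "convex (half_strip l x \<delta> n)"
proof -
  have eq: "half_strip l x \<delta> n = {s. Re s > x} \<inter> {s. Im s > real n * l - \<delta>} \<inter> {s. Im s < (real n + 1) * l + \<delta>}"
    by (auto simp: half_strip_def)
  show "open (half_strip l x \<delta> n)" unfolding eq
    by (intro open_Int open_halfspace_Re_gt open_halfspace_Im_gt open_halfspace_Im_lt)
  show "convex (half_strip l x \<delta> n)" unfolding eq
    by (intro convex_Int convex_halfspace_Re_gt convex_halfspace_Im_gt convex_halfspace_Im_lt)
qed

lemma half_strip_mono: "x \<le> x' \<Longrightarrow> \<delta>' \<le> \<delta> \<Longrightarrow> half_strip l x' \<delta>' n \<subseteq> half_strip l x \<delta> n"
  by (auto simp: half_strip_def)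

lemma bdd_on_blocks_mono:
  assumes "bdd_on_blocks l x \<delta> g J" "x \<le> x'" "\<delta>' \<le> \<delta>" "J' \<subseteq> J"
  shows "bdd_on_blocks l x' \<delta>' g J'"
proof -
  from assms(1) obtain M where M: "\<forall>n\<in>J. g holomorphic_on half_strip l x \<delta> n \<and> (\<forall>s\<in>half_strip l x \<delta> n. cmod (g s) \<le> M)"
    unfolding bdd_on_blocks_def by blast
  have "g holomorphic_on half_strip l x' \<delta>' n \<and> (\<forall>s\<in>half_strip l x' \<delta>' n. cmod (g s) \<le> M)" if "n \<in> J'" for n
  proof -
    have "n \<in> J" using that assms(4) by blast
    then show ?thesis
      using M half_strip_mono[OF assms(2,3), of l n] holomorphic_on_subset[of g "half_strip l x \<delta> n"] by (meson subsetD)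
  qed
  then show ?thesis unfolding bdd_on_blocks_def by blast
qed

lemma bdd_on_blocksE:
  assumes "bdd_on_blocks l x \<delta> g J"
  obtains M where "M > 0" "\<And>n. n \<in> J \<Longrightarrow> g holomorphic_on half_strip l x \<delta> n"
    "\<And>n s. n \<in> J \<Longrightarrow> s \<in> half_strip l x \<delta> n \<Longrightarrow> cmod (g s) \<le> M"
proof -
  from assms obtain M where M: "\<forall>n\<in>J. g holomorphic_on half_strip l x \<delta> n \<and> (\<forall>s\<in>half_strip l x \<delta> n. cmod (g s) \<le> M)"
    unfolding bdd_on_blocks_def by blast
  show ?thesis
  proof (rule that[of "max M 1"])
    show "cmod (g s) \<le> max M 1" if "n \<in> J" "s \<in> half_strip l x \<delta> n" for n s
      using M that by (simp add: le_max_iff_disj)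
  qed (use M in auto)
qed

lemma bdd_on_blocks_mult:
  assumes "bdd_on_blocks l x \<delta> f J" "bdd_on_blocks l x \<delta> g J"
  shows "bdd_on_blocks l x \<delta> (\<lambda>s. f s * g s) J"
proof -
  obtain M where M: "M > 0" "\<And>n. n \<in> J \<Longrightarrow> f holomorphic_on half_strip l x \<delta> n"
    "\<And>n s. n \<in> J \<Longrightarrow> s \<in> half_strip l x \<delta> n \<Longrightarrow> cmod (f s) \<le> M" by (rule bdd_on_blocksE[OF assms(1)]) blast
  obtain M' where M': "M' > 0" "\<And>n. n \<in> J \<Longrightarrow> g holomorphic_on half_strip l x \<delta> n"
    "\<And>n s. n \<in> J \<Longrightarrow> s \<in> half_strip l x \<delta> n \<Longrightarrow> cmod (g s) \<le> M'" by (rule bdd_on_blocksE[OF assms(2)]) blast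
  show ?thesis unfolding bdd_on_blocks_def
  proof (intro exI[of _ "M * M'"] ballI conjI)
    fix n assume n: "n \<in> J"
    show "(\<lambda>s. f s * g s) holomorphic_on half_strip l x \<delta> n" using M(2)[OF n] M'(2)[OF n] by (rule holomorphic_on_mult)
    show "cmod (f s * g s) \<le> M * M'" if "s \<in> half_strip l x \<delta> n" for s
      unfolding norm_mult using M(1) by (intro mult_mono M(3)[OF n that] M'(3)[OF n that]) auto
  qed
qed

lemma bdd_on_blocks_power:
  assumes "bdd_on_blocks l x \<delta> g J"
  shows "bdd_on_blocks l x \<delta> (\<lambda>s. g s ^ k) J"
proof (induction k)
  case 0
  show ?case unfolding bdd_on_blocks_def by (auto intro!: exI[of _ 1])
next
  case (Suc k)
  then show ?case using bdd_on_blocks_mult[OF assms Suc] by simp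
qed

text \<open>
  On the right \<open>h N\<close> is at most \<open>\<epsilon>\<close>, and on the rectangle of block \<open>n\<close> at most \<open>M (1 + \<surd>(y n))\<close>, where
  \<open>y n\<close> majorizes \<open>|P\<^sub>N|\<^sup>2\<close> and has bounded mean, uniformly in \<open>N\<close>.  The inequality
  \<open>|h N| \<le> \<eta> M (1 + \<surd>(y n)) + \<kappa> \<epsilon>\<close> follows by \<open>two_constants_scaled\<close>.  First \<open>\<eta>\<close> is
  chosen to make the mean square of the first term small; this fixes \<open>\<kappa>\<close>, and a large \<open>N\<close> makes \<open>\<kappa> \<epsilon>\<close> small.
\<close>

lemma mean_sup_vanishes:
  fixes h :: "nat \<Rightarrow> complex \<Rightarrow> complex"
  assumes l: "l > 0" and x: "1/2 < x0" "x0 < x1" "x1 \<le> 2" and \<delta>: "0 \<le> \<delta>1" "\<delta>1 < \<delta>0"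
    and b: "ramanujan_hypothesis b" and M: "M > 0"
    and hol: "\<And>N n. n \<in> J \<Longrightarrow> h N holomorphic_on half_strip l x0 \<delta>0 n"
    and grow: "\<And>N n s. n \<in> J \<Longrightarrow> s \<in> half_strip l x0 \<delta>0 n \<Longrightarrow> cmod (h N s) \<le> M * (1 + cmod (dirichlet_poly b N s))"
    and small: "\<And>e. e > 0 \<Longrightarrow> \<exists>N0. \<forall>N\<ge>N0. \<forall>s. Re s \<ge> 2 \<longrightarrow> cmod (h N s) \<le> e"
    and e: "e > 0"
  shows "\<exists>N0. \<forall>N\<ge>N0. mean_sup_le (block_rect l x1 2 \<delta>1) J (h N) e"
proof -
  define x' where "x' = (x0 + x1) / 2"
  define \<delta>' where "\<delta>' = (\<delta>0 + \<delta>1) / 2"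
  have x': "x0 < x'" "x' < x1" "0 \<le> x0" "x' \<le> 4" using x by (auto simp: x'_def)
  have \<delta>': "\<delta>1 < \<delta>'" "\<delta>' < \<delta>0" "0 \<le> \<delta>'" using \<delta> by (auto simp: \<delta>'_def)
  obtain C where C: "C > 0" "\<And>c N e. e > 0 \<Longrightarrow> mean_sup_le (block_rect l x' 4 \<delta>') UNIV (dirichlet_poly c N)
     (C * (\<Sum>m=1..N. cmod (c m) ^ 2 * real m powr (-2 * x0)) + e)"
    using dirichlet_poly_mean_sup[OF l \<delta>'(3) x'(3,1,4)] by blast
  define S where "S = (\<Sum>\<^sub>\<infinity>m\<in>{1..}. cmod (b m) ^ 2 * real m powr (-2 * x0))"
  have S: "(\<Sum>m=1..N. cmod (b m) ^ 2 * real m powr (-2 * x0)) \<le> S" for N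
    unfolding S_def by (rule finite_sum_le_infsum[OF ramanujan_square_summable[OF b x(1)]]) auto
  have S0: "S \<ge> 0" using S[of 0] by simp
  define \<Omega> where "\<Omega> = box (Complex x' (-\<delta>')) (Complex 4 (l + \<delta>'))"
  define V where "V = box (Complex 2 (-\<delta>')) (Complex 4 (l + \<delta>'))"
  define K where "K = cbox (Complex x1 (-\<delta>1)) (Complex 2 (l + \<delta>1))"
  note regions = \<Omega>_def V_def K_def in_box_complex_iff in_cbox_complex_iff
  have \<Omega>: "open \<Omega>" "connected \<Omega>" by (simp_all add: \<Omega>_def open_box convex_connected convex_box)
  have V: "open V" "V \<subseteq> \<Omega>" "V \<noteq> {}"
  proof -
    have "Complex 3 0 \<in> V" using \<delta> \<delta>' l by (simp add: regions)
    then show "V \<noteq> {}" by blast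
  qed (use x x' in \<open>auto simp: regions open_box\<close>)
  have K: "compact K" "K \<subseteq> \<Omega>" using x' \<delta>' by (auto simp: regions compact_cbox)
  (* With this eta the bound 4 eta^2 M^2 (2 + C S) of the mean square contribution of the
     large region is e / 2. *)
  define \<eta> where "\<eta> = sqrt (e / (8 * M ^ 2 * (2 + C * S)))"
  have pos: "8 * M ^ 2 * (2 + C * S) > 0" using M C(1) S0 by (intro mult_pos_pos add_pos_nonneg) auto
  have \<eta>: "\<eta> > 0" "\<eta> ^ 2 = e / (8 * M ^ 2 * (2 + C * S))" using e pos by (auto simp: \<eta>_def)
  obtain \<kappa> where \<kappa>: "\<kappa> > 0" "\<And>h B v z. h holomorphic_on \<Omega> \<Longrightarrow> (\<And>z. z \<in> \<Omega> \<Longrightarrow> cmod (h z) \<le> B) \<Longrightarrow>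
     (\<And>z. z \<in> V \<Longrightarrow> cmod (h z) \<le> v) \<Longrightarrow> z \<in> K \<Longrightarrow> cmod (h z) \<le> \<eta> * B + \<kappa> * v"
    by (rule two_constants_scaled[OF \<Omega> V K \<eta>(1)]) blast
  define \<epsilon> where "\<epsilon> = sqrt e / (2 * \<kappa>)"
  have \<epsilon>: "\<epsilon> > 0" "2 * (\<kappa> * \<epsilon>) ^ 2 = e / 2"
    using e \<kappa>(1) by (auto simp: \<epsilon>_def power_mult_distrib power_divide)
  obtain N0 where N0: "\<And>N s. N \<ge> N0 \<Longrightarrow> Re s \<ge> 2 \<Longrightarrow> cmod (h N s) \<le> \<epsilon>" using small[OF \<epsilon>(1)] by blast
  show ?thesis
  proof (intro exI[of _ N0] allI impI)
    fix N assume N: "N \<ge> N0"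
    obtain y :: "nat \<Rightarrow> real" where y: "\<And>n. y n \<ge> 0"
     "\<And>n s. n \<in> UNIV \<Longrightarrow> s \<in> block_rect l x' 4 \<delta>' n \<Longrightarrow> cmod (dirichlet_poly b N s) ^ 2 \<le> y n"
     "\<forall>\<^sub>F X in sequentially. (\<Sum>n=1..X. y n) \<le> (C * (\<Sum>m=1..N. cmod (b m) ^ 2 * real m powr (-2 * x0)) + 1) * real X"
      by (rule mean_sup_leE[OF C(2)[OF zero_less_one, of b N]]) blast
    define w where "w = (\<lambda>n. 4 * \<eta>^2 * M^2 * (1 + y n) + e / 2)"
    have w0: "w n \<ge> 0" for n using y(1)[of n] e by (simp add: w_def)
    have main: "cmod (h N s) ^ 2 \<le> w n" if n: "n \<in> J" and s: "s \<in> block_rect l x1 2 \<delta>1 n" for n s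
    proof -
      define T where "T = \<i> * of_real (real n * l)"
      have T: "Re T = 0" "Im T = real n * l" by (simp_all add: T_def)
      have in_strip: "z + T \<in> half_strip l x0 \<delta>0 n" if "z \<in> \<Omega>" for z
        using that x' \<delta>' by (auto simp: half_strip_def regions T algebra_simps)
      have "cmod ((\<lambda>z. h N (z + T)) (s - T)) \<le> \<eta> * (M * (1 + sqrt (y n))) + \<kappa> * \<epsilon>"
      proof (rule \<kappa>(2)[where h = "\<lambda>z. h N (z + T)" and z = "s - T"])
        have "(h N \<circ> (\<lambda>z. z + T)) holomorphic_on \<Omega>"
          by (rule holomorphic_on_compose_gen[OF _ hol[OF n]]) (use in_strip in \<open>auto intro!: holomorphic_intros\<close>)
        then show "(\<lambda>z. h N (z + T)) holomorphic_on \<Omega>" by (simp add: o_def)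
        show "cmod (h N (z + T)) \<le> M * (1 + sqrt (y n))" if z: "z \<in> \<Omega>" for z
        proof -
          have "cmod (dirichlet_poly b N (z + T)) ^ 2 \<le> y n"
            using z by (intro y(2)) (auto simp: T regions block_rect_def algebra_simps)
          then have "cmod (dirichlet_poly b N (z + T)) \<le> sqrt (y n)" by (rule real_le_rsqrt)
          then have "M * (1 + cmod (dirichlet_poly b N (z + T))) \<le> M * (1 + sqrt (y n))" using M by simp
          then show ?thesis using grow[OF n in_strip[OF z], of N] by linarith
        qed
        show "cmod (h N (z + T)) \<le> \<epsilon>" if "z \<in> V" for z
          using that by (intro N0[OF N]) (auto simp: T regions)
        show "s - T \<in> K" using s by (auto simp: regions T block_rect_def algebra_simps)
      qed
      then have le: "cmod (h N s) \<le> \<eta> * (M * (1 + sqrt (y n))) + \<kappa> * \<epsilon>" by simp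
      have two: "(p + q) ^ 2 \<le> 2 * p ^ 2 + 2 * q ^ 2" for p q :: real
        using zero_le_power2[of "p - q"] by (simp add: power2_eq_square algebra_simps)
      have "cmod (h N s) ^ 2 \<le> (\<eta> * (M * (1 + sqrt (y n))) + \<kappa> * \<epsilon>) ^ 2"
        using le by (intro power_mono) auto
      also have "\<dots> \<le> 2 * (\<eta> * (M * (1 + sqrt (y n)))) ^ 2 + 2 * (\<kappa> * \<epsilon>) ^ 2" by (rule two)
      also have "\<dots> \<le> 2 * (\<eta>^2 * M^2 * (2 * 1 ^ 2 + 2 * sqrt (y n) ^ 2)) + 2 * (\<kappa> * \<epsilon>) ^ 2"
        using mult_left_mono[OF two[of 1 "sqrt (y n)"], of "\<eta>^2 * M^2"] by (simp add: power_mult_distrib mult_ac)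
      also have "\<dots> = w n" using y(1)[of n] \<epsilon>(2) by (simp add: w_def algebra_simps)
      finally show ?thesis .
    qed
    have "\<forall>\<^sub>F X in sequentially. (\<Sum>n=1..X. w n) \<le> e * real X"
      using y(3)
    proof eventually_elim
      case (elim X)
      have "C * (\<Sum>m=1..N. cmod (b m) ^ 2 * real m powr (-2 * x0)) \<le> C * S"
        using S C(1) by (intro mult_left_mono) auto
      then have "(C * (\<Sum>m=1..N. cmod (b m) ^ 2 * real m powr (-2 * x0)) + 1) * real X \<le> (C * S + 1) * real X"
        by (intro mult_right_mono) auto
      then have yS: "(\<Sum>n=1..X. y n) \<le> (C * S + 1) * real X" using elim by linarith
      have "(\<Sum>n=1..X. w n) = 4 * \<eta>^2 * M^2 * (real X + (\<Sum>n=1..X. y n)) + e / 2 * real X"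
        by (simp add: w_def sum.distrib sum_distrib_left distrib_left)
      also have "\<dots> \<le> 4 * \<eta>^2 * M^2 * (real X + (C * S + 1) * real X) + e / 2 * real X"
        using yS by (intro add_right_mono mult_left_mono add_left_mono) auto
      also have "4 * \<eta>^2 * M^2 * (real X + (C * S + 1) * real X) = (\<eta>^2 * (8 * M^2 * (2 + C * S))) / 2 * real X"
        by (simp add: algebra_simps)
      also have "\<eta>^2 * (8 * M^2 * (2 + C * S)) = e"
        unfolding \<eta>(2) using pos
        by (simp only: times_divide_eq_left nonzero_mult_div_cancel_right[OF less_imp_neq[OF pos, symmetric]])
      finally show ?case by (simp add: algebra_simps)
    qed
    then show "mean_sup_le (block_rect l x1 2 \<delta>1) J (h N) e"
      by (intro mean_sup_leI[OF w0 main])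
  qed
qed

text \<open>
  The point is that one sequence \<open>D\<close> serves all \<open>J\<close>, however large the bound of \<open>g\<close> on the blocks in
  \<open>J\<close>: the exceptional set will be assembled from infinitely many \<open>J\<close>, whose bounds may tend to infinity.
  By \<open>mean_sup_vanishes\<close> some \<open>P\<^sub>N\<^sub>'\<close> with \<open>N' \<ge> N\<close> is close to \<open>g\<close>, where \<open>N'\<close> depends on \<open>J\<close>.  But
  \<open>P\<^sub>N\<^sub>' - P\<^sub>N\<close> is a Dirichlet polynomial, whose mean \<open>dirichlet_poly_mean_sup\<close> bounds by the tail of
  \<open>\<Sum>|b(n)|\<^sup>2 n\<^sup>-\<^sup>2\<^sup>\<sigma>\<close> from \<open>N\<close> on, for whatever \<open>N'\<close>.
\<close>

lemma dirichlet_poly_approximation: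
  assumes l: "l > 0" and x: "1/2 < x0" "x0 < x1" "x1 \<le> 2" and \<delta>: "\<delta>0 > 0"
    and g: "ramanujan_series g b"
  shows "\<exists>D. D \<longlonglongrightarrow> 0 \<and> (\<forall>N. D N > 0) \<and> (\<forall>J N. bdd_on_blocks l x0 \<delta>0 g J \<longrightarrow>
    mean_sup_le (block_rect l x1 2 0) J (\<lambda>s. g s - dirichlet_poly b N s) (D N))"
proof -
  let ?R = "block_rect l x1 2 0"
  have rb: "ramanujan_hypothesis b" using g by (simp add: ramanujan_series_def)
  have x00: "0 \<le> x0" using x by simp
  obtain C where C: "C > 0" "\<And>c N e. e > 0 \<Longrightarrow> mean_sup_le ?R UNIV (dirichlet_poly c N)
     (C * (\<Sum>m=1..N. cmod (c m) ^ 2 * real m powr (-2 * x0)) + e)"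
    using dirichlet_poly_mean_sup[OF l order_refl x00 x(2,3)] by blast
  define q where "q = (\<lambda>m. cmod (b m) ^ 2 * real m powr (-2 * x0))"
  have q0: "q m \<ge> 0" for m by (simp add: q_def)
  have qs: "q summable_on {1..}" unfolding q_def by (rule ramanujan_square_summable[OF rb x(1)])
  define S where "S = infsum q {1..}"
  define D where "D = (\<lambda>N. 2 * C * (S - (\<Sum>m=1..N. q m)) + 1 / real (N + 1))"
  have partial: "(\<Sum>m=1..N. q m) \<le> S" for N
    unfolding S_def by (rule finite_sum_le_infsum[OF qs]) (use q0 in auto)
  have Dpos: "D N > 0" for N
    unfolding D_def using partial[of N] C(1) by (intro add_nonneg_pos mult_nonneg_nonneg) auto
  have "(\<lambda>N. \<Sum>m=1..N. q m) \<longlonglongrightarrow> S"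
    unfolding S_def using qs by (intro has_sum_imp_partial_sums) simp
  then have "D \<longlonglongrightarrow> 2 * C * (S - S) + 0"
    unfolding D_def using LIMSEQ_ignore_initial_segment[OF lim_1_over_n[where 'a=real], of 1]
    by (intro tendsto_intros) auto
  then have Dlim: "D \<longlonglongrightarrow> 0" by simp
  have "mean_sup_le ?R J (\<lambda>s. g s - dirichlet_poly b N s) (D N)" if J: "bdd_on_blocks l x0 \<delta>0 g J" for J N
  proof -
    obtain M where M: "M > 0" "\<And>n. n \<in> J \<Longrightarrow> g holomorphic_on half_strip l x0 \<delta>0 n"
      "\<And>n s. n \<in> J \<Longrightarrow> s \<in> half_strip l x0 \<delta>0 n \<Longrightarrow> cmod (g s) \<le> M"
      by (rule bdd_on_blocksE[OF J]) blast
    define e where "e = 1 / (4 * real (N + 1))"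
    have e: "e > 0" by (simp add: e_def)
    have "\<exists>N0. \<forall>N\<ge>N0. mean_sup_le ?R J (\<lambda>s. g s - dirichlet_poly b N s) e"
    proof (rule mean_sup_vanishes[OF l x order_refl \<delta> rb, where M = "max M 1"])
      show "(\<lambda>s. g s - dirichlet_poly b N s) holomorphic_on half_strip l x0 \<delta>0 n" if "n \<in> J" for N n
        by (intro holomorphic_on_diff M(2)[OF that] holomorphic_on_subset[OF dirichlet_poly_holomorphic]) auto
      show "cmod (g s - dirichlet_poly b N s) \<le> max M 1 * (1 + cmod (dirichlet_poly b N s))"
        if "n \<in> J" "s \<in> half_strip l x0 \<delta>0 n" for N n s
      proof -
        have "cmod (g s - dirichlet_poly b N s) \<le> cmod (g s) + cmod (dirichlet_poly b N s)" by (rule norm_triangle_ineq4)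
        also have "\<dots> \<le> max M 1 + max M 1 * cmod (dirichlet_poly b N s)"
          using M(3)[OF that] mult_right_mono[of 1 "max M 1" "cmod (dirichlet_poly b N s)"] by simp
        finally show ?thesis by (simp add: distrib_left)
      qed
      show "\<exists>N0. \<forall>N\<ge>N0. \<forall>s. 2 \<le> Re s \<longrightarrow> cmod (g s - dirichlet_poly b N s) \<le> e" if "e > 0" for e
        by (rule ramanujan_series_tail[OF g that])
    qed (use e in auto)
    then obtain N1 where N1: "\<And>N. N \<ge> N1 \<Longrightarrow> mean_sup_le ?R J (\<lambda>s. g s - dirichlet_poly b N s) e" by blast
    define N' where "N' = max N N1"
    (* The polynomial with these coefficients is the difference of the partial sums at N' and N. *)
    define c where "c = (\<lambda>m. if m \<le> N then 0 else b m)"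
    have split: "{1..N'} = {1..N} \<union> {N<..N'}" by (auto simp: N'_def)
    have sum_split: "(\<Sum>m=1..N'. f m) = (\<Sum>m=1..N. f m) + (\<Sum>m\<in>{N<..N'}. f m)" for f :: "nat \<Rightarrow> 'z::comm_monoid_add"
      unfolding split by (rule sum.union_disjoint) auto
    have P: "dirichlet_poly b N' s = dirichlet_poly b N s + dirichlet_poly c N' s" for s
      unfolding dirichlet_poly_def sum_split by (simp add: c_def)
    have "(\<Sum>m=1..N'. cmod (c m) ^ 2 * real m powr (-2 * x0)) = (\<Sum>m=1..N'. q m) - (\<Sum>m=1..N. q m)"
      unfolding sum_split by (simp add: c_def q_def)
    then have csum: "(\<Sum>m=1..N'. cmod (c m) ^ 2 * real m powr (-2 * x0)) \<le> S - (\<Sum>m=1..N. q m)"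
      using partial[of N'] by simp
    have "mean_sup_le ?R J (dirichlet_poly c N') (C * (S - (\<Sum>m=1..N. q m)) + e)"
      by (rule mean_sup_le_mono[OF C(2)[OF e]]) (use csum C(1) in \<open>auto intro!: mult_left_mono\<close>)
    from mean_sup_le_add[OF N1[of N'] this]
    have "mean_sup_le ?R J (\<lambda>s. g s - dirichlet_poly b N s) (2 * e + 2 * (C * (S - (\<Sum>m=1..N. q m)) + e))"
      by (simp add: N'_def[symmetric] P) (simp add: N'_def)
    moreover have "2 * e + 2 * (C * (S - (\<Sum>m=1..N. q m)) + e) = D N"
    proof -
      have "4 * e = 1 / real (N + 1)" by (simp add: e_def field_simps)
      then show ?thesis unfolding D_def by (simp only: distrib_left mult.assoc)
    qed
    ultimately show ?thesis by simp
  qed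
  then show ?thesis using Dlim Dpos by blast
qed

text \<open>
  Let \<open>B\<^sub>N\<close> be the partial sums of the series of \<open>1/g\<close>.  The functions \<open>g B\<^sub>N - 1\<close> tend to \<open>0\<close> for
  \<open>Re s \<ge> 2\<close> and are \<open>O(1 + |B\<^sub>N|)\<close> on the blocks in \<open>J\<close>, so \<open>mean_sup_vanishes\<close> applies.  Where
  \<open>|g B\<^sub>N - 1| \<le> 1/2\<close>, \<open>g\<close> does not vanish and \<open>|1/g| \<le> 2 |B\<^sub>N|\<close>.  The blocks on which
  this may fail have a majorant greater than \<open>1/4\<close>, and Chebyshev's inequality bounds their number.
\<close>

lemma zero_free_blocks:
  assumes l: "l > 0" and x: "1/2 < x0" "x0 < x1" "x1 \<le> 2" and \<delta>: "0 \<le> \<delta>1" "\<delta>1 < \<delta>0"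
    and g: "ramanujan_series g a" and c: "ramanujan_series (\<lambda>s. inverse (g s)) c"
    and nz: "\<And>s. Re s > 1 \<Longrightarrow> g s \<noteq> 0" and J: "bdd_on_blocks l x0 \<delta>0 g J" and e: "e > 0"
  shows "\<exists>J'\<subseteq>J. (\<forall>\<^sub>F X in sequentially. real (card ({1..X} \<inter> (J - J'))) \<le> e * real X) \<and>
     (\<forall>n\<in>J'. \<forall>s\<in>half_strip l x1 \<delta>1 n. g s \<noteq> 0) \<and> bdd_on_blocks l x1 \<delta>1 (\<lambda>s. inverse (g s)) J'"
proof -
  obtain M where M: "M > 0" "\<And>n. n \<in> J \<Longrightarrow> g holomorphic_on half_strip l x0 \<delta>0 n"
    "\<And>n s. n \<in> J \<Longrightarrow> s \<in> half_strip l x0 \<delta>0 n \<Longrightarrow> cmod (g s) \<le> M"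
    by (rule bdd_on_blocksE[OF J]) blast
  have rc: "ramanujan_hypothesis c" using c by (simp add: ramanujan_series_def)
  obtain B where B: "B > 0" "\<And>s. Re s \<ge> 2 \<Longrightarrow> cmod (g s) \<le> B" by (rule ramanujan_series_bounded[OF g]) blast
  obtain B' where B': "B' > 0" "\<And>s. Re s \<ge> 2 \<Longrightarrow> cmod (inverse (g s)) \<le> B'" by (rule ramanujan_series_bounded[OF c]) blast
  have "\<exists>N0. \<forall>N\<ge>N0. mean_sup_le (block_rect l x1 2 \<delta>1) J (\<lambda>s. g s * dirichlet_poly c N s - 1) (e / 4)"
  proof (rule mean_sup_vanishes[OF l x \<delta> rc, where M = "max M 1"])
    show "(\<lambda>s. g s * dirichlet_poly c N s - 1) holomorphic_on half_strip l x0 \<delta>0 n" if "n \<in> J" for N n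
      by (intro holomorphic_on_diff holomorphic_on_mult holomorphic_on_const M(2)[OF that] holomorphic_on_subset[OF dirichlet_poly_holomorphic]) auto
    show "cmod (g s * dirichlet_poly c N s - 1) \<le> max M 1 * (1 + cmod (dirichlet_poly c N s))"
      if "n \<in> J" "s \<in> half_strip l x0 \<delta>0 n" for N n s
    proof -
      have "cmod (g s * dirichlet_poly c N s - 1) \<le> cmod (g s) * cmod (dirichlet_poly c N s) + 1"
        using norm_triangle_ineq4[of "g s * dirichlet_poly c N s" 1] by (simp add: norm_mult)
      also have "\<dots> \<le> max M 1 * cmod (dirichlet_poly c N s) + max M 1"
        using M(3)[OF that] by (intro add_mono mult_right_mono) auto
      finally show ?thesis by (simp add: distrib_left)
    qed
    show "\<exists>N0. \<forall>N\<ge>N0. \<forall>s. 2 \<le> Re s \<longrightarrow> cmod (g s * dirichlet_poly c N s - 1) \<le> \<epsilon>" if \<epsilon>: "\<epsilon> > 0" for \<epsilon>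
    proof -
      have "\<epsilon> / B > 0" using \<epsilon> B(1) by simp
      from ramanujan_series_tail[OF c this] obtain N0
        where N0: "\<And>N s. N \<ge> N0 \<Longrightarrow> Re s \<ge> 2 \<Longrightarrow> cmod (inverse (g s) - dirichlet_poly c N s) \<le> \<epsilon> / B" by blast
      have "cmod (g s * dirichlet_poly c N s - 1) \<le> \<epsilon>" if "N \<ge> N0" "Re s \<ge> 2" for N s
      proof -
        have "g s * dirichlet_poly c N s - 1 = - (g s * (inverse (g s) - dirichlet_poly c N s))"
          using nz[of s] that by (simp add: algebra_simps)
        then have "cmod (g s * dirichlet_poly c N s - 1) = cmod (g s) * cmod (inverse (g s) - dirichlet_poly c N s)"
          by (simp add: norm_mult)
        also have "\<dots> \<le> B * (\<epsilon> / B)" using B(1) by (intro mult_mono B(2) N0 that) auto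
        finally show ?thesis using B(1) by simp
      qed
      then show ?thesis by blast
    qed
  qed (use e in auto)
  then obtain N where "mean_sup_le (block_rect l x1 2 \<delta>1) J (\<lambda>s. g s * dirichlet_poly c N s - 1) (e / 4)" by blast
  then obtain y where y: "\<And>n. y n \<ge> 0"
    "\<And>n s. n \<in> J \<Longrightarrow> s \<in> block_rect l x1 2 \<delta>1 n \<Longrightarrow> cmod (g s * dirichlet_poly c N s - 1) ^ 2 \<le> y n"
    "\<forall>\<^sub>F X in sequentially. (\<Sum>n=1..X. y n) \<le> (e / 4) * real X" by (rule mean_sup_leE) blast
  define J' where "J' = {n\<in>J. y n \<le> 1 / 4}"
  define C where "C = (\<Sum>n=1..N. cmod (c n))"
  have key: "g s \<noteq> 0 \<and> cmod (inverse (g s)) \<le> max B' (2 * C)" if n: "n \<in> J'" and s: "s \<in> half_strip l x1 \<delta>1 n" for n s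
  proof (cases "Re s \<ge> 2")
    case True
    then show ?thesis using nz[of s] B'(2)[of s] by (auto simp: le_max_iff_disj)
  next
    case False
    have "cmod (g s * dirichlet_poly c N s - 1) ^ 2 \<le> y n"
      using n s False by (intro y(2)) (auto simp: J'_def half_strip_def block_rect_def)
    also have "\<dots> \<le> (1 / 2) ^ 2" using n by (simp add: J'_def power2_eq_square)
    finally have le: "cmod (g s * dirichlet_poly c N s - 1) \<le> 1 / 2" by (rule power2_le_imp_le) simp
    have gP: "cmod (g s) * cmod (dirichlet_poly c N s) \<ge> 1 / 2"
      using le norm_triangle_ineq2[of 1 "1 - g s * dirichlet_poly c N s"] by (simp add: norm_mult norm_minus_commute)
    then have g0: "g s \<noteq> 0" by auto
    have "cmod (inverse (g s)) \<le> 2 * cmod (dirichlet_poly c N s)"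
    proof -
      have "cmod (g s) > 0" using g0 by simp
      moreover have "1 \<le> 2 * cmod (dirichlet_poly c N s) * cmod (g s)" using gP by (simp add: mult_ac)
      ultimately show ?thesis by (simp only: norm_inverse) (simp only: inverse_eq_divide pos_divide_le_eq)
    qed
    also have "\<dots> \<le> 2 * C" unfolding C_def
      using s x by (intro mult_left_mono norm_dirichlet_poly_le) (auto simp: half_strip_def)
    finally show ?thesis using g0 by auto
  qed
  have "bdd_on_blocks l x1 \<delta>1 (\<lambda>s. inverse (g s)) J'"
    unfolding bdd_on_blocks_def
  proof (intro exI[of _ "max B' (2 * C)"] ballI conjI)
    fix n assume n: "n \<in> J'"
    have "g holomorphic_on half_strip l x1 \<delta>1 n"
      using M(2)[of n] n x \<delta> half_strip_mono[of x0 x1 \<delta>1 \<delta>0 l n] by (auto simp: J'_def intro: holomorphic_on_subset)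
    then show "(\<lambda>s. inverse (g s)) holomorphic_on half_strip l x1 \<delta>1 n"
      using key[OF n] by (intro holomorphic_on_inverse) auto
  qed (use key in auto)
  moreover have "\<forall>\<^sub>F X in sequentially. real (card ({1..X} \<inter> (J - J'))) \<le> e * real X"
    using y(3)
  proof eventually_elim
    case (elim X)
    have "real (card ({1..X} \<inter> (J - J'))) * (1 / 4) = (\<Sum>n\<in>{1..X} \<inter> (J - J'). 1 / 4)" by simp
    also have "\<dots> \<le> (\<Sum>n\<in>{1..X} \<inter> (J - J'). y n)" by (rule sum_mono) (auto simp: J'_def)
    also have "\<dots> \<le> (\<Sum>n=1..X. y n)" by (rule sum_mono2) (use y(1) in auto)
    finally show ?case using elim by simp
  qed
  moreover have "J' \<subseteq> J" by (auto simp: J'_def)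
  ultimately show ?thesis using key by blast
qed

text \<open>
  Cauchy's estimate, on discs that reach from the smaller half strip into the larger one.
\<close>

lemma bdd_on_blocks_deriv:
  assumes "bdd_on_blocks l x0 \<delta>0 g J" "x0 < x1" "\<delta>1 < \<delta>0"
  shows "bdd_on_blocks l x1 \<delta>1 (deriv g) J"
proof -
  obtain M where M: "M > 0" "\<And>n. n \<in> J \<Longrightarrow> g holomorphic_on half_strip l x0 \<delta>0 n"
    "\<And>n s. n \<in> J \<Longrightarrow> s \<in> half_strip l x0 \<delta>0 n \<Longrightarrow> cmod (g s) \<le> M"
    by (rule bdd_on_blocksE[OF assms(1)]) blast
  define r where "r = min (x1 - x0) (\<delta>0 - \<delta>1) / 2"
  have r: "r > 0" "r < x1 - x0" "r < \<delta>0 - \<delta>1" using assms by (auto simp: r_def min_def)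
  show ?thesis unfolding bdd_on_blocks_def
  proof (intro exI[of _ "M / r"] ballI conjI)
    fix n assume n: "n \<in> J"
    show "deriv g holomorphic_on half_strip l x1 \<delta>1 n"
      using holomorphic_deriv[OF M(2)[OF n] half_strip_open] half_strip_mono[of x0 x1 \<delta>1 \<delta>0 l n] assms
      by (auto intro: holomorphic_on_subset)
    fix s assume s: "s \<in> half_strip l x1 \<delta>1 n"
    have sub: "cball s r \<subseteq> half_strip l x0 \<delta>0 n"
    proof
      fix w assume "w \<in> cball s r"
      then have "cmod (s - w) \<le> r" by (simp add: dist_norm)
      then have "\<bar>Re (s - w)\<bar> \<le> r" "\<bar>Im (s - w)\<bar> \<le> r"
        using abs_Re_le_cmod[of "s - w"] abs_Im_le_cmod[of "s - w"] by linarith+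
      then show "w \<in> half_strip l x0 \<delta>0 n" using s r by (auto simp: half_strip_def)
    qed
    have "cmod ((deriv ^^ 1) g s) \<le> fact 1 * M / r ^ 1"
    proof (rule Cauchy_inequality)
      show "g holomorphic_on ball s r" "continuous_on (cball s r) g"
        using holomorphic_on_subset[OF M(2)[OF n]] sub ball_subset_cball[of s r]
        by (blast, blast intro: holomorphic_on_imp_continuous_on)
      show "cmod (g w) \<le> M" if "cmod (s - w) = r" for w
        using sub that by (intro M(3)[OF n]) (auto simp: dist_norm)
    qed (use r in auto)
    then show "cmod (deriv g s) \<le> M / r" by simp
  qed
qed

subsection \<open>Continuation to half strips\<close>

lemma continuation_value_half_strip:
  assumes F: "F holomorphic_on half_strip l x \<delta> n"
    and eq: "\<And>s. s \<in> half_strip l x \<delta> n \<Longrightarrow> Re s > 1 \<Longrightarrow> F s = f s" and s: "s \<in> half_strip l x \<delta> n"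
  shows "continuation_value f s (F s)"
proof -
  define r where "r = min (Re s - x) (min (Im s - (real n * l - \<delta>)) ((real n + 1) * l + \<delta> - Im s))"
  have r: "r > 0" using s by (auto simp: r_def half_strip_def)
  have sub: "right_strip s r \<subseteq> half_strip l x \<delta> n"
    by (auto simp: right_strip_def half_strip_def r_def)
  show ?thesis unfolding continuation_value_def
    using r holomorphic_on_subset[OF F sub] eq sub by blast
qed

lemma cont_half_strip:
  assumes F: "F holomorphic_on half_strip l x \<delta> n"
    and eq: "\<And>s. s \<in> half_strip l x \<delta> n \<Longrightarrow> Re s > 1 \<Longrightarrow> F s = f s"
  shows "s \<in> half_strip l x \<delta> n \<Longrightarrow> cont f s = F s" and "s \<in> half_strip l x \<delta> n \<Longrightarrow> continues_to f s"
    and "cont f holomorphic_on half_strip l x \<delta> n"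
proof -
  show c: "cont f s = F s" if "s \<in> half_strip l x \<delta> n" for s
    by (rule cont_eqI[OF continuation_value_half_strip[OF F eq that]])
  show "continues_to f s" if "s \<in> half_strip l x \<delta> n" for s
    unfolding continues_to_def using continuation_value_half_strip[OF F eq that] by blast
  show "cont f holomorphic_on half_strip l x \<delta> n"
    using F by (rule holomorphic_transform) (simp add: c)
qed

text \<open>
  A half strip is convex, hence carries a primitive of \<open>g'/g\<close>; normalized to agree with \<open>lg\<close> on
  the right, it is the continuation of \<open>lg\<close>.  It is bounded because \<open>lg\<close> is bounded for \<open>Re s \<ge> 2\<close> and
  the distance to that half-plane is at most \<open>2 - x\<close>.
\<close>

lemma cont_log_blocks:
  assumes l: "l > 0" and g: "bdd_on_blocks l x \<delta> g J" and q: "bdd_on_blocks l x \<delta> (\<lambda>s. deriv g s / g s) J"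
    and \<delta>: "\<delta> > 0" and x: "x < 2" and lg: "ramanujan_series lg b"
    and der: "\<And>s. Re s > 1 \<Longrightarrow> (lg has_field_derivative deriv g s / g s) (at s)"
  shows "bdd_on_blocks l x \<delta> (cont lg) J" "n \<in> J \<Longrightarrow> s \<in> half_strip l x \<delta> n \<Longrightarrow> continues_to lg s"
proof -
  obtain M where M: "M > 0" "\<And>n. n \<in> J \<Longrightarrow> (\<lambda>s. deriv g s / g s) holomorphic_on half_strip l x \<delta> n"
    "\<And>n s. n \<in> J \<Longrightarrow> s \<in> half_strip l x \<delta> n \<Longrightarrow> cmod (deriv g s / g s) \<le> M"
    by (rule bdd_on_blocksE[OF q]) blast
  obtain B where B: "B > 0" "\<And>s. Re s \<ge> 2 \<Longrightarrow> cmod (lg s) \<le> B" by (rule ramanujan_series_bounded[OF lg]) blast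
  have ext: "\<exists>F. F holomorphic_on half_strip l x \<delta> n \<and> (\<forall>s\<in>half_strip l x \<delta> n. Re s > 1 \<longrightarrow> F s = lg s) \<and>
      (\<forall>s\<in>half_strip l x \<delta> n. cmod (F s) \<le> B + M * (2 - x))" if n: "n \<in> J" for n
  proof -
    let ?H = "half_strip l x \<delta> n"
    obtain F0 where F0: "\<And>s. s \<in> ?H \<Longrightarrow> (F0 has_field_derivative deriv g s / g s) (at s)"
      using holomorphic_convex_primitive'[OF half_strip_convex half_strip_open M(2)[OF n]]
        half_strip_open by (metis at_within_open)
    let ?U = "?H \<inter> {s. Re s > 1}"
    have U: "convex ?U" by (intro convex_Int half_strip_convex convex_halfspace_Re_gt)
    have "\<exists>k. \<forall>s\<in>?U. F0 s - lg s = k"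
    proof (rule has_field_derivative_zero_constant[OF U])
      fix s assume s: "s \<in> ?U"
      have "((\<lambda>s. F0 s - lg s) has_field_derivative (deriv g s / g s - deriv g s / g s)) (at s)"
        using s by (intro DERIV_diff F0 der) auto
      then show "((\<lambda>s. F0 s - lg s) has_field_derivative 0) (at s within ?U)"
        by (auto intro: DERIV_subset)
    qed
    then obtain k where k: "\<And>s. s \<in> ?H \<Longrightarrow> Re s > 1 \<Longrightarrow> F0 s - lg s = k" by blast
    define F where "F = (\<lambda>s. F0 s - k)"
    have Fder: "(F has_field_derivative deriv g s / g s) (at s)" if "s \<in> ?H" for s
      unfolding F_def using DERIV_diff[OF F0[OF that] DERIV_const, of k] by simp
    have Feq: "F s = lg s" if "s \<in> ?H" "Re s > 1" for s using k[OF that] by (simp add: F_def algebra_simps)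
    have "cmod (F s) \<le> B + M * (2 - x)" if s: "s \<in> ?H" for s
    proof (cases "Re s \<ge> 2")
      case True
      then have "cmod (F s) \<le> B" using Feq[OF s] B(2)[of s] by simp
      also have "\<dots> \<le> B + M * (2 - x)" using M(1) x by simp
      finally show ?thesis .
    next
      case False
      define w where "w = Complex 2 (Im s)"
      have w: "w \<in> ?H" using s x by (auto simp: half_strip_def w_def)
      have "cmod (F s - F w) \<le> M * cmod (s - w)"
        by (rule field_differentiable_bound[OF half_strip_convex DERIV_subset[OF Fder]])
           (use M(3)[OF n] s w in auto)
      also have "cmod (s - w) = 2 - Re s" using False by (simp add: w_def cmod_def)
      also have "M * (2 - Re s) \<le> M * (2 - x)" using M(1) s by (auto simp: half_strip_def)
      finally have "cmod (F s - F w) \<le> M * (2 - x)" by simp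
      moreover have "cmod (F w) \<le> B" using Feq[OF w] B(2)[of w] by (simp add: w_def)
      ultimately show ?thesis using norm_triangle_ineq[of "F s - F w" "F w"] by simp
    qed
    moreover have "F holomorphic_on ?H" using Fder by (auto simp: holomorphic_on_open[OF half_strip_open])
    ultimately show ?thesis using Feq by blast
  qed
  show "bdd_on_blocks l x \<delta> (cont lg) J"
    unfolding bdd_on_blocks_def
  proof (intro exI[of _ "B + M * (2 - x)"] ballI)
    fix n assume "n \<in> J"
    from ext[OF this] obtain F where F: "F holomorphic_on half_strip l x \<delta> n"
      "\<And>s. s \<in> half_strip l x \<delta> n \<Longrightarrow> Re s > 1 \<Longrightarrow> F s = lg s"
      "\<And>s. s \<in> half_strip l x \<delta> n \<Longrightarrow> cmod (F s) \<le> B + M * (2 - x)" by blast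
    show "cont lg holomorphic_on half_strip l x \<delta> n \<and> (\<forall>s\<in>half_strip l x \<delta> n. cmod (cont lg s) \<le> B + M * (2 - x))"
      using cont_half_strip[OF F(1,2)] F(3) by auto
  qed
  show "continues_to lg s" if "n \<in> J" "s \<in> half_strip l x \<delta> n"
  proof -
    from ext[OF that(1)] obtain F where F: "F holomorphic_on half_strip l x \<delta> n"
      "\<And>s. s \<in> half_strip l x \<delta> n \<Longrightarrow> Re s > 1 \<Longrightarrow> F s = lg s" by blast
    show ?thesis by (rule cont_half_strip(2)[OF F that(2)])
  qed
qed

text \<open>
  Normality is used on a domain with an abscissa \<open>\<alpha>\<close> strictly between \<open>u\<close> and \<open>x0\<close>, of which
  \<open>x0 \<le> Re s \<le> 2\<close>, \<open>-\<delta> \<le> Im s \<le> l + \<delta>\<close> is a compact subset.  There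
  \<open>chordal_normal_family_bounded\<close> bounds the translates; to the right of it the series does.
\<close>

lemma class_N_bounded_blocks:
  assumes L: "class_N u L" "ramanujan_series L a" and x: "u < x0" "x0 \<le> 1" and l: "l > 0" and \<delta>: "0 < \<delta>" "\<delta> < l"
    and \<epsilon>: "\<epsilon> > 0"
  shows "\<exists>J\<subseteq>{1..}. lower_dens J > ereal (1 - \<epsilon>) \<and> bdd_on_blocks l x0 \<delta> (cont L) J \<and>
     (\<forall>n\<in>J. \<forall>s\<in>half_strip l x0 \<delta> n. continues_to L s)"
proof -
  define \<alpha> where "\<alpha> = (u + x0) / 2"
  have \<alpha>: "u < \<alpha>" "\<alpha> < x0" "\<alpha> \<le> 1" using x by (auto simp: \<alpha>_def)
  obtain J and G :: "nat \<Rightarrow> complex \<Rightarrow> complex" where J: "J \<subseteq> {1..}" "lower_dens J > ereal (1 - \<epsilon>)"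
    and G: "\<And>n. n \<in> J \<Longrightarrow> G n holomorphic_on Q_rect \<alpha> l"
     "\<And>n s. n \<in> J \<Longrightarrow> s \<in> Q_rect \<alpha> l \<Longrightarrow> Re s > 1 \<Longrightarrow> G n s = L (s + \<i> * of_real (real n * l))"
    and normal: "chordal_normal_family (Q_rect \<alpha> l) (G ` J)"
    using L(1)[unfolded class_N_def, THEN conjunct2, rule_format, of \<alpha> l \<epsilon>] \<alpha> l \<epsilon> by blast
  obtain B where B: "B > 0" "\<And>s. Re s \<ge> 2 \<Longrightarrow> cmod (L s) \<le> B" by (rule ramanujan_series_bounded[OF L(2)]) blast
  have Q_eq: "Q_rect \<alpha> l = {s. Re s > \<alpha>} \<inter> {s. Im s > - l} \<inter> {s. Im s < 2 * l}" by (auto simp: Q_rect_def)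
  have Q: "open (Q_rect \<alpha> l)" "connected (Q_rect \<alpha> l)" unfolding Q_eq
    by (intro open_Int open_halfspace_Re_gt open_halfspace_Im_gt open_halfspace_Im_lt
        convex_connected convex_Int convex_halfspace_Re_gt convex_halfspace_Im_gt convex_halfspace_Im_lt)+
  define V where "V = Q_rect \<alpha> l \<inter> {s. Re s > 2}"
  define K where "K = cbox (Complex x0 (-\<delta>)) (Complex 2 (l + \<delta>))"
  have "\<exists>M. \<forall>f\<in>G ` J. \<forall>z\<in>K. cmod (f z) \<le> M"
  proof (rule chordal_normal_family_bounded[OF Q _ normal, where V = V and B = B])
    show "f holomorphic_on Q_rect \<alpha> l" if "f \<in> G ` J" for f using that G(1) by auto
    show "open V" unfolding V_def using Q(1) by (intro open_Int open_halfspace_Re_gt)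
    have "Complex 3 0 \<in> V" using \<alpha> l by (auto simp: V_def Q_rect_def)
    then show "V \<noteq> {}" by blast
    show "V \<subseteq> Q_rect \<alpha> l" by (auto simp: V_def)
    show "cmod (f z) \<le> B" if "f \<in> G ` J" "z \<in> V" for f z
      using that G(2) by (auto simp: V_def intro!: B(2))
    show "compact K" unfolding K_def by (rule compact_cbox)
    show "K \<subseteq> Q_rect \<alpha> l" using \<alpha> \<delta> l by (auto simp: K_def Q_rect_def in_cbox_complex_iff)
  qed
  then obtain M where M: "\<And>n z. n \<in> J \<Longrightarrow> z \<in> K \<Longrightarrow> cmod (G n z) \<le> M" by blast
  have ext: "\<exists>F. F holomorphic_on half_strip l x0 \<delta> n \<and> (\<forall>s\<in>half_strip l x0 \<delta> n. Re s > 1 \<longrightarrow> F s = L s) \<and>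
      (\<forall>s\<in>half_strip l x0 \<delta> n. cmod (F s) \<le> max M B)" if n: "n \<in> J" for n
  proof -
    define T where "T = \<i> * complex_of_real (real n * l)"
    have T: "Re T = 0" "Im T = real n * l" by (simp_all add: T_def)
    define F where "F = (\<lambda>s. G n (s - T))"
    have inQ: "s - T \<in> Q_rect \<alpha> l" if "s \<in> half_strip l x0 \<delta> n" for s
      using that \<alpha> \<delta> by (auto simp: half_strip_def Q_rect_def T algebra_simps)
    have "(G n \<circ> (\<lambda>s. s - T)) holomorphic_on half_strip l x0 \<delta> n"
      by (rule holomorphic_on_compose_gen[OF _ G(1)[OF n]]) (use inQ in \<open>auto intro!: holomorphic_intros\<close>)
    then have "F holomorphic_on half_strip l x0 \<delta> n" by (simp add: F_def o_def)
    moreover have eq: "F s = L s" if "s \<in> half_strip l x0 \<delta> n" "Re s > 1" for s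
      using G(2)[OF n inQ[OF that(1)]] that(2) T(1) unfolding F_def by (simp add: T_def)
    moreover have "cmod (F s) \<le> max M B" if s: "s \<in> half_strip l x0 \<delta> n" for s
    proof (cases "Re s \<ge> 2")
      case True
      then show ?thesis using eq[OF s] B(2)[of s] by auto
    next
      case False
      then have "s - T \<in> K" using s by (auto simp: K_def in_cbox_complex_iff half_strip_def T algebra_simps)
      then show ?thesis using M[OF n] by (auto simp: F_def le_max_iff_disj)
    qed
    ultimately show ?thesis by blast
  qed
  have "bdd_on_blocks l x0 \<delta> (cont L) J"
    unfolding bdd_on_blocks_def
  proof (intro exI[of _ "max M B"] ballI)
    fix n assume "n \<in> J"
    from ext[OF this] obtain F where F: "F holomorphic_on half_strip l x0 \<delta> n"
      "\<And>s. s \<in> half_strip l x0 \<delta> n \<Longrightarrow> Re s > 1 \<Longrightarrow> F s = L s"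
      "\<And>s. s \<in> half_strip l x0 \<delta> n \<Longrightarrow> cmod (F s) \<le> max M B" by blast
    show "cont L holomorphic_on half_strip l x0 \<delta> n \<and> (\<forall>s\<in>half_strip l x0 \<delta> n. cmod (cont L s) \<le> max M B)"
      using cont_half_strip[OF F(1,2)] F(3) by auto
  qed
  moreover have "continues_to L s" if "n \<in> J" "s \<in> half_strip l x0 \<delta> n" for n s
  proof -
    from ext[OF that(1)] obtain F where F: "F holomorphic_on half_strip l x0 \<delta> n"
      "\<And>s. s \<in> half_strip l x0 \<delta> n \<Longrightarrow> Re s > 1 \<Longrightarrow> F s = L s" by blast
    show ?thesis by (rule cont_half_strip(2)[OF F that(2)])
  qed
  ultimately show ?thesis using J by blast
qed

section \<open>Choosing the exceptional set\<close>

text \<open>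
  The bounds at stage \<open>j\<close> hold only from some point on, which depends on \<open>j\<close> and on the quantity \<open>q\<close>.
  The stage \<open>\<phi> n\<close> moves on to \<open>j\<close> only at a time \<open>T j\<close> past the thresholds of all
  \<open>q \<le> j\<close>; each \<open>q\<close> is thus under control from stage \<open>q\<close> on.  As the \<open>T j\<close> at least double, the
  contributions of the past stages form a geometric series, bounded by \<open>2 D T\<^sub>j\<close>.  The
  present stage contributes \<open>D X\<close>, and another \<open>D X\<close> pays for the finitely many \<open>n\<close> before stage \<open>max i q\<close>.
\<close>

lemma diagonal_choice:
  fixes y :: "nat \<Rightarrow> nat \<Rightarrow> nat \<Rightarrow> real"
  assumes y0: "\<And>j q n. y j q n \<ge> 0"
    and ev: "\<And>j q. \<forall>\<^sub>F X in sequentially. (\<Sum>n=1..X. y j q n) \<le> d j q * real X"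
  shows "\<exists>\<phi>. \<forall>q D i. D > 0 \<and> (\<forall>j\<ge>i. d j q \<le> D) \<longrightarrow>
     (\<forall>\<^sub>F X in sequentially. (\<Sum>n=1..X. y (\<phi> n) q n) \<le> 4 * D * real X)"
proof -
  have "\<exists>T. \<forall>X\<ge>T. \<forall>q\<le>j. (\<Sum>n=1..X. y j q n) \<le> d j q * real X" for j
  proof -
    have "\<forall>\<^sub>F X in sequentially. \<forall>q\<in>{..j}. (\<Sum>n=1..X. y j q n) \<le> d j q * real X"
      using ev by (intro eventually_ball_finite) auto
    then show ?thesis unfolding eventually_sequentially by auto
  qed
  then obtain T0 where T0: "\<And>j X q. X \<ge> T0 j \<Longrightarrow> q \<le> j \<Longrightarrow> (\<Sum>n=1..X. y j q n) \<le> d j q * real X" by metis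
  define T where "T = (\<lambda>j. ((\<Sum>i\<le>j. T0 i) + 1) * 2 ^ j)"
  have T_T0: "T0 j \<le> T j" for j
  proof -
    have "T0 j \<le> (\<Sum>i\<le>j. T0 i) + 1" using member_le_sum[of j "{..j}" T0] by simp
    also have "\<dots> \<le> T j" unfolding T_def using mult_le_mono2[of 1 "2 ^ j" "(\<Sum>i\<le>j. T0 i) + 1"] by simp
    finally show ?thesis .
  qed
  have T_Suc: "2 * T j \<le> T (Suc j)" for j by (simp add: T_def)
  have T_pos: "T j > 0" for j by (simp add: T_def)
  have T_mono: "i \<le> j \<Longrightarrow> T i \<le> T j" for i j
    by (rule lift_Suc_mono_le[of T]) (use T_Suc in \<open>auto intro: order_trans[OF _ T_Suc]\<close>)
  have T_large: "n < T (Suc n)" for n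
  proof -
    have "n < 2 ^ n" by (rule less_exp)
    also have "(2::nat) ^ n \<le> 2 ^ Suc n" by simp
    also have "\<dots> \<le> T (Suc n)" by (simp add: T_def)
    finally show ?thesis .
  qed
  define \<phi> where "\<phi> = (\<lambda>n. LEAST j. n < T (Suc j))"
  have \<phi>1: "n < T (Suc (\<phi> n))" for n unfolding \<phi>_def by (rule LeastI[of _ n]) (rule T_large)
  have \<phi>_eq: "\<phi> n = j" if "T j \<le> n" "n < T (Suc j)" for n j
    unfolding \<phi>_def
  proof (rule Least_equality)
    fix i assume "n < T (Suc i)"
    show "j \<le> i"
    proof (rule ccontr)
      assume "\<not> j \<le> i"
      then have "T (Suc i) \<le> T j" by (intro T_mono) simp
      then show False using \<open>n < T (Suc i)\<close> that by simp
    qed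
  qed (rule that)
  have "\<forall>\<^sub>F X in sequentially. (\<Sum>n=1..X. y (\<phi> n) q n) \<le> 4 * D * real X"
    if D: "D > 0" and dD: "\<And>j. j \<ge> i \<Longrightarrow> d j q \<le> D" for q D i
  proof -
    define m where "m = max i q"
    define K where "K = (\<Sum>n\<in>{1..<T m}. y (\<phi> n) q n)"
    have stage: "(\<Sum>n\<in>{T j..X}. y (\<phi> n) q n) \<le> D * real X" if j: "j \<ge> m" and X: "T j \<le> X" "X < T (Suc j)" for j X
    proof -
      have "(\<Sum>n\<in>{T j..X}. y (\<phi> n) q n) = (\<Sum>n\<in>{T j..X}. y j q n)"
        by (rule sum.cong) (use X \<phi>_eq in auto)
      also have "\<dots> \<le> (\<Sum>n=1..X. y j q n)"
        using T_pos[of j] y0 by (intro sum_mono2) (auto simp: Suc_le_eq)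
      also have "\<dots> \<le> d j q * real X"
        using j X T_T0[of j] by (intro T0) (auto simp: m_def)
      also have "\<dots> \<le> D * real X" using dD[of j] j by (intro mult_right_mono) (auto simp: m_def)
      finally show ?thesis .
    qed
    have past: "(\<Sum>n\<in>{1..<T j}. y (\<phi> n) q n) \<le> K + 2 * D * real (T j)" if "j \<ge> m" for j
      using that
    proof (induction j rule: dec_induct)
      case base
      then show ?case using D by (simp add: K_def)
    next
      case (step j)
      have lt: "T j < T (Suc j)" using T_Suc[of j] T_pos[of j] by linarith
      have "{1..<T (Suc j)} = {1..<T j} \<union> {T j..T (Suc j) - 1}" using lt T_pos[of j] by auto
      then have "(\<Sum>n\<in>{1..<T (Suc j)}. y (\<phi> n) q n) = (\<Sum>n\<in>{1..<T j}. y (\<phi> n) q n) + (\<Sum>n\<in>{T j..T (Suc j) - 1}. y (\<phi> n) q n)"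
        by (simp only:) (rule sum.union_disjoint, auto)
      also have "\<dots> \<le> (K + 2 * D * real (T j)) + D * real (T (Suc j) - 1)"
        using step lt by (intro add_mono stage) auto
      also have "\<dots> \<le> K + 2 * D * real (T (Suc j))"
      proof -
        have "real (2 * T j) \<le> real (T (Suc j))" using T_Suc[of j] by (simp only: of_nat_le_iff)
        then have "D * (2 * real (T j)) \<le> D * real (T (Suc j))" using D by (intro mult_left_mono) auto
        moreover have "D * real (T (Suc j) - 1) \<le> D * real (T (Suc j))" using D by (intro mult_left_mono) auto
        ultimately show ?thesis by linarith
      qed
      finally show ?case .
    qed
    have "\<forall>\<^sub>F X in sequentially. real X \<ge> K / D"
      using filterlim_real_sequentially by (simp add: filterlim_at_top)
    moreover have "\<forall>\<^sub>F X in sequentially. X \<ge> T m" by (rule eventually_ge_at_top)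
    ultimately show ?thesis
    proof eventually_elim
      case (elim X)
      define j where "j = \<phi> X"
      have jm: "j \<ge> m"
      proof (rule ccontr)
        assume "\<not> j \<ge> m"
        then have "T (Suc j) \<le> T m" by (intro T_mono) simp
        then show False using \<phi>1[of X] elim by (simp add: j_def)
      qed
      have Tj: "T j \<le> X"
      proof (cases j)
        case 0
        then show ?thesis using elim T_mono[of 0 m] by simp
      next
        case (Suc i)
        then have "\<not> X < T (Suc i)" unfolding j_def \<phi>_def by (intro not_less_Least) simp
        then show ?thesis using Suc by simp
      qed
      have Xj: "X < T (Suc j)" using \<phi>1[of X] by (simp add: j_def)
      have "{1..X} = {1..<T j} \<union> {T j..X}" using Tj T_pos[of j] by auto
      then have "(\<Sum>n=1..X. y (\<phi> n) q n) = (\<Sum>n\<in>{1..<T j}. y (\<phi> n) q n) + (\<Sum>n\<in>{T j..X}. y (\<phi> n) q n)"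
        by (simp only:) (rule sum.union_disjoint, auto)
      also have "\<dots> \<le> (K + 2 * D * real (T j)) + D * real X"
        by (intro add_mono past stage jm Tj Xj)
      also have "\<dots> \<le> 4 * D * real X"
      proof -
        have "D * real (T j) \<le> D * real X" using D Tj by (intro mult_left_mono) auto
        moreover have "K \<le> D * real X" using elim(1) D by (simp add: field_simps)
        ultimately show ?thesis by linarith
      qed
      finally show ?case .
    qed
  qed
  then show ?thesis by blast
qed

section \<open>Mean values off the exceptional set\<close>

lemma block_index:
  assumes "l > 0" "t \<ge> 0"
  shows "real n * l \<le> t \<and> t < (real n + 1) * l \<longleftrightarrow> n = nat \<lfloor>t / l\<rfloor>"
proof -
  have fl: "\<lfloor>t / l\<rfloor> \<ge> 0" using assms by simp
  have "real n * l \<le> t \<and> t < (real n + 1) * l \<longleftrightarrow> real n \<le> t / l \<and> t / l < real n + 1"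
    using assms by (simp add: pos_le_divide_eq pos_divide_less_eq)
  also have "\<dots> \<longleftrightarrow> \<lfloor>t / l\<rfloor> = int n" by (auto simp: floor_eq_iff)
  also have "\<dots> \<longleftrightarrow> n = nat \<lfloor>t / l\<rfloor>" using fl by auto
  finally show ?thesis .
qed

definition exceptional_set :: "real \<Rightarrow> nat set \<Rightarrow> real set" where
  "exceptional_set l Gd = {1..} \<inter> (\<Union>n\<in>-Gd. {real n * l..<(real n + 1) * l})"

lemma exceptional_set_iff:
  assumes "l > 0" "t \<ge> 1"
  shows "t \<in> exceptional_set l Gd \<longleftrightarrow> nat \<lfloor>t / l\<rfloor> \<notin> Gd"
  using block_index[OF assms(1), of t] assms(2) by (auto simp: exceptional_set_def)

lemma step_function_integral:
  fixes w :: "nat \<Rightarrow> real"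
  assumes l: "l > 0" and w: "\<And>n. w n \<ge> 0"
  shows "set_integrable lborel {1..T} (\<lambda>t. w (nat \<lfloor>t / l\<rfloor>))"
    and "(LINT t:{1..T}|lborel. w (nat \<lfloor>t / l\<rfloor>)) \<le> l * (\<Sum>n=0..nat \<lfloor>T / l\<rfloor>. w n)"
proof -
  define B where "B = (\<lambda>n. {1..T} \<inter> {real n * l..<(real n + 1) * l})"
  have fin: "emeasure lborel (B n) < \<infinity>" and ms: "B n \<in> sets lborel" for n
  proof -
    show "B n \<in> sets lborel" by (simp add: B_def)
    have "emeasure lborel (B n) \<le> emeasure lborel {1..T}" by (rule emeasure_mono) (auto simp: B_def)
    also have "\<dots> < \<infinity>" by (cases "1 \<le> T") auto
    finally show "emeasure lborel (B n) < \<infinity>" .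
  qed
  have meas: "measure lborel (B n) \<le> l" for n
  proof -
    have "measure lborel (B n) \<le> measure lborel {real n * l..<(real n + 1) * l}"
    proof (rule measure_mono_fmeasurable)
      have "real n * l \<le> (real n + 1) * l" using l by simp
      then show "{real n * l..<(real n + 1) * l} \<in> fmeasurable lborel" by (intro fmeasurableI) auto
    qed (auto simp: B_def)
    also have "\<dots> = l" using l by (simp add: algebra_simps)
    finally show ?thesis .
  qed
  have eq: "indicator {1..T} t *\<^sub>R w (nat \<lfloor>t / l\<rfloor>) = (\<Sum>n=0..nat \<lfloor>T / l\<rfloor>. w n * indicat_real (B n) t)" for t
  proof (cases "t \<in> {1..T}")
    case True
    then have t: "t \<ge> 0" by simp
    have ind: "indicat_real (B n) t = (if n = nat \<lfloor>t / l\<rfloor> then 1 else 0)" for n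
      using block_index[OF l t, of n] True by (auto simp: B_def)
    have "nat \<lfloor>t / l\<rfloor> \<le> nat \<lfloor>T / l\<rfloor>" using True l by (intro nat_mono floor_mono divide_right_mono) auto
    then have "(\<Sum>n=0..nat \<lfloor>T / l\<rfloor>. if n = nat \<lfloor>t / l\<rfloor> then w n else 0) = w (nat \<lfloor>t / l\<rfloor>)"
      by (subst sum.delta) auto
    moreover have "(\<Sum>n=0..nat \<lfloor>T / l\<rfloor>. w n * indicat_real (B n) t) = (\<Sum>n=0..nat \<lfloor>T / l\<rfloor>. if n = nat \<lfloor>t / l\<rfloor> then w n else 0)"
      unfolding ind by (intro sum.cong) auto
    ultimately show ?thesis using True by simp
  next
    case False
    then have "indicat_real (B n) t = 0" for n by (auto simp: B_def indicator_def)
    with False show ?thesis by simp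
  qed
  have int: "integrable lborel (\<lambda>t. w n * indicat_real (B n) t)" for n
    using fin ms by (intro integrable_mult_right integrable_real_indicator)
  show "set_integrable lborel {1..T} (\<lambda>t. w (nat \<lfloor>t / l\<rfloor>))"
    unfolding set_integrable_def eq by (intro Bochner_Integration.integrable_sum int)
  have "(LINT t:{1..T}|lborel. w (nat \<lfloor>t / l\<rfloor>)) = (\<Sum>n=0..nat \<lfloor>T / l\<rfloor>. w n * measure lborel (B n))"
    unfolding set_lebesgue_integral_def eq
    by (subst Bochner_Integration.integral_sum) (use int ms in auto)
  also have "\<dots> \<le> (\<Sum>n=0..nat \<lfloor>T / l\<rfloor>. w n * l)" by (intro sum_mono mult_left_mono meas w)
  finally show "(LINT t:{1..T}|lborel. w (nat \<lfloor>t / l\<rfloor>)) \<le> l * (\<Sum>n=0..nat \<lfloor>T / l\<rfloor>. w n)"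
    by (simp add: sum_distrib_left mult.commute)
qed

lemma set_integrable_off_exceptional:
  fixes f :: "real \<Rightarrow> 'a :: {banach, second_countable_topology}"
  assumes l: "l > 0" and f: "\<And>n. n \<in> Gd \<Longrightarrow> continuous_on {real n * l..(real n + 1) * l} f"
  shows "set_integrable lborel {1..T} (\<lambda>t. indicat_real (- exceptional_set l Gd) t *\<^sub>R f t)"
proof -
  define B where "B = (\<lambda>n. {1..T} \<inter> {real n * l..<(real n + 1) * l})"
  have eq: "indicator {1..T} t *\<^sub>R (indicat_real (- exceptional_set l Gd) t *\<^sub>R f t) =
      (\<Sum>n\<in>{0..nat \<lfloor>T / l\<rfloor>} \<inter> Gd. indicator (B n) t *\<^sub>R f t)" for t
  proof (cases "t \<in> {1..T}")
    case True
    then have t: "t \<ge> 0" by simp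
    have ind: "indicat_real (B n) t *\<^sub>R f t = (if n = nat \<lfloor>t / l\<rfloor> then f t else 0)" for n
      using block_index[OF l t, of n] True by (auto simp: B_def)
    have "nat \<lfloor>t / l\<rfloor> \<le> nat \<lfloor>T / l\<rfloor>" using True l by (intro nat_mono floor_mono divide_right_mono) auto
    then have "(\<Sum>n\<in>{0..nat \<lfloor>T / l\<rfloor>} \<inter> Gd. indicator (B n) t *\<^sub>R f t) = (if nat \<lfloor>t / l\<rfloor> \<in> Gd then f t else 0)"
      unfolding ind by (subst sum.delta) auto
    then show ?thesis using True exceptional_set_iff[OF l, of t Gd] by (auto simp: indicator_def)
  next
    case False
    then have "indicat_real (B n) t = 0" for n by (auto simp: B_def indicator_def)
    with False show ?thesis by simp
  qed
  have "integrable lborel (\<lambda>t. indicator (B n) t *\<^sub>R f t)" if "n \<in> Gd" for n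
  proof -
    have "set_integrable lborel {real n * l..(real n + 1) * l} f"
      by (rule borel_integrable_atLeastAtMost'[OF f[OF that]])
    then have "set_integrable lborel (B n) f"
      by (rule set_integrable_subset) (auto simp: B_def)
    then show ?thesis by (simp add: set_integrable_def)
  qed
  then show ?thesis
    unfolding set_integrable_def eq by (intro Bochner_Integration.integrable_sum) auto
qed

text \<open>
  Off the exceptional set \<open>f\<close> is compared with \<open>F\<close>; on the exceptional set \<open>0\<close> is compared with \<open>F\<close>,
  which costs at most \<open>c2 l\<close> for each bad block.  The summand \<open>1\<close> in the last term is block \<open>0\<close>.
\<close>

lemma block_comparison:
  fixes f F :: "real \<Rightarrow> 'a :: {banach, second_countable_topology}"
  assumes l: "l > 0" and Gd: "0 \<notin> Gd" and f: "\<And>n. n \<in> Gd \<Longrightarrow> continuous_on {real n * l..(real n + 1) * l} f"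
    and F: "continuous_on {1..T} F" and c0: "continuous_on {1..T} c0" "\<And>t. c0 t \<ge> 0"
    and y: "\<And>n. y n \<ge> 0" and c: "c1 \<ge> 0" "c2 \<ge> 0"
    and good: "\<And>n t. n \<in> Gd \<Longrightarrow> real n * l \<le> t \<Longrightarrow> t \<le> (real n + 1) * l \<Longrightarrow> norm (f t - F t) \<le> c0 t + c1 * y n"
    and bad: "\<And>t. norm (F t) \<le> c2"
  shows "norm ((LINT t:{1..T}|lborel. indicat_real (- exceptional_set l Gd) t *\<^sub>R f t) - (LINT t:{1..T}|lborel. F t))
    \<le> (LINT t:{1..T}|lborel. c0 t) + c1 * l * (\<Sum>n=1..nat \<lfloor>T / l\<rfloor>. y n)
       + c2 * l * (1 + real (card (- Gd \<inter> {1..nat \<lfloor>T / l\<rfloor>})))"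
proof -
  let ?A = "exceptional_set l Gd" and ?X = "nat \<lfloor>T / l\<rfloor>"
  define w where "w = (\<lambda>n. if n \<in> Gd then c1 * y n else c2)"
  have w0: "w n \<ge> 0" for n using y c by (simp add: w_def)
  have i1: "set_integrable lborel {1..T} (\<lambda>t. indicat_real (- ?A) t *\<^sub>R f t)"
    by (rule set_integrable_off_exceptional[OF l f])
  have i2: "set_integrable lborel {1..T} F" by (rule borel_integrable_atLeastAtMost'[OF F])
  have i3: "set_integrable lborel {1..T} c0" by (rule borel_integrable_atLeastAtMost'[OF c0(1)])
  note i4 = step_function_integral(1)[OF l w0, of T]
  have pt: "norm (indicat_real (- ?A) t *\<^sub>R f t - F t) \<le> c0 t + w (nat \<lfloor>t / l\<rfloor>)" if t: "t \<in> {1..T}" for t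
  proof (cases "nat \<lfloor>t / l\<rfloor> \<in> Gd")
    case True
    have "real (nat \<lfloor>t / l\<rfloor>) * l \<le> t \<and> t < (real (nat \<lfloor>t / l\<rfloor>) + 1) * l"
      using block_index[OF l, of t "nat \<lfloor>t / l\<rfloor>"] t by simp
    then have "norm (f t - F t) \<le> c0 t + c1 * y (nat \<lfloor>t / l\<rfloor>)" by (intro good[OF True]) auto
    then show ?thesis using True exceptional_set_iff[OF l, of t Gd] t by (simp add: w_def)
  next
    case False
    then show ?thesis using bad[of t] c0(2)[of t] exceptional_set_iff[OF l, of t Gd] t by (simp add: w_def)
  qed
  have "norm ((LINT t:{1..T}|lborel. indicat_real (- ?A) t *\<^sub>R f t) - (LINT t:{1..T}|lborel. F t)) =
     norm (LINT t:{1..T}|lborel. indicat_real (- ?A) t *\<^sub>R f t - F t)"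
    by (simp only: set_integral_diff(2)[OF i1 i2])
  also have "\<dots> \<le> (LINT t:{1..T}|lborel. norm (indicat_real (- ?A) t *\<^sub>R f t - F t))"
    by (rule set_integral_norm_bound[OF set_integral_diff(1)[OF i1 i2]])
  also have "\<dots> \<le> (LINT t:{1..T}|lborel. c0 t + w (nat \<lfloor>t / l\<rfloor>))"
    by (rule set_integral_mono[OF set_integrable_norm[OF set_integral_diff(1)[OF i1 i2]] set_integral_add(1)[OF i3 i4] pt])
  also have "\<dots> = (LINT t:{1..T}|lborel. c0 t) + (LINT t:{1..T}|lborel. w (nat \<lfloor>t / l\<rfloor>))"
    by (rule set_integral_add(2)[OF i3 i4])
  also have "\<dots> \<le> (LINT t:{1..T}|lborel. c0 t) + l * (\<Sum>n=0..?X. w n)"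
    by (intro add_left_mono step_function_integral(2)[OF l w0])
  also have "(\<Sum>n=0..?X. w n) = c2 + (\<Sum>n=1..?X. w n)"
    using Gd by (simp add: sum.atLeast_Suc_atMost w_def)
  also have "(\<Sum>n=1..?X. w n) \<le> (\<Sum>n=1..?X. c1 * y n + c2 * (if n \<in> - Gd then 1 else 0))"
    using y c by (intro sum_mono) (auto simp: w_def)
  also have "\<dots> = c1 * (\<Sum>n=1..?X. y n) + c2 * real (card (- Gd \<inter> {1..?X}))"
    by (simp add: sum.distrib sum_distrib_left[symmetric] sum.If_cases Int_commute Compl_eq)
  finally show ?thesis using l by (simp add: algebra_simps)
qed

text \<open>
  The error \<open>|f - F|\<close> is split in two: a part \<open>c1 y n\<close> constant on blocks, whose mean is
  controlled by sums over \<open>n\<close>, and a part \<open>c0\<close> given pointwise, whose mean is an integral.  For the mean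
  of \<open>|g|\<^sup>2\<close> the latter is a small multiple of \<open>|P\<^sub>N|\<^sup>2\<close>, for the mean of \<open>g\<close> it is a constant.
  None of \<open>c1\<close>, \<open>c2\<close>, \<open>y\<close> depends on \<open>\<sigma>\<close>, which gives uniformity.
\<close>

lemma uniform_limit_mean_offI:
  fixes f :: "complex \<Rightarrow> 'a :: {banach, second_countable_topology}" and m :: "real \<Rightarrow> 'a"
  assumes l: "l > 0" and Gd: "0 \<notin> Gd" and dens: "has_dens (- Gd) 0"
    and cont: "\<And>n \<sigma>. n \<in> Gd \<Longrightarrow> \<sigma> \<in> \<Sigma> \<Longrightarrow> continuous_on {real n * l..(real n + 1) * l} (\<lambda>t. f (Complex \<sigma> t))"
    and approx: "\<And>e. e > 0 \<Longrightarrow> \<exists>F c0 c1 c2 y. c1 \<ge> 0 \<and> c2 \<ge> 0 \<and> (\<forall>n. y n \<ge> 0) \<and>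
      (\<forall>\<sigma>\<in>\<Sigma>. continuous_on UNIV (F \<sigma>) \<and> continuous_on UNIV (c0 \<sigma>) \<and> (\<forall>t. 0 \<le> c0 \<sigma> t \<and> norm (F \<sigma> t) \<le> c2) \<and>
         (\<forall>n\<in>Gd. \<forall>t\<in>{real n * l..(real n + 1) * l}. norm (f (Complex \<sigma> t) - F \<sigma> t) \<le> c0 \<sigma> t + c1 * y n)) \<and>
      (\<forall>\<^sub>F X in sequentially. c1 * (\<Sum>n=1..X. y n) \<le> e * real X) \<and>
      (\<forall>\<^sub>F T in at_top. \<forall>\<sigma>\<in>\<Sigma>. (LINT t:{1..T}|lborel. c0 \<sigma> t) \<le> e * T \<and>
         norm ((LINT t:{1..T}|lborel. F \<sigma> t) - T *\<^sub>R m \<sigma>) \<le> e * T)"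
  shows "uniform_limit \<Sigma> (mean_off (exceptional_set l Gd) f) m at_top"
  unfolding uniform_limit_iff
proof (intro allI impI)
  fix e :: real assume e: "e > 0"
  let ?A = "exceptional_set l Gd"
  (* Five error terms: c0, y, block 0, the other bad blocks, and the mean of F. *)
  define e' where "e' = e / 6"
  have e': "e' > 0" using e by (simp add: e'_def)
  obtain F c0 c1 c2 and y :: "nat \<Rightarrow> real" where c: "c1 \<ge> 0" "c2 \<ge> 0" and y: "\<And>n. y n \<ge> 0"
    and F: "\<And>\<sigma>. \<sigma> \<in> \<Sigma> \<Longrightarrow> continuous_on UNIV (F \<sigma>)" and c0: "\<And>\<sigma>. \<sigma> \<in> \<Sigma> \<Longrightarrow> continuous_on UNIV (c0 \<sigma>)"
    and c00: "\<And>\<sigma> t. \<sigma> \<in> \<Sigma> \<Longrightarrow> 0 \<le> c0 \<sigma> t" and F2: "\<And>\<sigma> t. \<sigma> \<in> \<Sigma> \<Longrightarrow> norm (F \<sigma> t) \<le> c2"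
    and good: "\<And>\<sigma> n t. \<sigma> \<in> \<Sigma> \<Longrightarrow> n \<in> Gd \<Longrightarrow> t \<in> {real n * l..(real n + 1) * l} \<Longrightarrow> norm (f (Complex \<sigma> t) - F \<sigma> t) \<le> c0 \<sigma> t + c1 * y n"
    and yX: "\<forall>\<^sub>F X in sequentially. c1 * (\<Sum>n=1..X. y n) \<le> e' * real X"
    and mean: "\<forall>\<^sub>F T in at_top. \<forall>\<sigma>\<in>\<Sigma>. (LINT t:{1..T}|lborel. c0 \<sigma> t) \<le> e' * T \<and>
         norm ((LINT t:{1..T}|lborel. F \<sigma> t) - T *\<^sub>R m \<sigma>) \<le> e' * T"
    using approx[OF e'] by blast
  define \<epsilon> where "\<epsilon> = e' / (c2 + 1)"
  have \<epsilon>: "\<epsilon> > 0" "c2 * \<epsilon> \<le> e'"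
  proof -
    show "\<epsilon> > 0" using e' c by (simp add: \<epsilon>_def)
    then have "c2 * \<epsilon> \<le> (c2 + 1) * \<epsilon>" by simp
    also have "\<dots> = e'" using c by (simp add: \<epsilon>_def field_simps)
    finally show "c2 * \<epsilon> \<le> e'" .
  qed
  have Xlim: "filterlim (\<lambda>T. nat \<lfloor>T / l\<rfloor>) sequentially at_top"
  proof -
    have "filterlim (\<lambda>T. T / l) at_top at_top" using l by real_asymp
    then show ?thesis
      by (intro filterlim_compose[OF filterlim_nat_sequentially] filterlim_compose[OF filterlim_floor_sequentially])
  qed
  have "\<forall>\<^sub>F X in sequentially. real (card (- Gd \<inter> {1..X})) / real X < \<epsilon>"
    using order_tendstoD(2)[OF dens[unfolded has_dens_def] \<epsilon>(1)] .
  then have "\<forall>\<^sub>F X in sequentially. real (card (- Gd \<inter> {1..X})) \<le> \<epsilon> * real X"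
    using eventually_gt_at_top[of 0] by eventually_elim (simp add: pos_divide_less_eq)
  then have bad: "\<forall>\<^sub>F T in at_top. real (card (- Gd \<inter> {1..nat \<lfloor>T / l\<rfloor>})) \<le> \<epsilon> * real (nat \<lfloor>T / l\<rfloor>)"
    using Xlim by (rule eventually_compose_filterlim)
  have yT: "\<forall>\<^sub>F T in at_top. c1 * (\<Sum>n=1..nat \<lfloor>T / l\<rfloor>. y n) \<le> e' * real (nat \<lfloor>T / l\<rfloor>)"
    using yX Xlim by (rule eventually_compose_filterlim)
  show "\<forall>\<^sub>F T in at_top. \<forall>\<sigma>\<in>\<Sigma>. dist (mean_off ?A f T \<sigma>) (m \<sigma>) < e"
    using eventually_ge_at_top[of 1] eventually_ge_at_top[of "c2 * l / e'"] yT bad mean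
  proof eventually_elim
    case (elim T)
    define X where "X = nat \<lfloor>T / l\<rfloor>"
    have T: "T > 0" using elim by simp
    have "real X \<le> T / l" using T l by (simp add: X_def)
    then have XT: "real X * l \<le> T" using l by (simp add: pos_le_divide_eq)
    have c2T: "c2 * l \<le> e' * T" using elim(2) e' by (simp add: pos_divide_le_eq mult.commute)
    have ys: "c1 * l * (\<Sum>n=1..X. y n) \<le> e' * T"
    proof -
      have "c1 * l * (\<Sum>n=1..X. y n) = l * (c1 * (\<Sum>n=1..X. y n))" by simp
      also have "\<dots> \<le> l * (e' * real X)" using elim(3) l by (intro mult_left_mono) (auto simp: X_def)
      also have "\<dots> = e' * (real X * l)" by simp
      also have "\<dots> \<le> e' * T" using XT e' by (intro mult_left_mono) auto
      finally show ?thesis .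
    qed
    have bs: "c2 * l * (1 + real (card (- Gd \<inter> {1..X}))) \<le> e' * T + e' * T"
    proof -
      have "c2 * l * real (card (- Gd \<inter> {1..X})) \<le> c2 * l * (\<epsilon> * real X)"
        using elim(4) l c by (intro mult_left_mono) (auto simp: X_def)
      also have "\<dots> = (c2 * \<epsilon>) * (real X * l)" by simp
      also have "\<dots> \<le> e' * T" using \<epsilon> XT e' l by (intro mult_mono) auto
      finally show ?thesis unfolding distrib_left mult_1_right using c2T by linarith
    qed
    show ?case
    proof
      fix \<sigma> assume \<sigma>: "\<sigma> \<in> \<Sigma>"
      define I1 where "I1 = (LINT t:{1..T}|lborel. indicat_real (- ?A) t *\<^sub>R f (Complex \<sigma> t))"
      define I2 where "I2 = (LINT t:{1..T}|lborel. F \<sigma> t)"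
      have "norm (I1 - I2) \<le> (LINT t:{1..T}|lborel. c0 \<sigma> t) + c1 * l * (\<Sum>n=1..X. y n)
         + c2 * l * (1 + real (card (- Gd \<inter> {1..X})))"
        unfolding I1_def I2_def X_def
        by (rule block_comparison[OF l Gd cont[OF _ \<sigma>] continuous_on_subset[OF F[OF \<sigma>]] continuous_on_subset[OF c0[OF \<sigma>]]])
           (use \<sigma> c y c00 F2 good in auto)
      moreover have "norm (I1 - T *\<^sub>R m \<sigma>) \<le> norm (I1 - I2) + norm (I2 - T *\<^sub>R m \<sigma>)"
        using norm_triangle_ineq[of "I1 - I2" "I2 - T *\<^sub>R m \<sigma>"] by simp
      moreover have "(LINT t:{1..T}|lborel. c0 \<sigma> t) \<le> e' * T" "norm (I2 - T *\<^sub>R m \<sigma>) \<le> e' * T"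
        using elim(5) \<sigma> by (auto simp: I2_def)
      ultimately have le: "norm (I1 - T *\<^sub>R m \<sigma>) \<le> 5 * (e' * T)" using ys bs by linarith
      have "(1 / T) *\<^sub>R I1 - m \<sigma> = (1 / T) *\<^sub>R (I1 - T *\<^sub>R m \<sigma>)" using T by (simp add: algebra_simps)
      then have "norm ((1 / T) *\<^sub>R I1 - m \<sigma>) = norm (I1 - T *\<^sub>R m \<sigma>) / T" using T by simp
      also have "\<dots> \<le> 5 * e'" using le T by (simp add: pos_divide_le_eq)
      also have "\<dots> < e" using e by (simp add: e'_def)
      finally show "dist (mean_off ?A f T \<sigma>) (m \<sigma>) < e"
        by (simp add: mean_off_def I1_def dist_norm)
    qed
  qed
qed

lemma square_diff_le:
  fixes z w :: complex
  assumes "\<theta> > 0"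
  shows "\<bar>cmod z ^ 2 - cmod w ^ 2\<bar> \<le> \<theta> * cmod w ^ 2 + (1 + 1 / \<theta>) * cmod (z - w) ^ 2"
proof -
  define d where "d = cmod (z - w)"
  have "\<bar>cmod z - cmod w\<bar> \<le> d" unfolding d_def by (rule norm_triangle_ineq3)
  moreover have d0: "d \<ge> 0" by (simp add: d_def)
  moreover have "\<bar>cmod z ^ 2 - cmod w ^ 2\<bar> = \<bar>cmod z - cmod w\<bar> * \<bar>(cmod z - cmod w) + 2 * cmod w\<bar>"
    unfolding abs_mult[symmetric] by (simp add: power2_eq_square algebra_simps)
  ultimately have "\<bar>cmod z ^ 2 - cmod w ^ 2\<bar> \<le> d * (d + 2 * cmod w)"
    using norm_ge_zero[of w] by (simp only:) (intro mult_mono, auto)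
  moreover have "0 \<le> (sqrt \<theta> * cmod w - d / sqrt \<theta>) ^ 2" by simp
  moreover have "(sqrt \<theta> * cmod w - d / sqrt \<theta>) ^ 2 = \<theta> * cmod w ^ 2 + (1 / \<theta>) * d ^ 2 - 2 * cmod w * d"
    using assms by (simp add: power2_diff power_mult_distrib power_divide)
  ultimately show ?thesis by (simp add: d_def power2_eq_square algebra_simps)
qed

text \<open>
  For \<open>|g|\<^sup>2\<close> the comparison function is \<open>|P\<^sub>N|\<^sup>2\<close>, with \<open>square_diff_le\<close>; for \<open>g\<close> it is
  \<open>P\<^sub>N\<close>, with \<open>|x| \<le> e + |x|\<^sup>2/e\<close>.  In both cases \<open>N\<close> is fixed first, in terms of the admissible
  error, and \<open>T\<close> tends to infinity afterwards.
\<close>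

lemma uniform_mean_valueI:
  assumes l: "l > 0" and \<alpha>: "1/2 < \<alpha>" and Gd: "0 \<notin> Gd"
    and dens: "has_dens (- Gd) 0" and g: "ramanujan_series g b"
    and cont: "\<And>n \<sigma>. n \<in> Gd \<Longrightarrow> \<sigma> \<in> {\<alpha>..2} \<Longrightarrow> continuous_on {real n * l..(real n + 1) * l} (\<lambda>t. g (Complex \<sigma> t))"
    and D: "D \<longlonglongrightarrow> 0"
    and approx: "\<And>N. mean_sup_le (block_rect l \<alpha> 2 0) Gd (\<lambda>s. g s - dirichlet_poly b N s) (D N)"
  shows "uniform_mean_value_series \<alpha> (exceptional_set l Gd) (\<lambda>s. cmod (g s) ^ 2) b"
    and "uniform_mean_value \<alpha> (exceptional_set l Gd) g (\<lambda>\<sigma>. b 1)"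
proof -
  let ?A = "exceptional_set l Gd"
  have rb: "ramanujan_hypothesis b" using g by (simp add: ramanujan_series_def)
  define a where "a = (\<lambda>\<sigma> n. cmod (b (Suc n)) ^ 2 * real (Suc n) powr (-2 * \<sigma>))"
  have a0: "a \<sigma> n \<ge> 0" for \<sigma> n by (simp add: a_def)
  have asum: "summable (a \<sigma>)" if "\<sigma> \<ge> \<alpha>" for \<sigma>
    using ramanujan_square_summable[OF rb, of \<sigma>] that \<alpha>
      summable_on_from_1_iff[of "\<lambda>n. cmod (b n) ^ 2 * real n powr (-2 * \<sigma>)"] by (simp add: a_def[abs_def])
  have a_eq: "(\<lambda>n. cmod (b (Suc n)) ^ 2 / real (Suc n) powr (2 * \<sigma>)) = a \<sigma>" for \<sigma>
    by (simp add: a_def powr_minus divide_inverse del: of_nat_Suc)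
  have a_mono: "a \<sigma> n \<le> a \<alpha> n" if "\<sigma> \<ge> \<alpha>" for \<sigma> n
    unfolding a_def using that by (intro mult_left_mono[OF powr_mono]) auto
  define S where "S = suminf (a \<alpha>)"
  have a_poly: "(\<Sum>m=1..N. cmod (b m) ^ 2 * real m powr (-2 * \<sigma>)) = (\<Sum>n<N. a \<sigma> n)" for N \<sigma>
    unfolding a_def by (rule sum.reindex_bij_witness[of _ Suc "\<lambda>n. n - 1"]) auto
  have aS: "(\<Sum>n<N. a \<sigma> n) \<le> S" if "\<sigma> \<ge> \<alpha>" for N \<sigma>
  proof -
    have "(\<Sum>n<N. a \<sigma> n) \<le> (\<Sum>n<N. a \<alpha> n)" by (intro sum_mono a_mono that)
    also have "\<dots> \<le> S" unfolding S_def by (rule sum_le_suminf[OF asum]) (auto simp: a0)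
    finally show ?thesis .
  qed
  have S0: "S \<ge> 0" using aS[of \<alpha> 0] by simp
  have tail: "\<bar>(\<Sum>n<N. a \<sigma> n) - suminf (a \<sigma>)\<bar> \<le> (\<Sum>n. a \<alpha> (n + N))" if \<sigma>: "\<sigma> \<ge> \<alpha>" for N \<sigma>
  proof -
    have "suminf (a \<sigma>) = (\<Sum>n. a \<sigma> (n + N)) + (\<Sum>n<N. a \<sigma> n)" by (rule suminf_split_initial_segment[OF asum[OF \<sigma>]])
    moreover have "(\<Sum>n. a \<sigma> (n + N)) \<le> (\<Sum>n. a \<alpha> (n + N))"
      using asum \<sigma> by (intro suminf_le a_mono) (auto simp: summable_iff_shift)
    moreover have "(\<Sum>n. a \<sigma> (n + N)) \<ge> 0" using asum \<sigma> a0 by (intro suminf_nonneg) (auto simp: summable_iff_shift)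
    ultimately show ?thesis by simp
  qed
  have contP: "continuous_on B (\<lambda>t. dirichlet_poly b N (Complex \<sigma> t))" for B N \<sigma>
    by (rule continuous_on_compose2[OF holomorphic_on_imp_continuous_on[OF dirichlet_poly_holomorphic]])
       (auto intro!: continuous_intros)
  have lint: "(LINT t:{1..T}|lborel. q t) = integral {1..T} q" if "continuous_on {1..T} q" for q :: "real \<Rightarrow> 'z :: euclidean_space" and T
    by (rule set_borel_integral_eq_integral(2)[OF borel_integrable_atLeastAtMost'[OF that]])
  have cont_bound: "cmod (dirichlet_poly b N (Complex \<sigma> t)) \<le> (\<Sum>n=1..N. cmod (b n))" if "\<sigma> \<ge> \<alpha>" for N \<sigma> t
    using that \<alpha> by (intro norm_dirichlet_poly_le) auto
  have scale: "\<forall>\<^sub>F X in sequentially. c * (\<Sum>n=1..X. y n) \<le> e * real X"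
    if "\<forall>\<^sub>F X in sequentially. (\<Sum>n=1..X. y n) \<le> D N * real X" "c \<ge> 0" "c * D N < e" for c e N and y :: "nat \<Rightarrow> real"
    using that(1)
  proof eventually_elim
    case (elim X)
    have "c * (\<Sum>n=1..X. y n) \<le> c * (D N * real X)" using elim that(2) by (intro mult_left_mono) auto
    also have "\<dots> \<le> e * real X" using that(3) by (simp add: mult.assoc[symmetric] mult_right_mono)
    finally show ?case .
  qed
  have main_sq: "uniform_limit {\<alpha>..2} (mean_off ?A (\<lambda>s. cmod (g s) ^ 2)) (\<lambda>\<sigma>. suminf (a \<sigma>)) at_top"
  proof (rule uniform_limit_mean_offI[OF l Gd dens])
    show "continuous_on {real n * l..(real n + 1) * l} (\<lambda>t. cmod (g (Complex \<sigma> t)) ^ 2)"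
      if "n \<in> Gd" "\<sigma> \<in> {\<alpha>..2}" for n \<sigma>
      by (intro continuous_intros cont that)
    fix e :: real assume e: "e > 0"
    (* The mean of |P_N|^2 is at most S + 1 for large T, so theta |P_N|^2 contributes at most e. *)
    define \<theta> where "\<theta> = e / (S + 1)"
    have \<theta>: "\<theta> > 0" "\<theta> * (S + 1) = e" using e S0 by (auto simp: \<theta>_def field_simps)
    have "(\<lambda>N. (1 + 1 / \<theta>) * D N) \<longlonglongrightarrow> (1 + 1 / \<theta>) * 0" by (intro tendsto_intros D)
    then have "\<forall>\<^sub>F N in sequentially. (1 + 1 / \<theta>) * D N < e" using e by (intro order_tendstoD(2)) auto
    moreover have "\<forall>\<^sub>F N in sequentially. (\<Sum>n. a \<alpha> (n + N)) < e / 2"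
      using e by (intro order_tendstoD(2)[OF suminf_exist_split2[OF asum]]) auto
    ultimately have "\<forall>\<^sub>F N in sequentially. (1 + 1 / \<theta>) * D N < e \<and> (\<Sum>n. a \<alpha> (n + N)) < e / 2"
      by (rule eventually_conj)
    then obtain N where N: "(1 + 1 / \<theta>) * D N < e" "(\<Sum>n. a \<alpha> (n + N)) < e / 2"
      using eventually_happens trivial_limit_sequentially by blast
    obtain y where y: "\<And>n. y n \<ge> 0"
      "\<And>n s. n \<in> Gd \<Longrightarrow> s \<in> block_rect l \<alpha> 2 0 n \<Longrightarrow> cmod (g s - dirichlet_poly b N s) ^ 2 \<le> y n"
      "\<forall>\<^sub>F X in sequentially. (\<Sum>n=1..X. y n) \<le> D N * real X"
      by (rule mean_sup_leE[OF approx]) blast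
    obtain K where K: "K \<ge> 0" "\<And>\<sigma> a b'. \<sigma> \<ge> 0 \<Longrightarrow> a \<le> b' \<Longrightarrow> \<bar>integral {a..b'} (\<lambda>t. cmod (dirichlet_poly b N (Complex \<sigma> t)) ^ 2)
      - (b' - a) * (\<Sum>n=1..N. cmod (b n) ^ 2 * real n powr (-2 * \<sigma>))\<bar> \<le> K"
      using dirichlet_poly_mean_square[of b N] by blast
    define F where "F = (\<lambda>\<sigma> t. cmod (dirichlet_poly b N (Complex \<sigma> t)) ^ 2)"
    have cF: "continuous_on B (F \<sigma>)" for B \<sigma> unfolding F_def by (intro continuous_intros contP)
    have "\<forall>\<^sub>F T in at_top. \<forall>\<sigma>\<in>{\<alpha>..2}. (LINT t:{1..T}|lborel. \<theta> * F \<sigma> t) \<le> e * T \<and>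
         norm ((LINT t:{1..T}|lborel. F \<sigma> t) - T *\<^sub>R suminf (a \<sigma>)) \<le> e * T"
      using eventually_ge_at_top[of 1] eventually_ge_at_top[of K] eventually_ge_at_top[of "2 * (K + S) / e"]
    proof eventually_elim
      case (elim T)
      show ?case
      proof
        fix \<sigma> assume "\<sigma> \<in> {\<alpha>..2}"
        then have \<sigma>: "\<sigma> \<ge> \<alpha>" "\<sigma> \<ge> 0" using \<alpha> by auto
        define s where "s = (\<Sum>n<N. a \<sigma> n)"
        have s: "0 \<le> s" "s \<le> S" unfolding s_def using aS[OF \<sigma>(1)] a0 by (auto intro: sum_nonneg)
        define I where "I = (LINT t:{1..T}|lborel. F \<sigma> t)"
        have I: "\<bar>I - (T - 1) * s\<bar> \<le> K"
          unfolding I_def lint[OF cF] s_def a_poly[symmetric] unfolding F_def using \<sigma> elim by (intro K(2)) auto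
        have Ts: "(T - 1) * s = T * s - s" by (simp add: left_diff_distrib)
        have "T * s \<le> T * S" using s elim by (intro mult_left_mono) auto
        then have "I \<le> T * (S + 1)" using I Ts s elim(2) by (simp only: distrib_left mult_1_right)
        then have "\<theta> * I \<le> \<theta> * (T * (S + 1))" using \<theta>(1) by (intro mult_left_mono) auto
        also have "\<dots> = (\<theta> * (S + 1)) * T" by (simp only: mult_ac)
        finally have 1: "\<theta> * I \<le> e * T" unfolding \<theta>(2) .
        have "K + S \<le> e / 2 * T" using elim(3) e by (simp add: pos_divide_le_eq mult_ac)
        then have "\<bar>I - T * s\<bar> \<le> e / 2 * T" using I Ts s by linarith
        moreover have "T * \<bar>s - suminf (a \<sigma>)\<bar> \<le> T * (e / 2)"
          using tail[OF \<sigma>(1), of N] N(2) elim by (intro mult_left_mono) (auto simp: s_def)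
        moreover have "\<bar>T * s - T * suminf (a \<sigma>)\<bar> = T * \<bar>s - suminf (a \<sigma>)\<bar>"
          using elim by (simp add: abs_mult flip: right_diff_distrib)
        moreover have "e / 2 * T = e * T / 2" "T * (e / 2) = e * T / 2" by simp_all
        ultimately have "\<bar>I - T * suminf (a \<sigma>)\<bar> \<le> e * T" by linarith
        with 1 show "(LINT t:{1..T}|lborel. \<theta> * F \<sigma> t) \<le> e * T \<and>
           norm ((LINT t:{1..T}|lborel. F \<sigma> t) - T *\<^sub>R suminf (a \<sigma>)) \<le> e * T"
          by (simp add: I_def)
      qed
    qed
    moreover have "norm (cmod (g (Complex \<sigma> t)) ^ 2 - F \<sigma> t) \<le> \<theta> * F \<sigma> t + (1 + 1 / \<theta>) * y n"
      if "\<sigma> \<in> {\<alpha>..2}" "n \<in> Gd" "t \<in> {real n * l..(real n + 1) * l}" for \<sigma> n t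
    proof -
      have "(1 + 1 / \<theta>) * cmod (g (Complex \<sigma> t) - dirichlet_poly b N (Complex \<sigma> t)) ^ 2 \<le> (1 + 1 / \<theta>) * y n"
        using that \<theta>(1) by (intro mult_left_mono y(2)) (auto simp: block_rect_def)
      then show ?thesis
        using square_diff_le[OF \<theta>(1), of "g (Complex \<sigma> t)" "dirichlet_poly b N (Complex \<sigma> t)"] by (simp add: F_def)
    qed
    moreover have "norm (F \<sigma> t) \<le> (\<Sum>n=1..N. cmod (b n)) ^ 2" if "\<sigma> \<in> {\<alpha>..2}" for \<sigma> t
      using that power_mono[OF cont_bound, of \<sigma> N t 2] by (simp add: F_def)
    moreover have "\<forall>\<^sub>F X in sequentially. (1 + 1 / \<theta>) * (\<Sum>n=1..X. y n) \<le> e * real X"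
      by (rule scale[OF y(3) _ N(1)]) (use \<theta>(1) in simp)
    moreover have "continuous_on UNIV (\<lambda>t. \<theta> * F \<sigma> t)" for \<sigma> by (intro continuous_intros cF)
    ultimately show "\<exists>F c0 c1 c2 y. c1 \<ge> 0 \<and> c2 \<ge> 0 \<and> (\<forall>n. y n \<ge> 0) \<and>
      (\<forall>\<sigma>\<in>{\<alpha>..2}. continuous_on UNIV (F \<sigma>) \<and> continuous_on UNIV (c0 \<sigma>) \<and> (\<forall>t. 0 \<le> c0 \<sigma> t \<and> norm (F \<sigma> t) \<le> c2) \<and>
         (\<forall>n\<in>Gd. \<forall>t\<in>{real n * l..(real n + 1) * l}. norm (cmod (g (Complex \<sigma> t)) ^ 2 - F \<sigma> t) \<le> c0 \<sigma> t + c1 * y n)) \<and>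
      (\<forall>\<^sub>F X in sequentially. c1 * (\<Sum>n=1..X. y n) \<le> e * real X) \<and>
      (\<forall>\<^sub>F T in at_top. \<forall>\<sigma>\<in>{\<alpha>..2}. (LINT t:{1..T}|lborel. c0 \<sigma> t) \<le> e * T \<and>
         norm ((LINT t:{1..T}|lborel. F \<sigma> t) - T *\<^sub>R suminf (a \<sigma>)) \<le> e * T)"
      using \<theta>(1) y(1) cF
      by (intro exI[of _ F] exI[of _ "\<lambda>\<sigma> t. \<theta> * F \<sigma> t"] exI[of _ "1 + 1 / \<theta>"] exI[of _ "(\<Sum>n=1..N. cmod (b n)) ^ 2"] exI[of _ y])
         (auto simp: F_def)
  qed
  have main: "uniform_limit {\<alpha>..2} (mean_off ?A g) (\<lambda>\<sigma>. b 1) at_top"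
  proof (rule uniform_limit_mean_offI[OF l Gd dens cont])
    fix e :: real assume e: "e > 0"
    have "(\<lambda>N. (1 / e) * D N) \<longlonglongrightarrow> (1 / e) * 0" by (intro tendsto_intros D)
    then have "\<forall>\<^sub>F N in sequentially. (1 / e) * D N < e" using e by (intro order_tendstoD(2)) auto
    moreover have "\<forall>\<^sub>F N in sequentially. N \<ge> (1::nat)" by (rule eventually_ge_at_top)
    ultimately have "\<forall>\<^sub>F N in sequentially. (1 / e) * D N < e \<and> N \<ge> 1" by (rule eventually_conj)
    then obtain N where N: "(1 / e) * D N < e" "N \<ge> 1"
      using eventually_happens trivial_limit_sequentially by blast
    obtain y where y: "\<And>n. y n \<ge> 0"
      "\<And>n s. n \<in> Gd \<Longrightarrow> s \<in> block_rect l \<alpha> 2 0 n \<Longrightarrow> cmod (g s - dirichlet_poly b N s) ^ 2 \<le> y n"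
      "\<forall>\<^sub>F X in sequentially. (\<Sum>n=1..X. y n) \<le> D N * real X"
      by (rule mean_sup_leE[OF approx]) blast
    obtain K where K: "\<And>\<sigma> a b'. \<sigma> \<ge> 0 \<Longrightarrow> a \<le> b' \<Longrightarrow> cmod (integral {a..b'} (\<lambda>t. dirichlet_poly b N (Complex \<sigma> t)) - (b' - a) *\<^sub>R b 1) \<le> K"
      using dirichlet_poly_mean[OF N(2), of b] by blast
    define F where "F = (\<lambda>\<sigma> t. dirichlet_poly b N (Complex \<sigma> t))"
    have cF: "continuous_on B (F \<sigma>)" for B \<sigma> unfolding F_def by (rule contP)
    have "\<forall>\<^sub>F T in at_top. \<forall>\<sigma>\<in>{\<alpha>..2}. (LINT t:{1..T}|lborel. e) \<le> e * T \<and>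
         norm ((LINT t:{1..T}|lborel. F \<sigma> t) - T *\<^sub>R b 1) \<le> e * T"
      using eventually_ge_at_top[of 1] eventually_ge_at_top[of "(K + cmod (b 1)) / e"]
    proof eventually_elim
      case (elim T)
      show ?case
      proof
        fix \<sigma> assume "\<sigma> \<in> {\<alpha>..2}"
        then have \<sigma>: "\<sigma> \<ge> 0" using \<alpha> by auto
        define I where "I = (LINT t:{1..T}|lborel. F \<sigma> t)"
        have "cmod (I - (T - 1) *\<^sub>R b 1) \<le> K"
          unfolding I_def lint[OF cF] unfolding F_def using \<sigma> elim by (intro K) auto
        moreover have "I - T *\<^sub>R b 1 = (I - (T - 1) *\<^sub>R b 1) - b 1" by (simp add: algebra_simps)
        then have "cmod (I - T *\<^sub>R b 1) \<le> cmod (I - (T - 1) *\<^sub>R b 1) + cmod (b 1)"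
          by (simp only: norm_triangle_ineq4)
        moreover have "K + cmod (b 1) \<le> e * T" using elim(2) e by (simp add: pos_divide_le_eq mult.commute)
        moreover have "(LINT t:{1..T}|lborel. e) \<le> e * T" using elim e by (simp add: lint)
        ultimately show "(LINT t:{1..T}|lborel. e) \<le> e * T \<and> norm ((LINT t:{1..T}|lborel. F \<sigma> t) - T *\<^sub>R b 1) \<le> e * T"
          unfolding I_def[symmetric] by linarith
      qed
    qed
    moreover have "norm (g (Complex \<sigma> t) - F \<sigma> t) \<le> e + (1 / e) * y n"
      if "\<sigma> \<in> {\<alpha>..2}" "n \<in> Gd" "t \<in> {real n * l..(real n + 1) * l}" for \<sigma> n t
    proof -
      define d where "d = cmod (g (Complex \<sigma> t) - F \<sigma> t)"
      have d: "d \<ge> 0" "d ^ 2 \<le> y n" using that y(2)[of n "Complex \<sigma> t"] by (auto simp: d_def F_def block_rect_def)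
      have "2 * (e * d) \<le> e * e + d ^ 2" using zero_le_power2[of "e - d"] by (simp add: power2_eq_square algebra_simps)
      then have "e * d \<le> e * e + y n" using d mult_nonneg_nonneg[of e d] e by linarith
      then have "d \<le> (e * e + y n) / e" using e by (simp add: pos_le_divide_eq mult.commute)
      then show ?thesis using e by (simp add: d_def add_divide_distrib)
    qed
    moreover have "\<forall>\<^sub>F X in sequentially. (1 / e) * (\<Sum>n=1..X. y n) \<le> e * real X"
      by (rule scale[OF y(3) _ N(1)]) (use e in simp)
    moreover have "norm (F \<sigma> t) \<le> (\<Sum>n=1..N. cmod (b n))" if "\<sigma> \<in> {\<alpha>..2}" for \<sigma> t
      using that cont_bound by (simp add: F_def)
    ultimately show "\<exists>F c0 c1 c2 y. c1 \<ge> 0 \<and> c2 \<ge> 0 \<and> (\<forall>n. y n \<ge> 0) \<and>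
      (\<forall>\<sigma>\<in>{\<alpha>..2}. continuous_on UNIV (F \<sigma>) \<and> continuous_on UNIV (c0 \<sigma>) \<and> (\<forall>t. 0 \<le> c0 \<sigma> t \<and> norm (F \<sigma> t) \<le> c2) \<and>
         (\<forall>n\<in>Gd. \<forall>t\<in>{real n * l..(real n + 1) * l}. norm (g (Complex \<sigma> t) - F \<sigma> t) \<le> c0 \<sigma> t + c1 * y n)) \<and>
      (\<forall>\<^sub>F X in sequentially. c1 * (\<Sum>n=1..X. y n) \<le> e * real X) \<and>
      (\<forall>\<^sub>F T in at_top. \<forall>\<sigma>\<in>{\<alpha>..2}. (LINT t:{1..T}|lborel. c0 \<sigma> t) \<le> e * T \<and>
         norm ((LINT t:{1..T}|lborel. F \<sigma> t) - T *\<^sub>R b 1) \<le> e * T)"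
      using e y(1) cF sum_nonneg[of "{1..N}" "\<lambda>n. cmod (b n)"]
      by (intro exI[of _ F] exI[of _ "\<lambda>\<sigma> t. e"] exI[of _ "1 / e"] exI[of _ "\<Sum>n=1..N. cmod (b n)"] exI[of _ y]) auto
  qed
  show "uniform_mean_value_series \<alpha> ?A (\<lambda>s. cmod (g s) ^ 2) b"
    unfolding uniform_mean_value_series_def uniform_mean_value_def a_eq
  proof (intro conjI ballI allI impI)
    show "summable (a \<sigma>)" if "\<sigma> \<in> {\<alpha>..2}" for \<sigma> using that by (intro asum) auto
    show "set_integrable lborel {1..T} (\<lambda>t. indicat_real (- ?A) t *\<^sub>R cmod (g (Complex \<sigma> t)) ^ 2)" if "\<sigma> \<in> {\<alpha>..2}" for \<sigma> T
      by (rule set_integrable_off_exceptional[OF l]) (intro continuous_intros cont that)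
  qed (rule main_sq)
  show "uniform_mean_value \<alpha> ?A g (\<lambda>\<sigma>. b 1)"
    unfolding uniform_mean_value_def
  proof (intro conjI ballI allI impI)
    show "set_integrable lborel {1..T} (\<lambda>t. indicat_real (- ?A) t *\<^sub>R g (Complex \<sigma> t))" if "\<sigma> \<in> {\<alpha>..2}" for \<sigma> T
      by (rule set_integrable_off_exceptional[OF l]) (intro cont that)
  qed (rule main)
qed

section \<open>The mean value theorem\<close>

text \<open>
  For every \<open>j\<close> the hypothesis provides blocks \<open>J j\<close> whose complement has upper density at most
  \<open>1/(j + 1)\<close>, and \<open>dirichlet_poly_approximation\<close> provides majorants \<open>Y j i N\<close> of the blockwise
  suprema of \<open>|g i - P\<^sub>N|\<^sup>2\<close> on \<open>J j\<close>.  These are countably many quantities for each stage \<open>j\<close>, to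
  which \<open>diagonal_choice\<close> applies: \<open>q = 0\<close> counts the blocks outside \<open>J j\<close>, and \<open>q = p + 1\<close> with
  \<open>p\<close> the code of \<open>(i, N)\<close> stands for \<open>Y j i N\<close>.  Block \<open>n\<close> is good if it belongs to \<open>J (\<phi> n)\<close>.
  The property \<open>Q\<close> passes on to the complement of the exceptional set what else is known about the blocks.
\<close>

lemma uniform_mean_values_family:
  fixes g :: "nat \<Rightarrow> complex \<Rightarrow> complex"
  assumes l: "l > 0" and x: "1/2 < x0" "x0 < \<alpha>" "\<alpha> \<le> 2" and \<delta>: "\<delta> > 0"
    and g: "\<And>i. ramanujan_series (g i) (b i)"
    and blocks: "\<And>\<epsilon>. \<epsilon> > 0 \<Longrightarrow> \<exists>J. (\<forall>\<^sub>F X in sequentially. real (card ({1..X} - J)) \<le> \<epsilon> * real X) \<and>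
        (\<forall>n\<in>J. n \<ge> 1 \<and> Q n) \<and> (\<forall>i. bdd_on_blocks l x0 \<delta> (g i) J)"
  obtains A where "l_set_density_zero l A"
    "\<And>t. t \<in> {1..} - A \<Longrightarrow> \<exists>n. Q n \<and> real n * l \<le> t \<and> t < (real n + 1) * l"
    "\<And>i. uniform_mean_value_series \<alpha> A (\<lambda>s. cmod (g i s) ^ 2) (b i)"
    "\<And>i. uniform_mean_value \<alpha> A (g i) (\<lambda>\<sigma>. b i 1)"
proof -
  define PJ where "PJ = (\<lambda>j::nat. \<lambda>J. (\<forall>\<^sub>F X in sequentially. real (card ({1..X} - J)) \<le> 1 / real (Suc j) * real X) \<and>
        (\<forall>n\<in>J. n \<ge> 1 \<and> Q n) \<and> (\<forall>i. bdd_on_blocks l x0 \<delta> (g i) J))"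
  define J where "J = (\<lambda>j. SOME J. PJ j J)"
  have "PJ j (J j)" for j
    unfolding J_def by (rule someI_ex, unfold PJ_def, rule blocks) simp
  then have J: "\<And>j::nat. \<forall>\<^sub>F X in sequentially. real (card ({1..X} - J j)) \<le> 1 / real (Suc j) * real X"
    "\<And>j n. n \<in> J j \<Longrightarrow> n \<ge> 1 \<and> Q n" "\<And>j i. bdd_on_blocks l x0 \<delta> (g i) (J j)"
    unfolding PJ_def by blast+
  have "\<forall>i. \<exists>D. D \<longlonglongrightarrow> 0 \<and> (\<forall>N. D N > 0) \<and> (\<forall>J N. bdd_on_blocks l x0 \<delta> (g i) J \<longrightarrow>
    mean_sup_le (block_rect l \<alpha> 2 0) J (\<lambda>s. g i s - dirichlet_poly (b i) N s) (D N))"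
    by (intro allI dirichlet_poly_approximation[OF l x \<delta> g])
  from choice[OF this] obtain D where "\<forall>i. D i \<longlonglongrightarrow> 0 \<and> (\<forall>N. D i N > 0) \<and>
    (\<forall>J N. bdd_on_blocks l x0 \<delta> (g i) J \<longrightarrow>
       mean_sup_le (block_rect l \<alpha> 2 0) J (\<lambda>s. g i s - dirichlet_poly (b i) N s) (D i N))" by blast
  then have D: "\<And>i. D i \<longlonglongrightarrow> 0" "\<And>i N. D i N > 0"
    "\<And>i J N. bdd_on_blocks l x0 \<delta> (g i) J \<Longrightarrow>
       mean_sup_le (block_rect l \<alpha> 2 0) J (\<lambda>s. g i s - dirichlet_poly (b i) N s) (D i N)"
    by blast+
  define PY where "PY = (\<lambda>j i N. \<lambda>y :: nat \<Rightarrow> real. (\<forall>n. y n \<ge> 0) \<and>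
    (\<forall>n\<in>J j. \<forall>s\<in>block_rect l \<alpha> 2 0 n. cmod (g i s - dirichlet_poly (b i) N s) ^ 2 \<le> y n) \<and>
    (\<forall>\<^sub>F X in sequentially. (\<Sum>n=1..X. y n) \<le> D i N * real X))"
  define Y where "Y = (\<lambda>j i N. SOME y. PY j i N y)"
  have "PY j i N (Y j i N)" for j i N
  proof -
    have "\<exists>y. PY j i N y" using D(3)[OF J(3), of j i N] unfolding PY_def mean_sup_le_def .
    then show ?thesis unfolding Y_def by (rule someI_ex)
  qed
  then have Y: "\<And>j i N n. Y j i N n \<ge> 0"
    "\<And>j i N n s. n \<in> J j \<Longrightarrow> s \<in> block_rect l \<alpha> 2 0 n \<Longrightarrow> cmod (g i s - dirichlet_poly (b i) N s) ^ 2 \<le> Y j i N n"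
    "\<And>j i N. \<forall>\<^sub>F X in sequentially. (\<Sum>n=1..X. Y j i N n) \<le> D i N * real X"
    unfolding PY_def by blast+
  define y where "y = (\<lambda>j q n. case q of 0 \<Rightarrow> (if n \<in> J j then 0 else 1) | Suc p \<Rightarrow> Y j (fst (prod_decode p)) (snd (prod_decode p)) n)"
  define d where "d = (\<lambda>j q. case q of 0 \<Rightarrow> 1 / real (Suc j) | Suc p \<Rightarrow> D (fst (prod_decode p)) (snd (prod_decode p)))"
  have y0: "y j q n \<ge> 0" for j q n using Y(1) by (auto simp: y_def split: nat.split)
  have yd: "\<forall>\<^sub>F X in sequentially. (\<Sum>n=1..X. y j q n) \<le> d j q * real X" for j q
  proof (cases q)
    case 0
    have "(\<Sum>n=1..X. y j q n) = real (card ({1..X} - J j))" for X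
    proof -
      have "(\<Sum>n=1..X. y j q n) = (\<Sum>n\<in>{1..X} - J j. 1)"
        unfolding 0 y_def nat.case by (rule sum.mono_neutral_cong_right) auto
      then show ?thesis by simp
    qed
    then show ?thesis using J(1)[of j] by (simp add: 0 d_def)
  next
    case (Suc p)
    then show ?thesis using Y(3) by (simp add: y_def d_def)
  qed
  from diagonal_choice[of y d, OF y0 yd] obtain \<phi> where \<phi>: "\<And>q B i. B > 0 \<Longrightarrow> (\<And>j. j \<ge> i \<Longrightarrow> d j q \<le> B) \<Longrightarrow>
     \<forall>\<^sub>F X in sequentially. (\<Sum>n=1..X. y (\<phi> n) q n) \<le> 4 * B * real X" by blast
  define Gd where "Gd = {n. n \<in> J (\<phi> n)}"
  have Gd: "n \<ge> 1 \<and> Q n" if "n \<in> Gd" for n using that J(2) by (auto simp: Gd_def)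
  have Gd0: "0 \<notin> Gd" using Gd by fastforce
  have dens: "has_dens (- Gd) 0"
    unfolding has_dens_def
  proof (rule tendstoI)
    fix e :: real assume e: "e > 0"
    obtain i :: nat where i: "1 / real (Suc i) < e / 8" using e nat_approx_posE[of "e / 8"] by auto
    have "\<forall>\<^sub>F X in sequentially. (\<Sum>n=1..X. y (\<phi> n) 0 n) \<le> 4 * (e / 8) * real X"
    proof (rule \<phi>)
      fix j assume "i \<le> j"
      then have "1 / real (Suc j) \<le> 1 / real (Suc i)" by (intro divide_left_mono) auto
      then show "d j 0 \<le> e / 8" using i by (simp add: d_def)
    qed (use e in simp)
    then show "\<forall>\<^sub>F X in sequentially. dist (real (card (- Gd \<inter> {1..X})) / real X) 0 < e"
      using eventually_gt_at_top[of 0]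
    proof eventually_elim
      case (elim X)
      have "(\<Sum>n=1..X. y (\<phi> n) 0 n) = (\<Sum>n\<in>- Gd \<inter> {1..X}. 1)"
        unfolding y_def nat.case by (rule sum.mono_neutral_cong_right) (auto simp: Gd_def)
      then have "real (card (- Gd \<inter> {1..X})) \<le> e / 2 * real X" using elim by simp
      also have "\<dots> < e * real X" using elim e by simp
      finally show ?case using elim by (simp add: pos_divide_less_eq)
    qed
  qed
  have approx: "mean_sup_le (block_rect l \<alpha> 2 0) Gd (\<lambda>s. g i s - dirichlet_poly (b i) N s) (4 * D i N)" for i N
  proof (rule mean_sup_leI[of "\<lambda>n. Y (\<phi> n) i N n"])
    define q where "q = Suc (prod_encode (i, N))"
    have "\<forall>\<^sub>F X in sequentially. (\<Sum>n=1..X. y (\<phi> n) q n) \<le> 4 * D i N * real X"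
      by (rule \<phi>[where i = 0]) (use D(2) in \<open>auto simp: d_def q_def\<close>)
    then show "\<forall>\<^sub>F X in sequentially. (\<Sum>n=1..X. Y (\<phi> n) i N n) \<le> (4 * D i N) * real X"
      by (simp add: y_def q_def)
  qed (use Y(1,2) in \<open>auto simp: Gd_def\<close>)
  have D4: "(\<lambda>N. 4 * D i N) \<longlonglongrightarrow> 0" for i using tendsto_mult[OF tendsto_const D(1), of 4 i] by simp
  have cont: "continuous_on {real n * l..(real n + 1) * l} (\<lambda>t. g i (Complex \<sigma> t))" if "n \<in> Gd" "\<sigma> \<in> {\<alpha>..2}" for n \<sigma> i
  proof (rule continuous_on_compose2[of "half_strip l x0 \<delta> n" "g i"])
    show "continuous_on (half_strip l x0 \<delta> n) (g i)"
      using J(3)[of i "\<phi> n"] that by (auto simp: Gd_def bdd_on_blocks_def intro: holomorphic_on_imp_continuous_on)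
    show "(\<lambda>t. Complex \<sigma> t) ` {real n * l..(real n + 1) * l} \<subseteq> half_strip l x0 \<delta> n"
      using that x \<delta> by (auto simp: half_strip_def)
  qed (intro continuous_intros)
  have \<alpha>: "1/2 < \<alpha>" using x by simp
  show ?thesis
  proof (rule that[of "exceptional_set l Gd"])
    show "l_set_density_zero l (exceptional_set l Gd)"
      unfolding l_set_density_zero_def exceptional_set_def using dens by blast
    show "\<exists>n. Q n \<and> real n * l \<le> t \<and> t < (real n + 1) * l" if t: "t \<in> {1..} - exceptional_set l Gd" for t
    proof -
      have "nat \<lfloor>t / l\<rfloor> \<in> Gd" using t exceptional_set_iff[OF l, of t Gd] by auto
      then show ?thesis using block_index[OF l, of t "nat \<lfloor>t / l\<rfloor>"] t Gd by auto
    qed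
    show "uniform_mean_value_series \<alpha> (exceptional_set l Gd) (\<lambda>s. cmod (g i s) ^ 2) (b i)"
      "uniform_mean_value \<alpha> (exceptional_set l Gd) (g i) (\<lambda>\<sigma>. b i 1)" for i
      using uniform_mean_valueI[where g = "g i" and b = "b i" and D = "\<lambda>N. 4 * D i N", OF l \<alpha> Gd0 dens g cont D4 approx] by blast+
  qed
qed

lemma lower_dens_count:
  assumes "lower_dens J > ereal (1 - \<epsilon>)"
  shows "\<forall>\<^sub>F X in sequentially. real (card ({1..X} - J)) \<le> \<epsilon> * real X"
proof -
  have "\<forall>\<^sub>F X in sequentially. ereal (1 - \<epsilon>) < ereal (real (card (J \<inter> {1..X})) / real X)"
    using assms unfolding lower_dens_def by (rule less_LiminfD)
  then show ?thesis using eventually_gt_at_top[of 0]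
  proof eventually_elim
    case (elim X)
    then have "(1 - \<epsilon>) * real X < real (card (J \<inter> {1..X}))" by (simp add: pos_less_divide_eq)
    moreover have "card ({1..X} - J) + card (J \<inter> {1..X}) = X"
    proof -
      have "card (({1..X} - J) \<union> (J \<inter> {1..X})) = card ({1..X} - J) + card (J \<inter> {1..X})"
        by (rule card_Un_disjoint) auto
      moreover have "({1..X} - J) \<union> (J \<inter> {1..X}) = {1..X}" by auto
      ultimately show ?thesis by simp
    qed
    ultimately show ?case by (simp add: algebra_simps flip: of_nat_add)
  qed
qed

theorem corollary9p2:
  fixes u \<alpha> l :: real and L :: "complex \<Rightarrow> complex" and a :: "nat \<Rightarrow> complex"
  assumes "1 / 2 \<le> u" and "u < 1"
    and "class_N u L"
    and "has_dirichlet_expansion L a" and "ramanujan_hypothesis a"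
    and "u < \<alpha>" and "\<alpha> \<le> 1" and "l > 0"
  shows
    "(\<exists>A. l_set_density_zero l A \<and>
        (\<forall>\<sigma>\<in>{\<alpha>..2}. \<forall>t\<in>{1..} - A. continues_to L (Complex \<sigma> t)) \<and>
        (\<forall>k::nat. k \<ge> 1 \<longrightarrow>
           (\<exists>b. has_dirichlet_expansion (\<lambda>s. L s ^ k) b \<and>
              uniform_mean_value_series \<alpha> A (\<lambda>s. cmod (cont L s) ^ (2 * k)) b \<and>
              uniform_mean_value \<alpha> A (\<lambda>s. cont L s ^ k) (\<lambda>\<sigma>. b 1))))
     \<and>
     (polynomial_euler_product L \<longrightarrow>
       (\<exists>lg. is_normalized_log L lg \<and>
        (\<exists>A. l_set_density_zero l A \<and>
          (\<forall>\<sigma>\<in>{\<alpha>..2}. \<forall>t\<in>{1..} - A. continues_to L (Complex \<sigma> t) \<and>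
             cont L (Complex \<sigma> t) \<noteq> 0 \<and> continues_to lg (Complex \<sigma> t)) \<and>
          (\<forall>k::nat. k \<ge> 1 \<longrightarrow>
             (\<exists>b. has_dirichlet_expansion (\<lambda>s. inverse (L s ^ k)) b \<and>
                uniform_mean_value_series \<alpha> A (\<lambda>s. inverse (cmod (cont L s) ^ (2 * k))) b)) \<and>
          (\<exists>b. has_dirichlet_expansion lg b \<and>
             uniform_mean_value_series \<alpha> A (\<lambda>s. cmod (cont lg s) ^ 2) b) \<and>
          (\<exists>b. has_dirichlet_expansion (\<lambda>s. deriv L s / L s) b \<and>
             uniform_mean_value_series \<alpha> A
               (\<lambda>s. (cmod (deriv (cont L) s / cont L s)) ^ 2) b))))"
proof -
  (* L is bounded to the right of x0, its reciprocal to the right of x1, and the approximation takes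
     place to the right of alpha; each step loses a little, also in the height of the strips. *)
  define x0 where "x0 = (u + \<alpha>) / 2"
  define x1 where "x1 = (x0 + \<alpha>) / 2"
  have "u < x0" "x0 < \<alpha>" using assms by (auto simp: x0_def)
  moreover have "x0 < x1" "x1 < \<alpha>" using \<open>x0 < \<alpha>\<close> by (auto simp: x1_def)
  ultimately have x: "u < x0" "x0 < x1" "x1 < \<alpha>" "1/2 < x0" "x0 < \<alpha>" "x0 \<le> 1" "\<alpha> \<le> 2" "x1 \<le> 2" "1/2 < x1" "x1 < 2"
    using assms(1,7) by linarith+
  define \<delta>0 where "\<delta>0 = l / 2"
  define \<delta>1 where "\<delta>1 = l / 3"
  have \<delta>: "0 < \<delta>0" "\<delta>0 < l" "0 < \<delta>1" "\<delta>1 < \<delta>0" using assms(8) by (auto simp: \<delta>0_def \<delta>1_def)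
  have L: "ramanujan_series L a" using assms by (simp add: ramanujan_series_def)
  have holL: "L holomorphic_on {s. Re s > 1}" by (rule ramanujan_series_deriv(1)[OF L])
  have contL: "cont L s = L s" if "Re s > 1" for s by (rule cont_eq[OF holL that])
  have blocksL: "\<exists>J\<subseteq>{1..}. (\<forall>\<^sub>F X in sequentially. real (card ({1..X} - J)) \<le> \<epsilon> * real X) \<and> bdd_on_blocks l x0 \<delta>0 (cont L) J \<and>
     (\<forall>n\<in>J. \<forall>s\<in>half_strip l x0 \<delta>0 n. continues_to L s)" if "\<epsilon> > 0" for \<epsilon>
    using class_N_bounded_blocks[OF assms(3) L x(1,6) assms(8) \<delta>(1,2) that] lower_dens_count by blast
  have in_strip: "Complex \<sigma> t \<in> half_strip l x \<delta> n"
    if "\<sigma> \<in> {\<alpha>..2}" "real n * l \<le> t" "t < (real n + 1) * l" "x < \<alpha>" "\<delta> > 0" for \<sigma> t x \<delta> n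
    using that by (auto simp: half_strip_def)

  have part1: "\<exists>A. l_set_density_zero l A \<and>
        (\<forall>\<sigma>\<in>{\<alpha>..2}. \<forall>t\<in>{1..} - A. continues_to L (Complex \<sigma> t)) \<and>
        (\<forall>k::nat. k \<ge> 1 \<longrightarrow>
           (\<exists>b. has_dirichlet_expansion (\<lambda>s. L s ^ k) b \<and>
              uniform_mean_value_series \<alpha> A (\<lambda>s. cmod (cont L s) ^ (2 * k)) b \<and>
              uniform_mean_value \<alpha> A (\<lambda>s. cont L s ^ k) (\<lambda>\<sigma>. b 1)))"
  proof -
    have "\<forall>k. \<exists>b. ramanujan_series (\<lambda>s. L s ^ k) b" using ramanujan_series_power[OF L] by blast
    then obtain b where b: "\<And>k. ramanujan_series (\<lambda>s. L s ^ k) (b k)" by metis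
    have b': "ramanujan_series (\<lambda>s. cont L s ^ k) (b k)" for k
      by (rule ramanujan_series_cong[OF b]) (simp add: contL)
    have blocks: "\<exists>J. (\<forall>\<^sub>F X in sequentially. real (card ({1..X} - J)) \<le> \<epsilon> * real X) \<and>
        (\<forall>n\<in>J. n \<ge> 1 \<and> (\<forall>s\<in>half_strip l x0 \<delta>0 n. continues_to L s)) \<and> (\<forall>k. bdd_on_blocks l x0 \<delta>0 (\<lambda>s. cont L s ^ k) J)"
      if eps: "\<epsilon> > 0" for \<epsilon>
    proof -
      obtain J where J: "J \<subseteq> {1..}" "\<forall>\<^sub>F X in sequentially. real (card ({1..X} - J)) \<le> \<epsilon> * real X"
        "bdd_on_blocks l x0 \<delta>0 (cont L) J" "\<forall>n\<in>J. \<forall>s\<in>half_strip l x0 \<delta>0 n. continues_to L s"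
        using blocksL[OF eps] by blast
      show ?thesis
        using J bdd_on_blocks_power[OF J(3)] by (intro exI[of _ J]) auto
    qed
    obtain A where A: "l_set_density_zero l A"
      "\<And>t. t \<in> {1..} - A \<Longrightarrow> \<exists>n. (\<forall>s\<in>half_strip l x0 \<delta>0 n. continues_to L s) \<and> real n * l \<le> t \<and> t < (real n + 1) * l"
      "\<And>k. uniform_mean_value_series \<alpha> A (\<lambda>s. cmod (cont L s ^ k) ^ 2) (b k)"
      "\<And>k. uniform_mean_value \<alpha> A (\<lambda>s. cont L s ^ k) (\<lambda>\<sigma>. b k 1)"
      by (rule uniform_mean_values_family[OF assms(8) x(4,5,7) \<delta>(1) b' blocks]) blast+
    have "continues_to L (Complex \<sigma> t)" if "\<sigma> \<in> {\<alpha>..2}" "t \<in> {1..} - A" for \<sigma> t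
      using A(2)[OF that(2)] in_strip[OF that(1) _ _ x(5) \<delta>(1)] by blast
    moreover have pow: "cmod (z ^ k) ^ 2 = cmod z ^ (2 * k)" for z k
      by (simp add: norm_power mult.commute flip: power_mult)
    moreover have "\<exists>b. has_dirichlet_expansion (\<lambda>s. L s ^ k) b \<and>
        uniform_mean_value_series \<alpha> A (\<lambda>s. cmod (cont L s) ^ (2 * k)) b \<and>
        uniform_mean_value \<alpha> A (\<lambda>s. cont L s ^ k) (\<lambda>\<sigma>. b 1)" for k
      using A(3)[of k] A(4)[of k] b[of k] unfolding pow ramanujan_series_def by blast
    ultimately show ?thesis using A(1) by blast
  qed

  have part2: "\<exists>lg. is_normalized_log L lg \<and>
        (\<exists>A. l_set_density_zero l A \<and>
          (\<forall>\<sigma>\<in>{\<alpha>..2}. \<forall>t\<in>{1..} - A. continues_to L (Complex \<sigma> t) \<and>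
             cont L (Complex \<sigma> t) \<noteq> 0 \<and> continues_to lg (Complex \<sigma> t)) \<and>
          (\<forall>k::nat. k \<ge> 1 \<longrightarrow>
             (\<exists>b. has_dirichlet_expansion (\<lambda>s. inverse (L s ^ k)) b \<and>
                uniform_mean_value_series \<alpha> A (\<lambda>s. inverse (cmod (cont L s) ^ (2 * k))) b)) \<and>
          (\<exists>b. has_dirichlet_expansion lg b \<and>
             uniform_mean_value_series \<alpha> A (\<lambda>s. cmod (cont lg s) ^ 2) b) \<and>
          (\<exists>b. has_dirichlet_expansion (\<lambda>s. deriv L s / L s) b \<and>
             uniform_mean_value_series \<alpha> A
               (\<lambda>s. (cmod (deriv (cont L) s / cont L s)) ^ 2) b))"
    if euler: "polynomial_euler_product L"
  proof -
    note E = polynomial_euler_product_inverse[OF L euler]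
    obtain c where c: "ramanujan_series (\<lambda>s. inverse (L s)) c" using E(3) by blast
    define c1 where "c1 = dirichlet_conv (\<lambda>n. a n * - of_real (ln (real n))) c"
    have quot: "ramanujan_series (\<lambda>s. deriv L s / L s) c1"
      using ramanujan_series_mult[OF ramanujan_series_deriv(2)[OF L] c] by (simp add: c1_def divide_inverse)
    have c11: "c1 1 = 0" by (simp add: c1_def dirichlet_conv_def)
    obtain lg b0 where lg: "is_normalized_log L lg" "ramanujan_series lg b0"
      "\<And>s. Re s > 1 \<Longrightarrow> (lg has_field_derivative deriv L s / L s) (at s)"
      by (rule normalized_log_series[OF L E(1,2) quot c11]) blast+
    have hollg: "lg holomorphic_on {s. Re s > 1}" by (rule ramanujan_series_deriv(1)[OF lg(2)])
    have "\<forall>k. \<exists>b. ramanujan_series (\<lambda>s. inverse (L s) ^ k) b" using ramanujan_series_power[OF c] by blast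
    then obtain b where b: "\<And>k. ramanujan_series (\<lambda>s. inverse (L s) ^ k) (b k)" by metis
    have holc: "cont L holomorphic_on {s. Re s > 1}"
      by (rule holomorphic_transform[OF holL]) (simp add: contL)
    have dcont: "deriv (cont L) s = deriv L s" if "Re s > 1" for s
      by (rule complex_derivative_transform_within_open[OF holc holL open_halfspace_Re_gt]) (use that in \<open>auto simp: contL\<close>)
    (* One enumeration of all functions concerned, so that they share the exceptional set. *)
    define g where "g = (\<lambda>i. case i of 0 \<Rightarrow> cont lg | Suc 0 \<Rightarrow> (\<lambda>s. deriv (cont L) s / cont L s) | Suc (Suc k) \<Rightarrow> (\<lambda>s. inverse (cont L s) ^ k))"
    define \<beta> where "\<beta> = (\<lambda>i. case i of 0 \<Rightarrow> b0 | Suc 0 \<Rightarrow> c1 | Suc (Suc k) \<Rightarrow> b k)"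
    have g: "ramanujan_series (g i) (\<beta> i)" for i
    proof -
      have "ramanujan_series (cont lg) b0"
        by (rule ramanujan_series_cong[OF lg(2)]) (simp add: cont_eq[OF hollg])
      moreover have "ramanujan_series (\<lambda>s. deriv (cont L) s / cont L s) c1"
        by (rule ramanujan_series_cong[OF quot]) (simp add: contL dcont)
      moreover have "ramanujan_series (\<lambda>s. inverse (cont L s) ^ k) (b k)" for k
        by (rule ramanujan_series_cong[OF b]) (simp add: contL)
      ultimately show ?thesis by (auto simp: g_def \<beta>_def split: nat.split)
    qed
    have Lc: "ramanujan_series (cont L) a" by (rule ramanujan_series_cong[OF L]) (simp add: contL)
    have cc: "ramanujan_series (\<lambda>s. inverse (cont L s)) c" by (rule ramanujan_series_cong[OF c]) (simp add: contL)
    have blocks: "\<exists>J. (\<forall>\<^sub>F X in sequentially. real (card ({1..X} - J)) \<le> \<epsilon> * real X) \<and>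
        (\<forall>n\<in>J. n \<ge> 1 \<and> (\<forall>s\<in>half_strip l x1 \<delta>1 n. continues_to L s \<and> cont L s \<noteq> 0 \<and> continues_to lg s)) \<and>
        (\<forall>i. bdd_on_blocks l x1 \<delta>1 (g i) J)"
      if \<epsilon>: "\<epsilon> > 0" for \<epsilon>
    proof -
      have \<epsilon>2: "\<epsilon> / 2 > 0" using \<epsilon> by simp
      obtain J where J: "J \<subseteq> {1..}" "\<forall>\<^sub>F X in sequentially. real (card ({1..X} - J)) \<le> \<epsilon> / 2 * real X"
        "bdd_on_blocks l x0 \<delta>0 (cont L) J" "\<forall>n\<in>J. \<forall>s\<in>half_strip l x0 \<delta>0 n. continues_to L s"
        using blocksL[OF \<epsilon>2] by blast
      have nz: "cont L s \<noteq> 0" if "Re s > 1" for s using E(2)[OF that] contL[OF that] by simp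
      obtain J' where J': "J' \<subseteq> J" "\<forall>\<^sub>F X in sequentially. real (card ({1..X} \<inter> (J - J'))) \<le> \<epsilon> / 2 * real X"
        "\<forall>n\<in>J'. \<forall>s\<in>half_strip l x1 \<delta>1 n. cont L s \<noteq> 0" "bdd_on_blocks l x1 \<delta>1 (\<lambda>s. inverse (cont L s)) J'"
        using zero_free_blocks[OF assms(8) x(4,2,8) less_imp_le[OF \<delta>(3)] \<delta>(4) Lc cc nz J(3) \<epsilon>2] by blast
      have cnt: "\<forall>\<^sub>F X in sequentially. real (card ({1..X} - J')) \<le> \<epsilon> * real X"
        using J(2) J'(2)
      proof eventually_elim
        case (elim X)
        have "{1..X} - J' = ({1..X} - J) \<union> ({1..X} \<inter> (J - J'))" using J'(1) by auto
        then have "card ({1..X} - J') \<le> card ({1..X} - J) + card ({1..X} \<inter> (J - J'))"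
          by (simp only: card_Un_le)
        then have "real (card ({1..X} - J')) \<le> real (card ({1..X} - J)) + real (card ({1..X} \<inter> (J - J')))"
          by (simp only: of_nat_add[symmetric] of_nat_le_iff)
        then show ?case using elim by linarith
      qed
      have J0: "bdd_on_blocks l x0 \<delta>0 (cont L) J'" by (rule bdd_on_blocks_mono[OF J(3) _ _ J'(1)]) auto
      have J1: "bdd_on_blocks l x1 \<delta>1 (cont L) J'"
        by (rule bdd_on_blocks_mono[OF J(3) _ _ J'(1)]) (use x \<delta> in auto)
      have q: "bdd_on_blocks l x1 \<delta>1 (\<lambda>s. deriv (cont L) s / cont L s) J'"
        using bdd_on_blocks_mult[OF bdd_on_blocks_deriv[OF J0 x(2) \<delta>(4)] J'(4)] by (simp add: divide_inverse)
      have der: "(lg has_field_derivative deriv (cont L) s / cont L s) (at s)" if "Re s > 1" for s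
        using lg(3)[OF that] by (simp add: dcont[OF that] contL[OF that])
      note lgb = cont_log_blocks[OF assms(8) J1 q \<delta>(3) x(10) lg(2) der]
      have gb: "bdd_on_blocks l x1 \<delta>1 (g i) J'" for i
        using lgb(1) q bdd_on_blocks_power[OF J'(4)] by (auto simp: g_def split: nat.split)
      have sub: "half_strip l x1 \<delta>1 n \<subseteq> half_strip l x0 \<delta>0 n" for n
        by (rule half_strip_mono) (use x \<delta> in auto)
      show ?thesis
        using cnt gb J(1,4) J'(1,3) lgb(2) sub by (intro exI[of _ J']) blast
    qed
    obtain A where A: "l_set_density_zero l A"
      "\<And>t. t \<in> {1..} - A \<Longrightarrow> \<exists>n. (\<forall>s\<in>half_strip l x1 \<delta>1 n. continues_to L s \<and> cont L s \<noteq> 0 \<and> continues_to lg s) \<and>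
          real n * l \<le> t \<and> t < (real n + 1) * l"
      "\<And>i. uniform_mean_value_series \<alpha> A (\<lambda>s. cmod (g i s) ^ 2) (\<beta> i)"
      by (rule uniform_mean_values_family[OF assms(8) x(9,3,7) \<delta>(3) g blocks]) blast+
    have cont_A: "continues_to L (Complex \<sigma> t) \<and> cont L (Complex \<sigma> t) \<noteq> 0 \<and> continues_to lg (Complex \<sigma> t)"
      if "\<sigma> \<in> {\<alpha>..2}" "t \<in> {1..} - A" for \<sigma> t
      using A(2)[OF that(2)] in_strip[OF that(1) _ _ x(3) \<delta>(3)] by blast
    have pow: "cmod (inverse z ^ k) ^ 2 = inverse (cmod z ^ (2 * k))" for z k
      by (simp add: norm_power norm_inverse power_inverse mult.commute flip: power_mult)
    have inv: "\<exists>b. has_dirichlet_expansion (\<lambda>s. inverse (L s ^ k)) b \<and>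
                uniform_mean_value_series \<alpha> A (\<lambda>s. inverse (cmod (cont L s) ^ (2 * k))) b" for k
    proof (intro exI conjI)
      show "has_dirichlet_expansion (\<lambda>s. inverse (L s ^ k)) (b k)"
        using b[of k] by (simp add: ramanujan_series_def power_inverse)
      show "uniform_mean_value_series \<alpha> A (\<lambda>s. inverse (cmod (cont L s) ^ (2 * k))) (b k)"
        using A(3)[of "Suc (Suc k)"] unfolding g_def \<beta>_def nat.case pow .
    qed
    have "uniform_mean_value_series \<alpha> A (\<lambda>s. cmod (cont lg s) ^ 2) b0"
      "uniform_mean_value_series \<alpha> A (\<lambda>s. cmod (deriv (cont L) s / cont L s) ^ 2) c1"
      using A(3)[of 0] A(3)[of 1] by (simp_all add: g_def \<beta>_def)
    moreover have "has_dirichlet_expansion lg b0" "has_dirichlet_expansion (\<lambda>s. deriv L s / L s) c1"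
      using lg(2) quot by (simp_all add: ramanujan_series_def)
    ultimately show ?thesis
      using lg(1) A(1) cont_A inv by blast
  qed
  show ?thesis using part1 part2 by blast
qed

end
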